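(* Let $f$ be a Rademacher random multiplicative function and $\zeta(r):=\sum_{n\geq 1}n^{-r}$ for $r>1$. Then $$C\Big(\Big(\Big(\frac{1}{2\log 1/s\, \log\log\log 1/s}\Big)^{1/2}\Big(\log \sum_{n\geq 1}\frac{f(n)}{n^{1/2+s}}+\frac{\log \zeta(1+2s)}{2}\Big):\ s\in(0,\mathrm{e}^{-\mathrm{e}})\Big)\Big)=[-1,1]\quad\text{a.s.}$$
   Context: A Rademacher random multiplicative function $f$ is defined as follows: $(f(p))_{p\text{ prime}}$ are independent random variables with $\mathbb{P}\{f(p)=1\}=\mathbb{P}\{f(p)=-1\}=1/2$; $f(1):=1$; $f(n):=\prod_{p\mid n}f(p)$ (product over the prime divisors of $n$) if $n$ is square-free; and $f(n):=0$ if $n$ is not square-free. For $s>0$ the series $F(s):=\sum_{n\ge1}f(n)n^{-1/2-s}$ converges a.s. and has the Euler product representation $F(s)=\prod_p\big(1+f(p)p^{-1/2-s}\big)$ (product over primes), which is strictly positive, so that $\log F(s)$ is real-valued. For a family $(x_s)$ of real numbers, $C((x_s))$ denotes the set of its limit points as $s\to 0+$. *)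

theory Defs
  imports "HOL-Probability.Probability" "HOL-Computational_Algebra.Computational_Algebra"
begin

text \<open>The value \<open>f 0\<close> is left unconstrained; it is never used.\<close>

locale rademacher_multiplicative = prob_space M for M :: "'a measure" +
  fixes f :: "nat \<Rightarrow> 'a \<Rightarrow> real"
  assumes indep: "indep_vars (\<lambda>_. borel) f {p. prime p}"
    and prob_plus: "prime p \<Longrightarrow> prob {\<omega> \<in> space M. f p \<omega> = 1} = 1 / 2"
    and prob_minus: "prime p \<Longrightarrow> prob {\<omega> \<in> space M. f p \<omega> = -1} = 1 / 2"
    and f_one: "\<omega> \<in> space M \<Longrightarrow> f 1 \<omega> = 1"
    and f_squarefree: "\<omega> \<in> space M \<Longrightarrow> n \<ge> 1 \<Longrightarrow> squarefree n \<Longrightarrow>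
      f n \<omega> = (\<Prod>p\<in>prime_factors n. f p \<omega>)"
    and f_not_squarefree: "\<omega> \<in> space M \<Longrightarrow> n \<ge> 1 \<Longrightarrow> \<not> squarefree n \<Longrightarrow> f n \<omega> = 0"

text \<open>Series over \<open>n \<ge> 1\<close> are indexed by \<open>Suc n\<close> with \<open>n \<ge> 0\<close>. The first one converges
  only conditionally in general, so it is the limit of its partial sums in the natural order.\<close>

definition dirichlet_F :: "(nat \<Rightarrow> 'a \<Rightarrow> real) \<Rightarrow> 'a \<Rightarrow> real \<Rightarrow> real" where
  "dirichlet_F f \<omega> s = (\<Sum>n. f (Suc n) \<omega> / real (Suc n) powr (1 / 2 + s))"

definition zeta_real :: "real \<Rightarrow> real" where
  "zeta_real r = (\<Sum>n. real (Suc n) powr (- r))"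

text \<open>Limit points of a family \<open>x\<close> along a filter, as limits along sequences of indices
  tending to the filter.\<close>

definition limit_points :: "'b filter \<Rightarrow> ('b \<Rightarrow> real) \<Rightarrow> real set" where
  "limit_points F x =
     {l. \<exists>s :: nat \<Rightarrow> 'b. filterlim s F sequentially \<and> (\<lambda>k. x (s k)) \<longlonglongrightarrow> l}"

end

theory Submission
  imports Defs "HOL-Real_Asymp.Real_Asymp"
begin

text \<open>
  Taking logarithms in the Euler product and expanding \<open>ln (1 + x)\<close> with a remainder of third order
  gives, up to a bounded error,
  \<open>ln F(s) = X(s) - P(1 + 2 s) / 2\<close>, where \<open>X(s) = \<Sum>\<^sub>p f(p) p\<^sup>-\<^sup>1\<^sup>/\<^sup>2\<^sup>-\<^sup>s\<close> and \<open>P(r) = \<Sum>\<^sub>p p\<^sup>-\<^sup>r\<close> is the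
  prime zeta function; moreover \<open>P(r) = ln (\<zeta> r)\<close> up to a bounded error. The quantity in the
  statement is therefore \<open>X(s) / lil_norm s\<close> up to a term that tends to zero, and the claim becomes a
  law of the iterated logarithm for \<open>X(s)\<close>, a sum of independent symmetric terms with variance
  \<open>P(1 + 2 s) = ln (1 / s) + O(1)\<close>. The size of \<open>P\<close> follows from comparing finite Euler products with
  the zeta function, which in turn is compared with \<open>1 / (r - 1)\<close>.

  Upper bound (\<open>AE_eventually_le\<close>). Along \<open>s\<^sub>k = exp (- \<rho>\<^sup>k)\<close> the maximal inequality for partial sums of
  random signs and the first Borel-Cantelli lemma bound all partial sums of \<open>X(s\<^sub>k)\<close> simultaneously.
  For \<open>s \<ge> s\<^sub>k\<close> the series \<open>X(s)\<close> arises from that of \<open>X(s\<^sub>k)\<close> by multiplication with decreasing weights in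
  \<open>[0, 1]\<close>, so that summation by parts carries the same bound over to all \<open>s \<ge> s\<^sub>k\<close>, in
  particular to the gap between consecutive points.

  Lower bound (\<open>AE_frequently_ge\<close>). Along \<open>s\<^sub>j = exp (- R\<^sup>j\<^sup>+\<^sup>1)\<close> with \<open>R\<close> large, almost all of the variance
  of \<open>X(s\<^sub>j)\<close> sits on a block of primes, and these blocks are disjoint. The block sums are independent,
  their large values have probability at least of order \<open>1 / j\<close> by an exponential change of measure,
  and the converse Borel-Cantelli lemma applies. What is left of \<open>X(s\<^sub>j)\<close> has a small variance and is
  controlled by the maximal inequality.

  Since \<open>X\<close> is continuous, the intermediate value theorem turns the two bounds, applied to \<open>X\<close> and to
  \<open>- X\<close>, into the full interval of limit points.

  The convergence of the Dirichlet series \<open>F(s)\<close> and \<open>X(s)\<close> for all \<open>s > 0\<close> at once is the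
  Rademacher-Menshov argument for orthogonal random variables (\<open>AE_dirichlet_summable\<close>). The Euler
  product is obtained in mean square: for fixed \<open>s\<close> the finite products and the partial sums of the series
  have a difference that tends to zero in mean square, so they agree in the limit along a
  subsequence. This gives the logarithmic expansion for all rational \<open>s\<close>, and by continuity for
  all \<open>s > 0\<close> (\<open>AE_ln_F\<close>).
\<close>

section \<open>Summation by parts and Dirichlet series\<close>

lemma sum_mult_by_parts:
  fixes a w :: "nat \<Rightarrow> real"
  shows "(\<Sum>i<n. a i * w i) = (\<Sum>i<n. (\<Sum>j\<le>i. a j) * (w i - w (Suc i))) + (\<Sum>j<n. a j) * w n"
  by (induction n) (auto simp: algebra_simps lessThan_Suc_atMost[symmetric])

text \<open>Summation by parts writes the weighted sum as a combination of the partial sums with nonnegative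
  coefficients of total mass \<open>w 0\<close>. The bound is one-sided, as in the maximal
  inequality to which it will be applied.\<close>

lemma weighted_sum_le:
  fixes a w :: "nat \<Rightarrow> real"
  assumes "\<And>k. k \<le> n \<Longrightarrow> (\<Sum>i<k. a i) \<le> B" "0 \<le> B" "decseq w" "\<And>i. 0 \<le> w i"
  shows "(\<Sum>i<n. a i * w i) \<le> B * w 0"
proof -
  have "(\<Sum>i<n. a i * w i) \<le> (\<Sum>i<n. B * (w i - w (Suc i))) + B * w n"
    unfolding sum_mult_by_parts[of a w n] using assms(1)[of "Suc i" for i] assms
    by (intro add_mono sum_mono mult_right_mono)
       (auto simp: lessThan_Suc_atMost[symmetric] decseq_Suc_iff Suc_le_eq)
  also have "\<dots> = B * w 0"
    unfolding sum_distrib_left[symmetric] by (simp add: sum_lessThan_telescope' algebra_simps)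
  finally show ?thesis .
qed

lemma Suc_powr_minus_decseq: "0 \<le> d \<Longrightarrow> decseq (\<lambda>i. real (Suc i) powr (-d))"
  by (intro decseq_SucI powr_mono2') auto

text \<open>The weights \<open>(i + 1)\<^sup>-\<^sup>d\<close> decrease and are at most 1 for every \<open>d \<ge> 0\<close>, so that each block of the
  weighted series is bounded, uniformly in \<open>d\<close>, by the partial sums of the same block of \<open>b\<close>.\<close>

lemma dirichlet_uniformly_convergent:
  fixes b :: "nat \<Rightarrow> real"
  assumes "summable b"
  shows "uniformly_convergent_on {0..} (\<lambda>n d. \<Sum>i<n. b i * real (Suc i) powr (-d))"
  unfolding uniformly_convergent_eq_Cauchy
proof (rule uniformly_Cauchy_onI')
  fix e :: real assume e: "e > 0"
  from summable_Cauchy[THEN iffD1, OF assms] e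
  obtain N where N: "\<And>m n. m \<ge> N \<Longrightarrow> norm (sum b {m..<n}) < e / 2"
    by (meson half_gt_zero)
  show "\<exists>M. \<forall>d\<in>{0..}. \<forall>m\<ge>M. \<forall>n>m.
      dist (\<Sum>i<m. b i * real (Suc i) powr (-d)) (\<Sum>i<n. b i * real (Suc i) powr (-d)) < e"
  proof (intro exI[of _ N] ballI allI impI)
    fix d :: real and m n :: nat assume d: "d \<in> {0..}" and mn: "m \<ge> N" "m < n"
    define w where "w i = real (Suc (i + m)) powr (-d)" for i
    have w: "decseq w" "\<And>i. 0 \<le> w i"
      using d by (auto simp: w_def intro!: decseq_SucI powr_mono2')
    have w0: "w 0 \<le> 1"
      using d powr_mono[of "-d" 0 "real (Suc m)"] unfolding w_def by simp
    have part: "(\<Sum>i<k. b (i + m)) \<le> e / 2" "(\<Sum>i<k. - b (i + m)) \<le> e / 2" for k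
    proof -
      have "(\<Sum>i<k. b (i + m)) = sum b {m..<m + k}"
        by (rule sum.reindex_bij_witness[of _ "\<lambda>i. i - m" "\<lambda>i. i + m"]) auto
      thus "(\<Sum>i<k. b (i + m)) \<le> e / 2" "(\<Sum>i<k. - b (i + m)) \<le> e / 2"
        using N[OF mn(1), of "m + k"] by (auto simp: sum_negf)
    qed
    have "(\<Sum>i<n-m. b (i+m) * w i) \<le> e / 2 * w 0"
      using part(1) e w by (intro weighted_sum_le) auto
    moreover have "(\<Sum>i<n-m. (- b (i+m)) * w i) \<le> e / 2 * w 0"
      using part(2) e w by (intro weighted_sum_le) auto
    moreover have "e / 2 * w 0 \<le> e / 2" using w0 e by simp
    ultimately have *: "\<bar>\<Sum>i<n-m. b (i+m) * w i\<bar> < e"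
      unfolding mult_minus_left sum_negf using e by linarith
    have "(\<Sum>i<n. b i * real (Suc i) powr (-d)) - (\<Sum>i<m. b i * real (Suc i) powr (-d))
      = (\<Sum>i\<in>{m..<n}. b i * real (Suc i) powr (-d))"
      using mn by (simp add: sum_diff_nat_ivl atLeast0LessThan[symmetric])
    also have "\<dots> = (\<Sum>i<n-m. b (i+m) * w i)"
      unfolding w_def
      by (rule sum.reindex_bij_witness[of _ "\<lambda>i. i + m" "\<lambda>i. i - m"]) (use mn in auto)
    finally show "dist (\<Sum>i<m. b i * real (Suc i) powr (-d)) (\<Sum>i<n. b i * real (Suc i) powr (-d)) < e"
      using * by (simp add: dist_real_def abs_minus_commute)
  qed
qed

text \<open>Near \<open>s > 0\<close> the terms are written as \<open>a n (n + 1)\<^sup>-\<^sup>s\<^sup>/\<^sup>2\<close>, which is summable, times weights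
  \<open>(n + 1)\<^sup>-\<^sup>d\<close> with \<open>d \<ge> 0\<close>; the convergence is then locally uniform although it may be conditional.\<close>

lemma dirichlet_continuous:
  fixes a :: "nat \<Rightarrow> real"
  assumes "\<And>s. s > 0 \<Longrightarrow> summable (\<lambda>n. a n * real (Suc n) powr (-s))"
  shows "continuous_on {0<..} (\<lambda>s. \<Sum>n. a n * real (Suc n) powr (-s))"
proof (subst continuous_on_eq_continuous_at, simp, intro ballI)
  fix s :: real assume s: "s \<in> {0<..}"
  define b where "b n = a n * real (Suc n) powr (-(s/2))" for n
  have "summable b" unfolding b_def using assms[of "s/2"] s by simp
  from uniformly_convergent_uniform_limit_iff[THEN iffD1, OF dirichlet_uniformly_convergent[OF this]]
  have "uniform_limit {0..} (\<lambda>n d. \<Sum>i<n. b i * real (Suc i) powr (-d))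
     (\<lambda>d. lim (\<lambda>n. \<Sum>i<n. b i * real (Suc i) powr (-d))) sequentially" .
  hence "continuous_on {0..} (\<lambda>d. lim (\<lambda>n. \<Sum>i<n. b i * real (Suc i) powr (-d)))"
    by (rule uniform_limit_theorem[rotated]) (auto intro!: always_eventually continuous_intros)
  hence cont: "continuous_on {s/2..} (\<lambda>t. lim (\<lambda>n. \<Sum>i<n. b i * real (Suc i) powr (-(t - s/2))))"
    by (rule continuous_on_compose2) (auto intro!: continuous_intros)
  have "b i * real (Suc i) powr (-(t - s/2)) = a i * real (Suc i) powr (-t)" for i t
    unfolding b_def by (simp add: powr_add[symmetric] mult.assoc)
  with cont have "continuous_on {s/2..} (\<lambda>t. \<Sum>n. a n * real (Suc n) powr (-t))"
    by (simp add: suminf_eq_lim)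
  hence "continuous_on {s/2<..} (\<lambda>t. \<Sum>n. a n * real (Suc n) powr (-t))"
    by (rule continuous_on_subset) auto
  thus "isCont (\<lambda>s. \<Sum>n. a n * real (Suc n) powr (-s)) s"
    using s by (simp add: continuous_on_eq_continuous_at)
qed

section \<open>Squarefree numbers and the prime zeta function\<close>

definition smooth_squarefree :: "nat set \<Rightarrow> nat set" where
  "smooth_squarefree P = {n. squarefree n \<and> prime_factors n \<subseteq> P}"

lemma prod_prime_factors_squarefree:
  fixes n :: nat assumes "squarefree n" shows "\<Prod>(prime_factors n) = n"
proof -
  have n: "n \<noteq> 0" using assms by (metis not_squarefree_0)
  have "n = (\<Prod>p\<in>prime_factors n. p ^ multiplicity p n)"
    using prime_factorization_nat[of n] n by simp
  also have "\<dots> = (\<Prod>p\<in>prime_factors n. p)"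
    using assms n by (intro prod.cong) (auto simp: squarefree_factorial_semiring')
  finally show ?thesis by simp
qed

lemma prod_primes:
  fixes X :: "nat set" assumes "finite X" "\<And>p. p \<in> X \<Longrightarrow> prime p"
  shows "squarefree (\<Prod>X)" "prime_factors (\<Prod>X) = X"
proof -
  show "squarefree (\<Prod>X)"
    using assms by (intro squarefree_prod_coprime) (auto intro: squarefree_prime primes_coprime)
  have "0 \<notin> X" using assms(2)[of 0] by auto
  with assms have "prime_factors (\<Prod>X) = (\<Union>x\<in>X. prime_factors x)"
    by (subst prime_factors_prod) auto
  also have "\<dots> = X" using assms by (auto simp: prime_prime_factors)
  finally show "prime_factors (\<Prod>X) = X" .
qed

text \<open>A squarefree number is determined by its set of prime factors. This is what makes the expansion of
  a finite product over primes a sum over squarefree numbers.\<close>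

lemma bij_betw_smooth_squarefree:
  assumes "finite P" "\<And>p. p \<in> P \<Longrightarrow> prime p"
  shows "bij_betw (\<lambda>X. \<Prod>X) (Pow P) (smooth_squarefree P)"
proof (rule bij_betw_byWitness[where f' = prime_factors])
  show "\<forall>X\<in>Pow P. prime_factors (\<Prod>X) = X"
    using assms by (intro ballI prod_primes) (auto intro: finite_subset)
  show "\<forall>n\<in>smooth_squarefree P. \<Prod>(prime_factors n) = n"
    by (auto simp: smooth_squarefree_def prod_prime_factors_squarefree)
  show "Prod ` Pow P \<subseteq> smooth_squarefree P"
  proof
    fix n assume "n \<in> Prod ` Pow P"
    then obtain X where X: "X \<subseteq> P" "n = \<Prod>X" by auto
    have "finite X" "\<And>p. p \<in> X \<Longrightarrow> prime p" using X assms by (auto intro: finite_subset)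
    from prod_primes[OF this] X show "n \<in> smooth_squarefree P"
      by (auto simp: smooth_squarefree_def)
  qed
  show "prime_factors ` smooth_squarefree P \<subseteq> Pow P"
    by (auto simp: smooth_squarefree_def)
qed

lemma finite_smooth_squarefree:
  assumes "finite P" "\<And>p. p \<in> P \<Longrightarrow> prime p"
  shows "finite (smooth_squarefree P)"
  using bij_betw_finite[OF bij_betw_smooth_squarefree[OF assms]] assms by simp

lemma prod_one_plus_primes:
  fixes g :: "nat \<Rightarrow> real"
  assumes "finite P" "\<And>p. p \<in> P \<Longrightarrow> prime p"
  shows "(\<Prod>p\<in>P. 1 + g p) = (\<Sum>n\<in>smooth_squarefree P. \<Prod>p\<in>prime_factors n. g p)"
proof -
  have "(\<Prod>p\<in>P. 1 + g p) = (\<Prod>p\<in>P. g p + 1)" by (simp add: add.commute)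
  also have "\<dots> = (\<Sum>X\<in>Pow P. \<Prod>p\<in>X. g p)"
    using prod_add[OF assms(1), of g "\<lambda>_. 1"] by simp
  also have "\<dots> = (\<Sum>X\<in>Pow P. \<Prod>p\<in>prime_factors (\<Prod>X). g p)"
  proof (intro sum.cong refl)
    fix X assume "X \<in> Pow P"
    hence "finite X" "\<And>p. p \<in> X \<Longrightarrow> prime p" using assms by (auto intro: finite_subset)
    thus "prod g X = prod g (prime_factors (\<Prod>X))" by (simp only: prod_primes)
  qed
  also have "\<dots> = (\<Sum>n\<in>smooth_squarefree P. \<Prod>p\<in>prime_factors n. g p)"
    by (rule sum.reindex_bij_betw[OF bij_betw_smooth_squarefree[OF assms]])
  finally show ?thesis .
qed

lemma prod_powr_prime_factors:
  assumes "squarefree (n::nat)"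
  shows "(\<Prod>p\<in>prime_factors n. real p powr r) = real n powr r"
proof -
  have "real n powr r = (\<Prod>p\<in>prime_factors n. real p) powr r"
    using prod_prime_factors_squarefree[OF assms] by (metis of_nat_prod prod.cong)
  thus ?thesis by (simp add: prod_powr_distrib)
qed

lemma prod_one_plus_powr_primes:
  assumes "finite P" "\<And>p. p \<in> P \<Longrightarrow> prime p"
  shows "(\<Prod>p\<in>P. 1 + real p powr r) = (\<Sum>n\<in>smooth_squarefree P. real n powr r)"
proof -
  have "(\<Prod>p\<in>P. 1 + real p powr r) = (\<Sum>n\<in>smooth_squarefree P. \<Prod>p\<in>prime_factors n. real p powr r)"
    by (rule prod_one_plus_primes[OF assms])
  also have "\<dots> = (\<Sum>n\<in>smooth_squarefree P. real n powr r)"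
    by (intro sum.cong refl prod_powr_prime_factors) (auto simp: smooth_squarefree_def)
  finally show ?thesis .
qed

lemma zeta_real_summable: "r > 1 \<Longrightarrow> summable (\<lambda>n. real (Suc n) powr (-r))"
  using summable_Suc_iff[of "\<lambda>n. real n powr (-r)"] summable_real_powr_iff[of "-r"] by simp

text \<open>Comparison of \<open>n\<^sup>-\<^sup>r\<close> with the increments of the antiderivative \<open>x\<^sup>1\<^sup>-\<^sup>r / (1 - r)\<close>, which telescope to
  \<open>1 / (r - 1)\<close>.\<close>

lemma zeta_real_bounds:
  assumes "r > 1"
  shows "1 / (r - 1) \<le> zeta_real r" "zeta_real r \<le> r / (r - 1)"
proof -
  define g where "g n = real (Suc n) powr (1 - r) / (r - 1)" for n
  have step: "real (Suc (Suc n)) powr (-r) \<le> g n - g (Suc n) \<and>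
              g n - g (Suc n) \<le> real (Suc n) powr (-r)" for n
  proof -
    have "\<exists>z. real (Suc n) < z \<and> z < real (Suc (Suc n)) \<and>
       real (Suc (Suc n)) powr (1 - r) / (r - 1) - real (Suc n) powr (1 - r) / (r - 1) =
       (real (Suc (Suc n)) - real (Suc n)) * (- (z powr (-r)))"
    proof (rule MVT2)
      fix x assume "real (Suc n) \<le> x" "x \<le> real (Suc (Suc n))"
      hence "x > 0" by simp
      hence "((\<lambda>x. x powr (1 - r) / (r - 1)) has_real_derivative (1 - r) * x powr (1 - r - 1) / (r - 1)) (at x)"
        by (intro DERIV_cdivide has_real_derivative_powr)
      moreover have "(1 - r) * x powr (1 - r - 1) / (r - 1) = - (x powr (-r))"
        using assms by (simp add: divide_eq_eq algebra_simps)
      ultimately show "((\<lambda>x. x powr (1 - r) / (r - 1)) has_real_derivative - (x powr (-r))) (at x)"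
        by simp
    qed simp
    then obtain z where z: "real (Suc n) < z" "z < real (Suc (Suc n))"
      "g n - g (Suc n) = z powr (-r)" by (auto simp: g_def)
    have "real (Suc (Suc n)) powr (-r) \<le> z powr (-r)" "z powr (-r) \<le> real (Suc n) powr (-r)"
      using z assms by (auto intro!: powr_mono2')
    with z show ?thesis by simp
  qed
  have "g \<longlonglongrightarrow> 0" unfolding g_def using assms by real_asymp
  from telescope_sums'[OF this] have sums: "(\<lambda>n. g n - g (Suc n)) sums (1 / (r - 1))"
    by (simp add: g_def)
  note sm = zeta_real_summable[OF assms]
  show "1 / (r - 1) \<le> zeta_real r"
    unfolding zeta_real_def using sums step by (intro sums_le[OF _ sums summable_sums[OF sm]]) auto
  have "(\<Sum>n. real (Suc (Suc n)) powr (-r)) \<le> 1 / (r - 1)"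
    using step summable_ignore_initial_segment[OF sm, of 1]
    by (intro sums_le[OF _ summable_sums sums]) auto
  moreover have "(\<Sum>n. real (Suc (Suc n)) powr (-r)) = zeta_real r - 1"
    using suminf_split_head[OF sm] by (simp add: zeta_real_def)
  ultimately have "zeta_real r - 1 \<le> 1 / (r - 1)" by simp
  moreover have "r / (r - 1) = 1 + 1 / (r - 1)" using assms by (simp add: field_simps)
  ultimately show "zeta_real r \<le> r / (r - 1)" by simp
qed

definition prime_zeta :: "real \<Rightarrow> real" where
  "prime_zeta r = (\<Sum>n. if prime (Suc n) then real (Suc n) powr (-r) else 0)"

lemma prime_zeta_summable:
  assumes "r > 1"
  shows "summable (\<lambda>n. if prime (Suc n) then real (Suc n) powr (-r) else 0)"
  by (rule summable_comparison_test'[OF zeta_real_summable[OF assms], of 0]) auto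

text \<open>Series over positive integers are indexed by \<open>Suc i\<close>; this converts between that indexing and finite sums
  over primes.\<close>

lemma sum_primes_Suc:
  fixes g :: "nat \<Rightarrow> real"
  shows "(\<Sum>i<N. if prime (Suc i) then g (Suc i) else 0) = (\<Sum>p | prime p \<and> p \<le> N. g p)"
proof -
  have "(\<Sum>i<N. if prime (Suc i) then g (Suc i) else 0) = (\<Sum>i | i < N \<and> prime (Suc i). g (Suc i))"
    by (rule sum.mono_neutral_cong_right) auto
  also have "\<dots> = (\<Sum>p | prime p \<and> p \<le> N. g p)"
    by (rule sum.reindex_bij_witness[of _ "\<lambda>p. p - 1" Suc]) (auto simp: prime_gt_0_nat Suc_le_eq dest: prime_gt_0_nat)
  finally show ?thesis .
qed

lemma sum_prime_index_le_prime_zeta: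
  assumes "s > 0"
  shows "(\<Sum>i\<in>{i. prime (Suc i) \<and> i < n}. real (Suc i) powr (-(1 + 2 * s))) \<le> prime_zeta (1 + 2 * s)"
proof -
  have "(\<Sum>i\<in>{i. prime (Suc i) \<and> i < n}. real (Suc i) powr (-(1 + 2 * s))) = 
     (\<Sum>i<n. if prime (Suc i) then real (Suc i) powr (-(1 + 2 * s)) else 0)"
    by (rule sum.mono_neutral_cong_left) auto
  also have "\<dots> \<le> prime_zeta (1 + 2 * s)"
    unfolding prime_zeta_def using assms by (intro sum_le_suminf prime_zeta_summable) auto
  finally show ?thesis .
qed

lemma square_powr_half: "(x powr (-(1 / 2 + s)))\<^sup>2 = x powr (-(1 + 2 * s))" for x s :: real
  unfolding power2_eq_square powr_add[symmetric] by (rule arg_cong[where f = "(powr) x"]) simp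

lemma finite_primes_le: "finite {p::nat. prime p \<and> p \<le> N}"
  by (rule finite_subset[of _ "{..N}"]) auto

lemma sum_le_zeta_real:
  assumes "r > 1" "finite A" "0 \<notin> A"
  shows "(\<Sum>n\<in>A. real n powr (-r)) \<le> zeta_real r"
proof -
  have "(\<Sum>n\<in>A. real n powr (-r)) = (\<Sum>n\<in>(\<lambda>n. n - 1) ` A. real (Suc n) powr (-r))"
  proof (rule sum.reindex_bij_witness[of _ Suc "\<lambda>n. n - 1"])
    have *: "Suc (a - 1) = a" if "a \<in> A" for a using that assms(3) by (cases a) auto
    show "Suc (a - 1) = a" if "a \<in> A" for a by (rule *[OF that])
    show "Suc b \<in> A" if "b \<in> (\<lambda>n. n - 1) ` A" for b using that * by force
    show "real (Suc (a - 1)) powr - r = real a powr - r" if "a \<in> A" for a using *[OF that] by simp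
  qed auto
  also have "\<dots> \<le> zeta_real r"
    unfolding zeta_real_def using assms by (intro sum_le_suminf zeta_real_summable) auto
  finally show ?thesis .
qed

text \<open>Every \<open>n \<le> N\<close> is a square times a squarefree number with prime factors at most \<open>N\<close>. Summing over all
  such pairs bounds the partial sums of the zeta function by \<open>\<zeta> 2\<close> times a finite product
  \<open>\<Prod>\<^sub>p (1 + p\<^sup>-\<^sup>r)\<close>, and \<open>1 + x \<le> exp x\<close>.\<close>

lemma ln_zeta_real_le:
  assumes "r > 1"
  shows "ln (zeta_real r) \<le> ln (zeta_real 2) + prime_zeta r"
proof -
  have pos: "zeta_real r > 0" "zeta_real 2 > 0" if "r > 1" for r
    using zeta_real_bounds(1)[of r] zeta_real_bounds(1)[of 2] that
    by (auto intro: less_le_trans[rotated])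
  have "(\<Sum>i<N. real (Suc i) powr (-r)) \<le> zeta_real 2 * exp (prime_zeta r)" for N
  proof -
    define P where "P = {p. prime p \<and> p \<le> N}"
    have P: "finite P" "\<And>p. p \<in> P \<Longrightarrow> prime p" by (auto simp: P_def finite_primes_le)
    let ?h = "\<lambda>n::nat. (square_part n, squarefree_part n)"
    have inj: "inj_on ?h A" for A
      by (rule inj_onI) (metis prod.inject squarefree_decompose)
    have "(\<Sum>i<N. real (Suc i) powr (-r)) = (\<Sum>n\<in>{1..N}. real n powr (-r))"
      by (rule sum.reindex_bij_witness[of _ "\<lambda>p. p - 1" Suc]) auto
    also have "\<dots> = (\<Sum>n\<in>{1..N}. (\<lambda>(m,q). real m powr (-(2*r)) * real q powr (-r)) (?h n))"
    proof (rule sum.cong)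
      fix n :: nat
      have "real n = real (squarefree_part n * (square_part n)\<^sup>2)"
        using squarefree_decompose[of n] by simp
      hence "real n = real (squarefree_part n) * real (square_part n) powr 2"
        by simp
      hence "real n powr (-r) = real (squarefree_part n) powr (-r) * (real (square_part n) powr 2) powr (-r)"
        by (simp add: powr_mult del: powr_numeral)
      thus "real n powr (-r) = (\<lambda>(m,q). real m powr (-(2*r)) * real q powr (-r)) (?h n)"
        by (simp add: powr_powr del: powr_numeral)
    qed simp
    also have "\<dots> = (\<Sum>(m,q)\<in>?h ` {1..N}. real m powr (-(2*r)) * real q powr (-r))"
      by (subst sum.reindex[OF inj]) simp
    also have "\<dots> \<le> (\<Sum>(m,q)\<in>{1..N} \<times> smooth_squarefree P. real m powr (-(2*r)) * real q powr (-r))"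
    proof (rule sum_mono2)
      show "?h ` {1..N} \<subseteq> {1..N} \<times> smooth_squarefree P"
      proof (clarsimp, intro conjI)
        fix n assume n: "Suc 0 \<le> n" "n \<le> N"
        have d: "square_part n dvd n" "squarefree_part n dvd n"
          using squarefree_decompose[of n] by (metis dvd_mult dvd_power dvd_triv_left zero_less_numeral)+
        show "Suc 0 \<le> square_part n" using n
          by (metis Suc_leI bot_nat_0.not_eq_extremum not_one_le_zero One_nat_def square_part_0_iff)
        show "square_part n \<le> N" using d n dvd_imp_le[of "square_part n" n] by linarith
        show "squarefree_part n \<in> smooth_squarefree P"
          unfolding smooth_squarefree_def P_def
        proof (safe)
          fix p assume p: "p \<in> prime_factors (squarefree_part n)"
          thus "prime p" by auto
          have "p dvd n" using p d by (meson dvd_trans in_prime_factors_iff)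
          thus "p \<le> N" using n dvd_imp_le[of p n] by linarith
        qed auto
      qed
    qed (auto simp: finite_smooth_squarefree[OF P])
    also have "\<dots> = (\<Sum>m\<in>{1..N}. real m powr (-(2*r))) * (\<Sum>q\<in>smooth_squarefree P. real q powr (-r))"
      by (simp add: sum_product sum.cartesian_product)
    also have "\<dots> \<le> zeta_real 2 * exp (prime_zeta r)"
    proof (rule mult_mono)
      have "(\<Sum>m\<in>{1..N}. real m powr (-(2*r))) \<le> (\<Sum>m\<in>{1..N}. real m powr (-2))"
        using assms by (intro sum_mono powr_mono) auto
      also have "\<dots> \<le> zeta_real 2" by (intro sum_le_zeta_real) auto
      finally show "(\<Sum>m\<in>{1..N}. real m powr (-(2*r))) \<le> zeta_real 2" .
      have "(\<Sum>q\<in>smooth_squarefree P. real q powr (-r)) = (\<Prod>p\<in>P. 1 + real p powr (-r))"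
        by (rule prod_one_plus_powr_primes[OF P, symmetric])
      also have "\<dots> \<le> (\<Prod>p\<in>P. exp (real p powr (-r)))"
        by (intro prod_mono) (auto simp: add_nonneg_nonneg)
      also have "\<dots> = exp (\<Sum>p\<in>P. real p powr (-r))" using P by (simp add: exp_sum)
      also have "(\<Sum>p\<in>P. real p powr (-r)) = (\<Sum>i<N. if prime (Suc i) then real (Suc i) powr (-r) else 0)"
        unfolding P_def by (rule sum_primes_Suc[symmetric])
      also have "\<dots> \<le> prime_zeta r" unfolding prime_zeta_def
        using assms by (intro sum_le_suminf prime_zeta_summable) auto
      finally show "(\<Sum>q\<in>smooth_squarefree P. real q powr (-r)) \<le> exp (prime_zeta r)" by simp
    qed (use pos[OF assms] in \<open>auto intro: sum_nonneg less_imp_le\<close>)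
    finally show ?thesis .
  qed
  hence "zeta_real r \<le> zeta_real 2 * exp (prime_zeta r)"
    unfolding zeta_real_def[of r] using zeta_real_summable[OF assms] by (intro suminf_le_const) auto
  hence "ln (zeta_real r) \<le> ln (zeta_real 2 * exp (prime_zeta r))"
    using pos[OF assms] by simp
  thus ?thesis using pos[of 2] by (simp add: ln_mult)
qed

text \<open>The converse comparison: the expanded product \<open>\<Prod>\<^sub>p (1 + p\<^sup>-\<^sup>r)\<close> contains each squarefree number only
  once, hence is at most \<open>\<zeta> r\<close>, and \<open>ln (1 + x) \<ge> x - x\<^sup>2\<close>.\<close>

lemma prime_zeta_le:
  assumes "r > 1"
  shows "prime_zeta r \<le> ln (zeta_real r) + zeta_real 2"
proof -
  have "(\<Sum>i<N. if prime (Suc i) then real (Suc i) powr (-r) else 0) \<le> ln (zeta_real r) + zeta_real 2" for N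
  proof -
    define P where "P = {p. prime p \<and> p \<le> N}"
    have P: "finite P" "\<And>p. p \<in> P \<Longrightarrow> prime p" by (auto simp: P_def finite_primes_le)
    have pos: "real p powr (-r) > 0" "real p powr (-r) \<le> 1" if "p \<in> P" for p
      using P(2)[OF that] assms powr_mono[of "-r" 0 "real p"] by (auto simp: prime_gt_0_nat Suc_leI)
    have "(\<Sum>p\<in>P. real p powr (-r) - real p powr (-2)) \<le> (\<Sum>p\<in>P. ln (1 + real p powr (-r)))"
    proof (rule sum_mono)
      fix p assume p: "p \<in> P"
      have "real p powr (-r) - (real p powr (-r))\<^sup>2 \<le> ln (1 + real p powr (-r))"
        using pos[OF p] by (intro ln_one_plus_pos_lower_bound) auto
      moreover have "(real p powr (-r))\<^sup>2 \<le> real p powr (-2)"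
        using assms P(2)[OF p] prime_ge_1_nat[of p]
        by (simp add: power2_eq_square powr_add[symmetric] powr_mono)
      ultimately show "real p powr (-r) - real p powr (-2) \<le> ln (1 + real p powr (-r))" by linarith
    qed
    also have "\<dots> = ln (\<Prod>p\<in>P. 1 + real p powr (-r))"
      using pos P by (subst ln_prod) (auto simp: add_nonneg_eq_0_iff)
    also have "(\<Prod>p\<in>P. 1 + real p powr (-r)) = (\<Sum>q\<in>smooth_squarefree P. real q powr (-r))"
      by (rule prod_one_plus_powr_primes[OF P])
    also have "ln \<dots> \<le> ln (zeta_real r)"
    proof (rule ln_mono)
      show "0 < (\<Sum>q\<in>smooth_squarefree P. real q powr (-r))"
        unfolding smooth_squarefree_def[symmetric] using finite_smooth_squarefree[OF P]
        by (intro sum_pos2[of _ 1]) (auto simp: smooth_squarefree_def)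
      show "(\<Sum>q\<in>smooth_squarefree P. real q powr (-r)) \<le> zeta_real r"
        using assms finite_smooth_squarefree[OF P]
        by (intro sum_le_zeta_real) (auto simp: smooth_squarefree_def)
    qed
    finally have "(\<Sum>p\<in>P. real p powr (-r)) \<le> ln (zeta_real r) + (\<Sum>p\<in>P. real p powr (-2))"
      by (simp add: sum_subtractf)
    also have "(\<Sum>p\<in>P. real p powr (-2)) \<le> zeta_real 2"
      using P P(2)[of 0] by (intro sum_le_zeta_real) auto
    finally show ?thesis
      unfolding P_def sum_primes_Suc[of "\<lambda>n. real n powr (-r)" N, symmetric] by simp
  qed
  thus ?thesis unfolding prime_zeta_def
    using prime_zeta_summable[OF assms] by (intro suminf_le_const) auto
qed

lemma prime_zeta_asymp:
  obtains C where "C > 0" "\<And>s. 0 < s \<Longrightarrow> s \<le> 1 \<Longrightarrow> \<bar>prime_zeta (1 + 2 * s) - ln (1 / s)\<bar> \<le> C"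
    "\<And>s. 0 < s \<Longrightarrow> \<bar>ln (zeta_real (1 + 2 * s)) - prime_zeta (1 + 2 * s)\<bar> \<le> C"
proof -
  define C1 where "C1 = ln (zeta_real 2) + zeta_real 2"
  have z2: "zeta_real 2 \<ge> 1" using zeta_real_bounds(1)[of 2] by simp
  hence l2: "ln (zeta_real 2) \<ge> 0" by simp
  have 1: "\<bar>ln (zeta_real (1 + 2 * s)) - prime_zeta (1 + 2 * s)\<bar> \<le> C1" if "s > 0" for s
    using ln_zeta_real_le[of "1 + 2 * s"] prime_zeta_le[of "1 + 2 * s"] that z2 l2
    unfolding C1_def by (intro abs_leI) linarith+
  have 2: "\<bar>ln (zeta_real (1 + 2 * s)) - ln (1 / s)\<bar> \<le> ln 2" if "s > 0" "s \<le> 1" for s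
  proof -
    have b: "1 / (2 * s) \<le> zeta_real (1 + 2 * s)" "zeta_real (1 + 2 * s) \<le> (1 + 2 * s) / (2 * s)"
      using zeta_real_bounds[of "1 + 2 * s"] that by auto
    have "(1 + 2 * s) / (2 * s) \<le> 2 * (1 / s)" using that by (simp add: field_simps)
    hence "ln (zeta_real (1 + 2 * s)) \<le> ln (2 * (1 / s))"
      using b that by (intro ln_mono) (auto intro: less_le_trans[rotated])
    moreover have "ln (1 / s / 2) \<le> ln (zeta_real (1 + 2 * s))"
      using b that by (intro ln_mono) auto
    ultimately show ?thesis using that by (simp add: ln_mult ln_div)
  qed
  show ?thesis
  proof (rule that[of "C1 + ln 2"])
    show "C1 + ln 2 > 0" using z2 l2 unfolding C1_def by (smt (verit) ln_gt_zero)
    fix s :: real assume s: "s > 0"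
    show "\<bar>ln (zeta_real (1 + 2 * s)) - prime_zeta (1 + 2 * s)\<bar> \<le> C1 + ln 2"
      using 1[OF s] by (smt (verit) ln_gt_zero)
    assume "s \<le> 1"
    from 1[OF s] 2[OF s this]
    show "\<bar>prime_zeta (1 + 2 * s) - ln (1 / s)\<bar> \<le> C1 + ln 2" by linarith
  qed
qed

section \<open>Tail bounds for weighted sums of random signs\<close>

text \<open>Integrating these bounds gives matching Gaussian estimates of \<open>cosh\<close> from both sides. The
  fourth-order term in the lower estimate is harmless for sums with many small coefficients.\<close>

lemma tanh_real_bounds:
  fixes x :: real assumes "x \<ge> 0"
  shows "tanh x \<le> x" "x - x ^ 3 / 3 \<le> tanh x"
proof -
  have *: "tanh y \<le> y" if "y \<ge> 0" for y :: real
  proof -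
    have "0 - tanh 0 \<le> y - tanh y"
    proof (rule DERIV_nonneg_imp_nondecreasing[OF that])
      fix z :: real
      have "((\<lambda>y. y - tanh y) has_real_derivative (tanh z)\<^sup>2) (at z)"
        by (auto intro!: derivative_eq_intros simp: less_imp_neq[THEN not_sym, OF cosh_real_pos])
      thus "\<exists>d. ((\<lambda>y. y - tanh y) has_real_derivative d) (at z) \<and> 0 \<le> d" by (intro exI[of _ "(tanh z)\<^sup>2"]) auto
    qed
    thus ?thesis by simp
  qed
  show "tanh x \<le> x" by (rule *[OF assms])
  have "tanh 0 - 0 + 0 ^ 3 / 3 \<le> tanh x - x + x ^ 3 / 3"
  proof (rule DERIV_nonneg_imp_nondecreasing[OF assms])
    fix z :: real assume z: "0 \<le> z"
    have "((\<lambda>x. tanh x - x + x ^ 3 / 3) has_real_derivative (z\<^sup>2 - (tanh z)\<^sup>2)) (at z)"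
      by (auto intro!: derivative_eq_intros simp: less_imp_neq[THEN not_sym, OF cosh_real_pos])
    moreover have "(tanh z)\<^sup>2 \<le> z\<^sup>2" using z *[OF z] by (intro power_mono) auto
    ultimately show "\<exists>d. ((\<lambda>x. tanh x - x + x ^ 3 / 3) has_real_derivative d) (at z) \<and> 0 \<le> d"
      by (intro exI[of _ "z\<^sup>2 - (tanh z)\<^sup>2"]) auto
  qed
  thus "x - x ^ 3 / 3 \<le> tanh x" by simp
qed

lemma cosh_le_exp_square: "cosh (x::real) \<le> exp (x\<^sup>2 / 2)"
proof -
  have "0\<^sup>2 / 2 - ln (cosh 0) \<le> \<bar>x\<bar>\<^sup>2 / 2 - ln (cosh \<bar>x\<bar>)"
  proof (rule DERIV_nonneg_imp_nondecreasing[of 0 "\<bar>x\<bar>" "\<lambda>x. x\<^sup>2 / 2 - ln (cosh x)"])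
    fix z :: real assume z: "0 \<le> z"
    have "((\<lambda>x. x\<^sup>2 / 2 - ln (cosh x)) has_real_derivative (z - tanh z)) (at z)"
      by (auto intro!: derivative_eq_intros simp: tanh_def)
    thus "\<exists>d. ((\<lambda>x. x\<^sup>2 / 2 - ln (cosh x)) has_real_derivative d) (at z) \<and> 0 \<le> d"
      using tanh_real_bounds(1)[OF z] by (intro exI[of _ "z - tanh z"]) auto
  qed simp
  hence "ln (cosh x) \<le> x\<^sup>2 / 2" by simp
  thus ?thesis using ln_le_cancel_iff[of "cosh x" "exp (x\<^sup>2 / 2)"] by simp
qed

lemma exp_le_cosh: "exp (x\<^sup>2 / 2 - x ^ 4 / 12) \<le> cosh (x::real)"
proof -
  have "ln (cosh 0) - 0\<^sup>2 / 2 + 0 ^ 4 / 12 \<le> ln (cosh \<bar>x\<bar>) - \<bar>x\<bar>\<^sup>2 / 2 + \<bar>x\<bar> ^ 4 / 12"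
  proof (rule DERIV_nonneg_imp_nondecreasing[of 0 "\<bar>x\<bar>" "\<lambda>x. ln (cosh x) - x\<^sup>2 / 2 + x ^ 4 / 12"])
    fix z :: real assume z: "0 \<le> z"
    have "((\<lambda>x. ln (cosh x) - x\<^sup>2 / 2 + x ^ 4 / 12) has_real_derivative (tanh z - z + z ^ 3 / 3)) (at z)"
      by (auto intro!: derivative_eq_intros simp: tanh_def)
    thus "\<exists>d. ((\<lambda>x. ln (cosh x) - x\<^sup>2 / 2 + x ^ 4 / 12) has_real_derivative d) (at z) \<and> 0 \<le> d"
      using tanh_real_bounds(2)[OF z] by (intro exI[of _ "tanh z - z + z ^ 3 / 3"]) auto
  qed simp
  hence "x\<^sup>2 / 2 - x ^ 4 / 12 \<le> ln (cosh x)" by (simp add: power_even_abs)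
  thus ?thesis using ln_ge_iff[of "cosh x"] by simp
qed

text \<open>The index set is a parameter since the values of a random multiplicative function are independent only
  at the primes.\<close>

locale rademacher_signs = prob_space M for M :: "'a measure" +
  fixes e :: "nat \<Rightarrow> 'a \<Rightarrow> real" and I :: "nat set"
  assumes indep: "indep_vars (\<lambda>_. borel) e I"
    and prob_plus: "i \<in> I \<Longrightarrow> prob {\<omega> \<in> space M. e i \<omega> = 1} = 1 / 2"
    and prob_minus: "i \<in> I \<Longrightarrow> prob {\<omega> \<in> space M. e i \<omega> = -1} = 1 / 2"
begin

lemma measurable_sign [measurable (raw)]: "i \<in> I \<Longrightarrow> e i \<in> borel_measurable M"
  using indep by (auto simp: indep_vars_def)

lemma AE_sign: 
  assumes "i \<in> I" shows "AE \<omega> in M. e i \<omega> = 1 \<or> e i \<omega> = -1"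
proof -
  have [measurable]: "e i \<in> borel_measurable M" using assms by measurable
  have "prob ({\<omega> \<in> space M. e i \<omega> = 1} \<union> {\<omega> \<in> space M. e i \<omega> = -1}) = 1"
    using prob_plus[OF assms(1)] prob_minus[OF assms(1)] by (subst finite_measure_Union) auto
  from prob_eq_1[THEN iffD1, OF _ this] show ?thesis by auto
qed

lemma expectation_sign:
  fixes g :: "real \<Rightarrow> real"
  assumes "i \<in> I" and [measurable]: "g \<in> borel_measurable borel"
  shows "expectation (\<lambda>\<omega>. g (e i \<omega>)) = (g 1 + g (-1)) / 2"
    and "integrable M (\<lambda>\<omega>. g (e i \<omega>))"
proof -
  have [measurable]: "e i \<in> borel_measurable M" using assms by measurable
  let ?A = "{\<omega> \<in> space M. e i \<omega> = 1}" and ?B = "{\<omega> \<in> space M. e i \<omega> = -1}"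
  have ae: "AE \<omega> in M. g (e i \<omega>) = g 1 * indicator ?A \<omega> + g (-1) * indicator ?B \<omega>"
    using AE_sign[OF assms(1)] AE_space by eventually_elim (auto simp: indicator_def)
  have "expectation (\<lambda>\<omega>. g (e i \<omega>)) = expectation (\<lambda>\<omega>. g 1 * indicator ?A \<omega> + g (-1) * indicator ?B \<omega>)"
    by (intro integral_cong_AE ae) auto
  also have "\<dots> = g 1 * prob ?A + g (-1) * prob ?B"
    by (subst Bochner_Integration.integral_add) (auto simp: less_top[symmetric])
  finally show "expectation (\<lambda>\<omega>. g (e i \<omega>)) = (g 1 + g (-1)) / 2"
    using prob_plus[OF assms(1)] prob_minus[OF assms(1)] by simp
  have "integrable M (\<lambda>\<omega>. g 1 * indicator ?A \<omega> + g (-1) * indicator ?B \<omega>)"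
    by (auto simp: less_top[symmetric])
  thus "integrable M (\<lambda>\<omega>. g (e i \<omega>))"
    by (subst integrable_cong_AE[OF _ _ ae]) auto
qed

lemma mgf:
  assumes "finite A" "A \<subseteq> I"
  shows "expectation (\<lambda>\<omega>. exp (t * (\<Sum>i\<in>A. a i * e i \<omega>))) = (\<Prod>i\<in>A. cosh (t * a i))"
    and "integrable M (\<lambda>\<omega>. exp (t * (\<Sum>i\<in>A. a i * e i \<omega>)))"
proof -
  have ind: "indep_vars (\<lambda>_. borel) (\<lambda>i \<omega>. exp (t * a i * e i \<omega>)) A"
    by (rule indep_vars_compose2[where Y = "\<lambda>i x. exp (t * a i * x)", OF indep_vars_subset[OF indep]])
       (use assms in auto)
  have int: "integrable M (\<lambda>\<omega>. exp (t * a i * e i \<omega>))" if "i \<in> A" for i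
    using assms that by (intro expectation_sign(2)[where g = "\<lambda>x. exp (t * a i * x)"]) auto
  have eq: "exp (t * (\<Sum>i\<in>A. a i * e i \<omega>)) = (\<Prod>i\<in>A. exp (t * a i * e i \<omega>))" for \<omega>
    using assms by (simp add: sum_distrib_left exp_sum mult.assoc)
  show "integrable M (\<lambda>\<omega>. exp (t * (\<Sum>i\<in>A. a i * e i \<omega>)))"
    unfolding eq by (rule indep_vars_integrable[OF assms(1) ind int])
  have "expectation (\<lambda>\<omega>. exp (t * (\<Sum>i\<in>A. a i * e i \<omega>))) = (\<Prod>i\<in>A. expectation (\<lambda>\<omega>. exp (t * a i * e i \<omega>)))"
    unfolding eq by (rule indep_vars_lebesgue_integral[OF assms(1) ind int])
  also have "\<dots> = (\<Prod>i\<in>A. cosh (t * a i))"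
    using assms by (intro prod.cong refl)
      (subst expectation_sign(1)[where g = "\<lambda>x. exp (t * a i * x)" for i], auto simp: cosh_def)
  finally show "expectation (\<lambda>\<omega>. exp (t * (\<Sum>i\<in>A. a i * e i \<omega>))) = (\<Prod>i\<in>A. cosh (t * a i))" .
qed

text \<open>A function of the signs indexed by \<open>A\<close> is written as \<open>G\<close> applied to the restricted family, which makes
  its independence of a further sign available. This is the induction step for stopped exponential sums.\<close>

lemma expectation_mult_new_sign:
  fixes G :: "(nat \<Rightarrow> real) \<Rightarrow> real" and g :: "real \<Rightarrow> real"
  assumes "n \<in> I" "n \<notin> A" "A \<subseteq> I"
    and [measurable]: "G \<in> borel_measurable (PiM A (\<lambda>_. borel))" "g \<in> borel_measurable borel"
    and int: "integrable M (\<lambda>\<omega>. G (restrict (\<lambda>i. e i \<omega>) A))"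
  shows "expectation (\<lambda>\<omega>. G (restrict (\<lambda>i. e i \<omega>) A) * g (e n \<omega>)) =
     expectation (\<lambda>\<omega>. G (restrict (\<lambda>i. e i \<omega>) A)) * ((g 1 + g (-1)) / 2)"
   and "integrable M (\<lambda>\<omega>. G (restrict (\<lambda>i. e i \<omega>) A) * g (e n \<omega>))"
proof -
  have "indep_var (PiM A (\<lambda>_. borel)) (\<lambda>\<omega>. restrict (\<lambda>i. e i \<omega>) A) (PiM {n} (\<lambda>_. borel)) (\<lambda>\<omega>. restrict (\<lambda>i. e i \<omega>) {n})"
    using assms by (intro indep_var_restrict[OF indep]) auto
  from indep_var_compose[OF this, of G borel "\<lambda>x. g (x n)" borel]
  have ind: "indep_var borel (\<lambda>\<omega>. G (restrict (\<lambda>i. e i \<omega>) A)) borel (\<lambda>\<omega>. g (e n \<omega>))"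
    by (simp add: comp_def)
  have int2: "integrable M (\<lambda>\<omega>. g (e n \<omega>))" using assms by (intro expectation_sign) auto
  show "integrable M (\<lambda>\<omega>. G (restrict (\<lambda>i. e i \<omega>) A) * g (e n \<omega>))"
    by (rule indep_var_integrable[OF ind int int2])
  show "expectation (\<lambda>\<omega>. G (restrict (\<lambda>i. e i \<omega>) A) * g (e n \<omega>)) =
     expectation (\<lambda>\<omega>. G (restrict (\<lambda>i. e i \<omega>) A)) * ((g 1 + g (-1)) / 2)"
    using assms by (subst indep_var_lebesgue_integral[OF ind int int2]) (simp add: expectation_sign(1))
qed

definition partial_sum :: "(nat \<Rightarrow> real) \<Rightarrow> nat \<Rightarrow> 'a \<Rightarrow> real" where
  "partial_sum a n \<omega> = (\<Sum>i<n. if i \<in> I then a i * e i \<omega> else 0)"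

lemma partial_sum_alt: "partial_sum a n \<omega> = (\<Sum>i\<in>{i\<in>I. i < n}. a i * e i \<omega>)"
  unfolding partial_sum_def by (rule sum.mono_neutral_cong_right) auto

lemma measurable_partial_sum [measurable]: "partial_sum a n \<in> borel_measurable M"
  unfolding partial_sum_alt[abs_def] by measurable

text \<open>The left-hand side is a lower bound for the expectation of \<open>exp (t S)\<close> stopped at the first time
  when the partial sum \<open>S\<close> exceeds \<open>l\<close>: on \<open>G n\<close> the stopped value is at least \<open>exp (t l)\<close>. Each further sign multiplies
  the part that has not been stopped by \<open>cosh (t a\<^sub>n) \<ge> 1\<close>.\<close>

lemma exp_maximal:
  fixes a :: "nat \<Rightarrow> real"
  assumes "l \<ge> 0" "t \<ge> 0"
  defines "G \<equiv> \<lambda>n \<omega>. \<exists>k\<le>n. partial_sum a k \<omega> > l"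
  shows "exp (t * l) * prob {\<omega>\<in>space M. G n \<omega>} + expectation (\<lambda>\<omega>. if G n \<omega> then 0 else exp (t * partial_sum a n \<omega>))
    \<le> (\<Prod>i\<in>{i\<in>I. i < n}. cosh (t * a i))"
proof (induction n)
  case 0
  show ?case using assms(1) by (simp add: G_def partial_sum_def prob_space)
next
  case (Suc n)
  have [measurable]: "{\<omega>\<in>space M. G n \<omega>} \<in> events" "Measurable.pred M (G n)" for n unfolding G_def by measurable
  have int: "integrable M (\<lambda>\<omega>. if G k \<omega> then 0 else exp (t * partial_sum a n \<omega>))" for n k
    by (rule Bochner_Integration.integrable_bound[OF mgf(2)[of "{i\<in>I. i < n}" t a]])
       (auto simp: partial_sum_alt)
  show ?case
  proof (cases "n \<in> I")
    case False
    hence eq: "partial_sum a (Suc n) \<omega> = partial_sum a n \<omega>" for \<omega> by (simp add: partial_sum_def)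
    have "G (Suc n) \<omega> = G n \<omega>" for \<omega>
      unfolding G_def by (auto simp: le_Suc_eq eq)
    moreover have "{i \<in> I. i < Suc n} = {i \<in> I. i < n}" using False by (auto simp: less_Suc_eq)
    ultimately show ?thesis using Suc by (simp only: eq)
  next
    case True
    define A where "A = {i\<in>I. i < n}"
    \<comment> \<open>The part that has not been stopped, as a function of the signs with index below \<open>n\<close>.\<close>
    define H where "H x = (if \<exists>k\<in>{..n}. (\<Sum>i\<in>{i\<in>I. i < k}. a i * x i) > l then 0 else exp (t * (\<Sum>i\<in>A. a i * x i)))" for x
    have [measurable]: "H \<in> borel_measurable (PiM A (\<lambda>_. borel))"
    proof -
      have [measurable]: "(\<lambda>x. \<Sum>i\<in>{i\<in>I. i < k}. a i * x i) \<in> borel_measurable (PiM A (\<lambda>_. borel))" if "k \<le> n" for k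
        using that by (intro borel_measurable_sum borel_measurable_times measurable_const measurable_component_singleton) (auto simp: A_def)
      have [measurable]: "Measurable.pred (PiM A (\<lambda>_. borel)) (\<lambda>x. \<exists>k\<in>{..n}. (\<Sum>i\<in>{i\<in>I. i < k}. a i * x i) > l)"
        by measurable
      have [measurable]: "(\<lambda>x. \<Sum>i\<in>A. a i * x i) \<in> borel_measurable (PiM A (\<lambda>_. borel))"
        by (intro borel_measurable_sum borel_measurable_times measurable_const measurable_component_singleton) auto
      show ?thesis unfolding H_def[abs_def] by measurable
    qed
    have He: "H (restrict (\<lambda>i. e i \<omega>) A) = (if G n \<omega> then 0 else exp (t * partial_sum a n \<omega>))" for \<omega>
    proof -
      have "(\<Sum>i\<in>{i\<in>I. i < k}. a i * restrict (\<lambda>i. e i \<omega>) A i) = partial_sum a k \<omega>" if "k \<le> n" for k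
        unfolding partial_sum_alt using that by (intro sum.cong) (auto simp: A_def)
      thus ?thesis unfolding H_def G_def A_def by (auto cong: conj_cong)
    qed
    have A: "n \<notin> A" "A \<subseteq> I" by (auto simp: A_def)
    have iH: "integrable M (\<lambda>\<omega>. H (restrict (\<lambda>i. e i \<omega>) A))" unfolding He by (rule int)
    note new = expectation_mult_new_sign[OF True A, of H "\<lambda>x. exp (t * a n * x)", OF _ _ iH, unfolded He]
    have step: "partial_sum a (Suc n) \<omega> = partial_sum a n \<omega> + a n * e n \<omega>" for \<omega>
      using True by (simp add: partial_sum_def)
    have GS: "G (Suc n) \<omega> \<longleftrightarrow> G n \<omega> \<or> partial_sum a (Suc n) \<omega> > l" for \<omega>
      unfolding G_def by (auto simp: le_Suc_eq)
    let ?c = "cosh (t * a n)"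
    let ?E = "expectation (\<lambda>\<omega>. if G n \<omega> then 0 else exp (t * partial_sum a n \<omega>))"
    have E1: "expectation (\<lambda>\<omega>. if G n \<omega> then 0 else exp (t * partial_sum a (Suc n) \<omega>)) = ?E * ?c"
    proof -
      have "(\<lambda>\<omega>. if G n \<omega> then 0 else exp (t * partial_sum a (Suc n) \<omega>))
         = (\<lambda>\<omega>. (if G n \<omega> then 0 else exp (t * partial_sum a n \<omega>)) * exp (t * a n * e n \<omega>))"
        by (auto simp: step exp_add[symmetric] algebra_simps)
      thus ?thesis using new(1) by (simp add: cosh_def)
    qed
    have "exp (t * l) * prob {\<omega>\<in>space M. G (Suc n) \<omega>} + expectation (\<lambda>\<omega>. if G (Suc n) \<omega> then 0 else exp (t * partial_sum a (Suc n) \<omega>))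
       = expectation (\<lambda>\<omega>. exp (t * l) * indicator {\<omega>\<in>space M. G (Suc n) \<omega>} \<omega> + (if G (Suc n) \<omega> then 0 else exp (t * partial_sum a (Suc n) \<omega>)))"
      by (subst Bochner_Integration.integral_add) (auto intro!: int simp: less_top[symmetric])
    also have "\<dots> \<le> expectation (\<lambda>\<omega>. exp (t * l) * indicator {\<omega>\<in>space M. G n \<omega>} \<omega> + (if G n \<omega> then 0 else exp (t * partial_sum a (Suc n) \<omega>)))"
    proof (rule integral_mono)
      fix \<omega> assume "\<omega> \<in> space M"
      thus "exp (t * l) * indicator {\<omega>\<in>space M. G (Suc n) \<omega>} \<omega> + (if G (Suc n) \<omega> then 0 else exp (t * partial_sum a (Suc n) \<omega>))
        \<le> exp (t * l) * indicator {\<omega>\<in>space M. G n \<omega>} \<omega> + (if G n \<omega> then 0 else exp (t * partial_sum a (Suc n) \<omega>))"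
        using assms(2) by (auto simp: GS indicator_def mult_left_mono)
    qed (auto intro!: int Bochner_Integration.integrable_add simp: less_top[symmetric])
    also have "\<dots> = exp (t * l) * prob {\<omega>\<in>space M. G n \<omega>} + ?E * ?c"
      by (subst Bochner_Integration.integral_add) (auto intro!: int simp: less_top[symmetric] E1)
    also have "\<dots> \<le> (exp (t * l) * prob {\<omega>\<in>space M. G n \<omega>} + ?E) * ?c"
      using cosh_real_ge_1[of "t * a n"] mult_left_mono[of 1 ?c "exp (t * l) * prob {\<omega>\<in>space M. G n \<omega>}"]
      by (simp add: algebra_simps)
    also have "\<dots> \<le> (\<Prod>i\<in>A. cosh (t * a i)) * ?c"
      using Suc by (intro mult_right_mono) (auto simp: A_def)
    also have "\<dots> = (\<Prod>i\<in>{i\<in>I. i < Suc n}. cosh (t * a i))"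
    proof -
      have "{i\<in>I. i < Suc n} = insert n A" using True by (auto simp: A_def)
      thus ?thesis using A by (simp add: A_def)
    qed
    finally show ?thesis .
  qed
qed

lemma prod_cosh_le:
  fixes a :: "'b \<Rightarrow> real"
  assumes "(\<Sum>i\<in>A. (a i)\<^sup>2) \<le> V"
  shows "(\<Prod>i\<in>A. cosh (t * a i)) \<le> exp (t\<^sup>2 * V / 2)"
proof (cases "finite A")
  case True
  have "(\<Prod>i\<in>A. cosh (t * a i)) \<le> (\<Prod>i\<in>A. exp ((t * a i)\<^sup>2 / 2))"
    by (intro prod_mono) (auto simp: cosh_le_exp_square)
  also have "\<dots> = exp (t\<^sup>2 * (\<Sum>i\<in>A. (a i)\<^sup>2) / 2)"
    using True by (simp add: exp_sum[symmetric] sum_distrib_left sum_divide_distrib power_mult_distrib)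
  also have "\<dots> \<le> exp (t\<^sup>2 * V / 2)" using assms by (simp add: mult_left_mono)
  finally show ?thesis .
qed (use assms in simp)

text \<open>Chernoff's bound with the optimal parameter \<open>t = l / V\<close>. Since \<open>exp_maximal\<close> already contains the maximum, the
  Gaussian bound for a single partial sum holds for the supremum of all of them without loss.\<close>

lemma maximal_inequality:
  assumes l: "l > 0" and V: "V > 0" "\<And>n. (\<Sum>i\<in>{i\<in>I. i < n}. (a i)\<^sup>2) \<le> V"
  shows "prob {\<omega>\<in>space M. \<exists>n. partial_sum a n \<omega> > l} \<le> exp (- (l\<^sup>2 / (2 * V)))"
proof -
  define t where "t = l / V"
  define B where "B n = {\<omega>\<in>space M. \<exists>k\<le>n. partial_sum a k \<omega> > l}" for n
  have t: "t \<ge> 0" using l V by (simp add: t_def)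
  have [measurable]: "B n \<in> events" for n unfolding B_def by measurable
  have "prob (B n) \<le> exp (- (l\<^sup>2 / (2 * V)))" for n
  proof -
    have "exp (t * l) * prob (B n) \<le> exp (t * l) * prob (B n) + expectation (\<lambda>\<omega>. if \<exists>k\<le>n. partial_sum a k \<omega> > l then 0 else exp (t * partial_sum a n \<omega>))"
      by simp
    also have "\<dots> \<le> (\<Prod>i\<in>{i\<in>I. i < n}. cosh (t * a i))"
      unfolding B_def using l t by (intro exp_maximal) auto
    also have "\<dots> \<le> exp (t\<^sup>2 * V / 2)" by (intro prod_cosh_le V)
    finally have "prob (B n) \<le> exp (t\<^sup>2 * V / 2) / exp (t * l)"
      by (simp add: field_simps)
    also have "\<dots> = exp (t\<^sup>2 * V / 2 - t * l)" by (simp add: exp_diff)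
    also have "t\<^sup>2 * V / 2 - t * l = - (l\<^sup>2 / (2 * V))"
      using V by (simp add: t_def power2_eq_square field_simps)
    finally show ?thesis .
  qed
  moreover have "(\<lambda>n. prob (B n)) \<longlonglongrightarrow> prob (\<Union>n. B n)"
    by (rule finite_Lim_measure_incseq) (auto simp: incseq_def B_def intro: le_trans)
  moreover have "(\<Union>n. B n) = {\<omega>\<in>space M. \<exists>n. partial_sum a n \<omega> > l}"
    by (auto simp: B_def)
  ultimately show ?thesis using LIMSEQ_le_const2 by (metis (no_types, lifting))
qed

text \<open>Under the measure with density proportional to \<open>exp (t S)\<close> the sum \<open>S\<close> concentrates around \<open>t V\<close> with
  standard deviation about \<open>\<surd>V\<close>. This is read off from the moment generating function: the expectation
  of \<open>exp (t S)\<close> on the two tails \<open>\<bar>S - t V\<bar> > 2 \<surd>V\<close> is estimated by Chernoff's bound with the parameters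
  \<open>t \<plusminus> h\<close>, and the total is bounded from below by \<open>exp_le_cosh\<close>. On the remaining event
  \<open>exp (t S)\<close> is at most \<open>exp (t (t V + 2 \<surd>V))\<close>, which bounds its probability from below.\<close>

lemma lower_tail:
  assumes A: "finite A" "A \<subseteq> I" and V: "V = (\<Sum>i\<in>A. (a i)\<^sup>2)" "V > 0" and t: "t \<ge> 0"
    and fourth: "t ^ 4 * (\<Sum>i\<in>A. (a i) ^ 4) \<le> 1"
  shows "prob {\<omega>\<in>space M. (\<Sum>i\<in>A. a i * e i \<omega>) \<ge> t * V - 2 * sqrt V}
    \<ge> exp (- (t\<^sup>2 * V / 2) - 2 * t * sqrt V) / 4"
proof -
  define S where "S \<omega> = (\<Sum>i\<in>A. a i * e i \<omega>)" for \<omega>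
  define \<delta> where "\<delta> = 2 * sqrt V"
  define h where "h = \<delta> / V"
  have hd: "h * \<delta> = 4" "h\<^sup>2 * V = 4" using V(2) by (auto simp: h_def \<delta>_def power2_eq_square field_simps)
  have [measurable]: "S \<in> borel_measurable M" unfolding S_def using A by (intro borel_measurable_sum) auto
  have E: "expectation (\<lambda>\<omega>. exp (u * S \<omega>)) \<le> exp (u\<^sup>2 * V / 2)" for u
    unfolding S_def mgf(1)[OF A] by (rule prod_cosh_le) (use V in simp)
  have int: "integrable M (\<lambda>\<omega>. exp (u * S \<omega>))" for u unfolding S_def by (rule mgf(2)[OF A])
  have low: "expectation (\<lambda>\<omega>. exp (t * S \<omega>)) \<ge> exp (t\<^sup>2 * V / 2 - 1 / 12)"
  proof -
    have "exp (t\<^sup>2 * V / 2 - 1 / 12) \<le> exp (\<Sum>i\<in>A. (t * a i)\<^sup>2 / 2 - (t * a i) ^ 4 / 12)"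
      using fourth unfolding V(1)
      by (simp add: sum_subtractf sum_divide_distrib[symmetric] power_mult_distrib sum_distrib_left[symmetric])
    also have "\<dots> = (\<Prod>i\<in>A. exp ((t * a i)\<^sup>2 / 2 - (t * a i) ^ 4 / 12))" using A by (simp add: exp_sum)
    also have "\<dots> \<le> (\<Prod>i\<in>A. cosh (t * a i))" by (intro prod_mono) (auto simp: exp_le_cosh)
    finally show ?thesis unfolding S_def mgf(1)[OF A] .
  qed
  \<comment> \<open>The two tails and the central part of the tilted measure.\<close>
  have pw: "exp (t * S \<omega>) \<le> exp (- h * (t * V + \<delta>)) * exp ((t + h) * S \<omega>)
      + exp (h * (t * V - \<delta>)) * exp ((t - h) * S \<omega>)
      + exp (t * (t * V + \<delta>)) * indicator {\<omega>\<in>space M. S \<omega> \<ge> t * V - \<delta>} \<omega>" if "\<omega> \<in> space M" for \<omega>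
  proof -
    have h: "h \<ge> 0" using V by (simp add: h_def \<delta>_def)
    consider "S \<omega> \<ge> t * V + \<delta>" | "S \<omega> < t * V - \<delta>" | "t * V - \<delta> \<le> S \<omega>" "S \<omega> \<le> t * V + \<delta>" by linarith
    thus ?thesis
    proof cases
      case 1
      have "t * S \<omega> \<le> - h * (t * V + \<delta>) + (t + h) * S \<omega>"
        using mult_left_mono[OF 1 h] by (simp add: algebra_simps)
      hence "exp (t * S \<omega>) \<le> exp (- h * (t * V + \<delta>)) * exp ((t + h) * S \<omega>)"
        by (simp add: exp_add[symmetric])
      thus ?thesis by (simp add: add_increasing2)
    next
      case 2
      have "t * S \<omega> \<le> h * (t * V - \<delta>) + (t - h) * S \<omega>"
        using mult_left_mono[OF less_imp_le[OF 2] h] by (simp add: algebra_simps)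
      hence "exp (t * S \<omega>) \<le> exp (h * (t * V - \<delta>)) * exp ((t - h) * S \<omega>)"
        by (simp add: exp_add[symmetric])
      thus ?thesis by (simp add: add_increasing2 add_increasing)
    next
      case 3
      have "exp (t * S \<omega>) \<le> exp (t * (t * V + \<delta>)) * indicator {\<omega>\<in>space M. S \<omega> \<ge> t * V - \<delta>} \<omega>"
        using 3 t that by (simp add: mult_left_mono)
      thus ?thesis by (simp add: add_increasing)
    qed
  qed
  let ?p = "prob {\<omega>\<in>space M. S \<omega> \<ge> t * V - \<delta>}"
  have "exp (t\<^sup>2 * V / 2 - 1 / 12) \<le> expectation (\<lambda>\<omega>. exp (- h * (t * V + \<delta>)) * exp ((t + h) * S \<omega>)
      + exp (h * (t * V - \<delta>)) * exp ((t - h) * S \<omega>)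
      + exp (t * (t * V + \<delta>)) * indicator {\<omega>\<in>space M. S \<omega> \<ge> t * V - \<delta>} \<omega>)"
    by (rule order.trans[OF low], rule integral_mono[OF int _ pw])
       (auto intro!: int Bochner_Integration.integrable_add integrable_mult_right simp: less_top[symmetric])
  also have "\<dots> = exp (- h * (t * V + \<delta>)) * expectation (\<lambda>\<omega>. exp ((t + h) * S \<omega>))
      + exp (h * (t * V - \<delta>)) * expectation (\<lambda>\<omega>. exp ((t - h) * S \<omega>))
      + exp (t * (t * V + \<delta>)) * ?p"
    by (subst Bochner_Integration.integral_add Bochner_Integration.integral_mult_right;
       (auto intro!: int Bochner_Integration.integrable_add integrable_mult_right simp: less_top[symmetric])?)+
  also have "\<dots> \<le> exp (- h * (t * V + \<delta>)) * exp ((t + h)\<^sup>2 * V / 2)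
      + exp (h * (t * V - \<delta>)) * exp ((t - h)\<^sup>2 * V / 2)
      + exp (t * (t * V + \<delta>)) * ?p"
    by (intro add_mono mult_left_mono E) auto
  also have "exp (- h * (t * V + \<delta>)) * exp ((t + h)\<^sup>2 * V / 2) = exp (t\<^sup>2 * V / 2) * exp (-2)"
    using hd by (simp add: exp_add[symmetric] power2_eq_square algebra_simps add_divide_distrib)
  also have "exp (h * (t * V - \<delta>)) * exp ((t - h)\<^sup>2 * V / 2) = exp (t\<^sup>2 * V / 2) * exp (-2)"
    using hd by (simp add: exp_add[symmetric] power2_eq_square algebra_simps add_divide_distrib diff_divide_distrib)
  also have "exp (t\<^sup>2 * V / 2 - 1 / 12) = exp (t\<^sup>2 * V / 2) * exp (- 1 / 12)"
    by (simp add: exp_add[symmetric])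
  finally have 1: "exp (t\<^sup>2 * V / 2) * (exp (- 1 / 12) - 2 * exp (-2)) \<le> exp (t * (t * V + \<delta>)) * ?p"
    by (simp add: algebra_simps)
  have "exp (2::real) \<ge> 1 + 2 + 2\<^sup>2 / 2" by (intro exp_lower_Taylor_quadratic) auto
  hence "exp (-2::real) \<le> 1/5" by (simp add: exp_minus field_simps)
  moreover have "exp (- 1 / 12 :: real) \<ge> 11 / 12" using exp_ge_add_one_self[of "-1/12 :: real"] by simp
  ultimately have "1 / 4 \<le> exp (- 1 / 12 :: real) - 2 * exp (-2)" by linarith
  hence "exp (t\<^sup>2 * V / 2) * (1/4) \<le> exp (t * (t * V + \<delta>)) * ?p"
    using 1 by (meson exp_ge_zero mult_left_mono order_trans)
  hence "exp (t\<^sup>2 * V / 2) / exp (t * (t * V + \<delta>)) / 4 \<le> ?p"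
    by (simp add: field_simps)
  also have "exp (t\<^sup>2 * V / 2) / exp (t * (t * V + \<delta>)) = exp (- (t\<^sup>2 * V / 2) - 2 * t * sqrt V)"
    by (simp add: exp_diff[symmetric] \<delta>_def power2_eq_square algebra_simps)
  finally show ?thesis unfolding S_def \<delta>_def .
qed

text \<open>Products of signs over different finite index sets are orthogonal: a factor indexed by the symmetric
  difference occurs only once and has mean zero.\<close>

lemma expectation_prod_signs:
  assumes S: "finite S" "S \<subseteq> I" and T: "finite T" "T \<subseteq> I"
  shows "integrable M (\<lambda>\<omega>. (\<Prod>i\<in>S. e i \<omega>) * (\<Prod>i\<in>T. e i \<omega>))"
    and "expectation (\<lambda>\<omega>. (\<Prod>i\<in>S. e i \<omega>) * (\<Prod>i\<in>T. e i \<omega>)) = (if S = T then 1 else 0)"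
proof -
  define g where "g i x = (if i \<in> S then x else 1) * (if i \<in> T then x else 1)" for i and x :: real
  have fin: "finite (S \<union> T)" using S T by auto
  have meas: "g i \<in> borel_measurable borel" for i unfolding g_def[abs_def] by measurable
  have ind: "indep_vars (\<lambda>_. borel) (\<lambda>i \<omega>. g i (e i \<omega>)) (S \<union> T)"
    by (rule indep_vars_compose2[where Y = g, OF indep_vars_subset[OF indep]])
       (use S T meas in auto)
  have int: "integrable M (\<lambda>\<omega>. g i (e i \<omega>))" if "i \<in> S \<union> T" for i
    using that S T by (intro expectation_sign(2) meas) auto
  have eq: "(\<Prod>i\<in>S. e i \<omega>) * (\<Prod>i\<in>T. e i \<omega>) = (\<Prod>i\<in>S \<union> T. g i (e i \<omega>))" for \<omega>
  proof -
    have "(\<Prod>i\<in>S. e i \<omega>) = (\<Prod>i\<in>S \<union> T. if i \<in> S then e i \<omega> else 1)"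
      using fin by (intro prod.mono_neutral_cong_left) auto
    moreover have "(\<Prod>i\<in>T. e i \<omega>) = (\<Prod>i\<in>S \<union> T. if i \<in> T then e i \<omega> else 1)"
      using fin by (intro prod.mono_neutral_cong_left) auto
    ultimately show ?thesis by (simp add: g_def prod.distrib)
  qed
  show "integrable M (\<lambda>\<omega>. (\<Prod>i\<in>S. e i \<omega>) * (\<Prod>i\<in>T. e i \<omega>))"
    unfolding eq by (rule indep_vars_integrable[OF fin ind int])
  have "expectation (\<lambda>\<omega>. (\<Prod>i\<in>S. e i \<omega>) * (\<Prod>i\<in>T. e i \<omega>)) = (\<Prod>i\<in>S \<union> T. expectation (\<lambda>\<omega>. g i (e i \<omega>)))"
    unfolding eq by (rule indep_vars_lebesgue_integral[OF fin ind int])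
  also have "\<dots> = (\<Prod>i\<in>S \<union> T. (g i 1 + g i (-1)) / 2)"
    using S T by (intro prod.cong refl expectation_sign(1) meas) auto
  also have "\<dots> = (if S = T then 1 else 0)"
  proof (cases "S = T")
    case False
    then obtain i where "i \<in> S \<union> T" "i \<notin> S \<inter> T" by blast
    hence "(g i 1 + g i (-1)) / 2 = 0" by (auto simp: g_def)
    with fin \<open>i \<in> S \<union> T\<close> have "(\<Prod>i\<in>S \<union> T. (g i 1 + g i (-1)) / 2) = 0"
      by (auto simp: prod_zero_iff)
    thus ?thesis using False by simp
  qed (auto simp: g_def intro!: prod.neutral)
  finally show "expectation (\<lambda>\<omega>. (\<Prod>i\<in>S. e i \<omega>) * (\<Prod>i\<in>T. e i \<omega>)) = (if S = T then 1 else 0)" .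
qed

end

section \<open>Two consequences of independence\<close>

text \<open>Each variable is viewed as a family over a singleton index set; disjoint subfamilies of an independent
  family are independent.\<close>

lemma (in prob_space) indep_vars_reindex_inj:
  assumes "indep_vars M' X I" "inj_on g J" "g ` J \<subseteq> I"
  shows "indep_vars (\<lambda>j. M' (g j)) (\<lambda>j. X (g j)) J"
proof -
  have "indep_vars (\<lambda>j. PiM {g j} M') (\<lambda>j \<omega>. restrict (\<lambda>i. X i \<omega>) {g j}) J"
    using assms by (intro indep_vars_restrict[OF assms(1)]) (auto simp: disjoint_family_on_def inj_on_def)
  from indep_vars_compose2[where Y = "\<lambda>j x. x (g j)" and N = "\<lambda>j. M' (g j)", OF this]
  show ?thesis by simp
qed

text \<open>The converse Borel-Cantelli lemma: by \<open>1 - p \<le> exp (- p)\<close>, the probability that none of the events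
  from index \<open>m\<close> on occurs is at most \<open>exp (- \<Sum> p\<^sub>j)\<close>, which is zero when the sum diverges.\<close>

lemma (in prob_space) borel_cantelli_AE2:
  fixes W :: "nat \<Rightarrow> 'a \<Rightarrow> real"
  assumes ind: "indep_vars (\<lambda>_. borel) W UNIV"
    and div: "\<not> summable (\<lambda>j. prob {\<omega>\<in>space M. W j \<omega> \<ge> c j})"
  shows "AE \<omega> in M. \<exists>\<^sub>F j in sequentially. W j \<omega> \<ge> c j"
proof -
  have [measurable]: "W j \<in> borel_measurable M" for j using ind by (auto simp: indep_vars_def)
  define p where "p j = prob {\<omega>\<in>space M. W j \<omega> \<ge> c j}" for j
  have null: "AE \<omega> in M. \<not> (\<forall>j\<ge>m. W j \<omega> < c j)" for m
  proof -
    let ?B = "{\<omega>\<in>space M. \<forall>j\<ge>m. W j \<omega> < c j}"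
    have le: "prob ?B \<le> exp (- (\<Sum>j\<in>{m..<n}. p j))" for n
    proof (cases "m < n")
      case True
      have "prob ?B \<le> prob (\<Inter>j\<in>{m..<n}. W j -` {..<c j} \<inter> space M)"
        using True by (intro finite_measure_mono) auto
      also have "\<dots> = (\<Prod>j\<in>{m..<n}. prob (W j -` {..<c j} \<inter> space M))"
        using True by (intro indep_varsD[OF ind]) auto
      also have "\<dots> = (\<Prod>j\<in>{m..<n}. 1 - p j)"
      proof (intro prod.cong refl)
        fix j
        have "W j -` {..<c j} \<inter> space M = space M - {\<omega>\<in>space M. W j \<omega> \<ge> c j}" by auto
        thus "prob (W j -` {..<c j} \<inter> space M) = 1 - p j" unfolding p_def by (simp add: prob_compl)
      qed
      also have "\<dots> \<le> (\<Prod>j\<in>{m..<n}. exp (- p j))"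
        using exp_ge_add_one_self[of "- p j" for j] by (intro prod_mono) (auto simp: p_def)
      also have "\<dots> = exp (- (\<Sum>j\<in>{m..<n}. p j))" by (simp add: exp_sum[symmetric] sum_negf)
      finally show ?thesis .
    qed simp
    have "prob ?B = 0"
    proof (rule ccontr)
      assume "prob ?B \<noteq> 0"
      hence pos: "prob ?B > 0" by (simp add: zero_less_measure_iff)
      have "summable (\<lambda>j. p (j + m))"
      proof (rule summableI_nonneg_bounded[where x = "- ln (prob ?B)"])
        show "0 \<le> p (j + m)" for j unfolding p_def by (rule measure_nonneg)
        show "(\<Sum>j<n. p (j + m)) \<le> - ln (prob ?B)" for n
        proof -
          have "ln (prob ?B) \<le> - (\<Sum>j\<in>{m..<m + n}. p j)"
            using ln_mono[OF le[of "m + n"] pos] unfolding ln_exp .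
          moreover have "(\<Sum>j\<in>{m..<m + n}. p j) = (\<Sum>j<n. p (j + m))"
            by (rule sum.reindex_bij_witness[of _ "\<lambda>j. j + m" "\<lambda>j. j - m"]) auto
          ultimately show ?thesis by simp
        qed
      qed
      hence "summable p" by (simp add: summable_iff_shift)
      with div show False by (simp add: p_def[abs_def])
    qed
    thus ?thesis by (subst (asm) prob_eq_0) auto
  qed
  have "AE \<omega> in M. \<forall>m. \<not> (\<forall>j\<ge>m. W j \<omega> < c j)" using null by (simp add: AE_all_countable)
  thus ?thesis
    by eventually_elim (auto simp: frequently_sequentially not_less)
qed

section \<open>Almost sure convergence of Dirichlet series with orthogonal coefficients\<close>

text \<open>The sum of the squares of \<open>\<Sum>z\<close> over all dyadic subintervals of \<open>[m, m + 2\<^sup>k)\<close>.\<close>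

fun dyadic_energy :: "nat \<Rightarrow> nat \<Rightarrow> (nat \<Rightarrow> real) \<Rightarrow> real" where
  "dyadic_energy 0 m z = (z m)\<^sup>2"
| "dyadic_energy (Suc k) m z =
     dyadic_energy k m z + dyadic_energy k (m + 2 ^ k) z + (\<Sum>i\<in>{m..<m + 2 ^ Suc k}. z i)\<^sup>2"

lemma dyadic_energy_nonneg: "dyadic_energy k m z \<ge> 0"
  by (induction k arbitrary: m) (auto intro: add_nonneg_nonneg)

lemma block_le_dyadic_energy: "(\<Sum>i\<in>{m..<m + 2 ^ k}. z i)\<^sup>2 \<le> dyadic_energy k m z"
  by (cases k) (auto simp: add_nonneg_nonneg dyadic_energy_nonneg)

text \<open>An initial segment of \<open>[m, m + 2\<^sup>k)\<close> is a union of at most \<open>k + 1\<close> dyadic intervals of different lengths, so the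
  Cauchy-Schwarz inequality applies. All initial segments are thus controlled by one quantity whose
  expectation is easy to compute for orthogonal random variables.\<close>

lemma initial_segment_le_dyadic_energy:
  "n \<le> 2 ^ k \<Longrightarrow> (\<Sum>i\<in>{m..<m + n}. z i)\<^sup>2 \<le> (real k + 1) * dyadic_energy k m z"
proof (induction k arbitrary: m n)
  case 0
  hence "n = 0 \<or> n = 1" by auto
  thus ?case by auto
next
  case (Suc k)
  let ?D = "dyadic_energy k m z" and ?D' = "dyadic_energy k (m + 2 ^ k) z"
  note nn = dyadic_energy_nonneg[of k m z] dyadic_energy_nonneg[of k "m + 2 ^ k" z]
  show ?case
  proof (cases "n \<le> 2 ^ k")
    case True
    have "(\<Sum>i\<in>{m..<m + n}. z i)\<^sup>2 \<le> (real k + 1) * ?D" by (rule Suc.IH[OF True])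
    also have "\<dots> \<le> (real (Suc k) + 1) * dyadic_energy (Suc k) m z"
      using nn by (intro mult_mono) auto
    finally show ?thesis .
  next
    case False
    define A where "A = (\<Sum>i\<in>{m..<m + 2 ^ k}. z i)"
    define B where "B = (\<Sum>i\<in>{m + 2 ^ k..<m + n}. z i)"
    have A: "A\<^sup>2 \<le> ?D" unfolding A_def by (rule block_le_dyadic_energy)
    have B: "B\<^sup>2 \<le> (real k + 1) * ?D'"
      using Suc.IH[of "n - 2 ^ k" "m + 2 ^ k"] Suc.prems False by (simp add: B_def)
    have AB: "(\<Sum>i\<in>{m..<m + n}. z i) = A + B"
      unfolding A_def B_def using False by (simp add: sum.atLeastLessThan_concat)
    have B': "B\<^sup>2 / (real k + 1) \<le> ?D'" using B by (simp add: divide_le_eq mult.commute)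
    have "(\<Sum>i\<in>{m..<m + n}. z i)\<^sup>2 = (A + B)\<^sup>2" by (simp only: AB)
    also have "(A + B)\<^sup>2 \<le> (real k + 2) * (A\<^sup>2 + B\<^sup>2 / (real k + 1))"
    proof -
      \<comment> \<open>The Cauchy-Schwarz inequality for one interval of full length and \<open>k + 1\<close> shorter ones.\<close>
      have "0 \<le> ((real k + 1) * A - B)\<^sup>2 / (real k + 1)" by simp
      also have "\<dots> = (real k + 2) * (A\<^sup>2 + B\<^sup>2 / (real k + 1)) - (A + B)\<^sup>2"
        by (simp add: power2_eq_square field_simps)
      finally show ?thesis by simp
    qed
    also have "\<dots> \<le> (real k + 2) * (?D + ?D')"
      using A B' by (intro mult_left_mono add_mono) auto
    also have "(real k + 2) * (?D + ?D') \<le> (real (Suc k) + 1) * dyadic_energy (Suc k) m z"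
      by (intro mult_mono) (use nn in auto)
    finally show ?thesis .
  qed
qed

text \<open>Summation by parts against the weights \<open>(n + 1)\<^sup>-\<^sup>1\<^sup>/\<^sup>2\<^sup>-\<^sup>s\<close>, whose differences are of order
  \<open>n\<^sup>-\<^sup>3\<^sup>/\<^sup>2\<^sup>-\<^sup>s\<close>: the growth rate \<open>n\<^sup>1\<^sup>/\<^sup>2\<^sup>+\<^sup>d\<close> with \<open>d < s\<close> suffices.\<close>

lemma dirichlet_summable_of_growth:
  fixes z :: "nat \<Rightarrow> real"
  assumes growth: "\<And>n. \<bar>\<Sum>i<n. z i\<bar> \<le> C * real (Suc n) powr (1 / 2 + d)" and d: "0 < d" "d < s"
  shows "summable (\<lambda>n. z n * real (Suc n) powr (-(1 / 2 + s)))"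
proof -
  define w where "w n = real (Suc n) powr (-(1 / 2 + s))" for n
  have C: "C \<ge> 0" using growth[of 0] by simp
  have w: "0 \<le> w n - w (Suc n) \<and> w n - w (Suc n) \<le> (1 / 2 + s) * real (Suc n) powr (-(3 / 2 + s))" for n
  proof -
    have "\<exists>x. real (Suc n) < x \<and> x < real (Suc (Suc n)) \<and>
       real (Suc (Suc n)) powr (-(1/2+s)) - real (Suc n) powr (-(1/2+s)) =
       (real (Suc (Suc n)) - real (Suc n)) * (-(1/2+s) * x powr (-(1/2+s) - 1))"
    proof (rule MVT2)
      fix x assume "real (Suc n) \<le> x"
      thus "((\<lambda>x. x powr (-(1/2+s))) has_real_derivative (-(1/2+s) * x powr (-(1/2+s) - 1))) (at x)"
        by (intro has_real_derivative_powr) auto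
    qed simp
    then obtain x where x: "real (Suc n) < x" "w n - w (Suc n) = (1/2+s) * x powr (-(3/2+s))"
      by (auto simp: w_def algebra_simps)
    have "x powr (-(3/2+s)) \<le> real (Suc n) powr (-(3/2+s))" using x d by (intro powr_mono2') auto
    thus ?thesis using x d by (simp add: mult_left_mono)
  qed
  have sm1: "summable (\<lambda>i. (\<Sum>j\<le>i. z j) * (w i - w (Suc i)))"
  proof (rule summable_comparison_test')
    show "summable (\<lambda>n. (C * 2 powr (1/2+d) * (1/2+s)) * real (Suc n) powr (-(1 + (s - d))))"
      using zeta_real_summable[of "1 + (s - d)"] d by (intro summable_mult) auto
    fix n :: nat
    have "norm ((\<Sum>j\<le>n. z j) * (w n - w (Suc n))) = \<bar>\<Sum>j<Suc n. z j\<bar> * (w n - w (Suc n))"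
      using w[of n] by (simp add: abs_mult lessThan_Suc_atMost)
    also have "\<dots> \<le> (C * real (Suc (Suc n)) powr (1/2+d)) * ((1/2+s) * real (Suc n) powr (-(3/2+s)))"
      using w[of n] C by (intro mult_mono growth) auto
    also have "real (Suc (Suc n)) powr (1/2+d) \<le> (2 * real (Suc n)) powr (1/2+d)"
      using d by (intro powr_mono2) auto
    also have "\<dots> = 2 powr (1/2+d) * real (Suc n) powr (1/2+d)"
      by (rule powr_mult)
    finally have "norm ((\<Sum>j\<le>n. z j) * (w n - w (Suc n))) \<le>
      C * (2 powr (1/2+d) * real (Suc n) powr (1/2+d)) * ((1/2+s) * real (Suc n) powr (-(3/2+s)))"
      using C d by (simp add: mult_left_mono mult_right_mono)
    also have "\<dots> = C * 2 powr (1/2+d) * (1/2+s) * (real (Suc n) powr (1/2+d) * real (Suc n) powr (-(3/2+s)))"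
      by (simp add: mult_ac)
    also have "real (Suc n) powr (1/2+d) * real (Suc n) powr (-(3/2+s)) = real (Suc n) powr (-(1 + (s - d)))"
      unfolding powr_add[symmetric] by (intro arg_cong2[of _ _ _ _ "(powr)"]) auto
    finally show "norm ((\<Sum>j\<le>n. z j) * (w n - w (Suc n))) \<le> (C * 2 powr (1/2+d) * (1/2+s)) * real (Suc n) powr (-(1 + (s - d)))" .
  qed
  have lim0: "(\<lambda>n. (\<Sum>j<n. z j) * w n) \<longlonglongrightarrow> 0"
  proof (rule Lim_null_comparison)
    show "\<forall>\<^sub>F n in sequentially. norm ((\<Sum>j<n. z j) * w n) \<le> C * real (Suc n) powr (d - s)"
    proof (intro always_eventually allI)
      fix n
      have "norm ((\<Sum>j<n. z j) * w n) \<le> C * real (Suc n) powr (1/2+d) * w n"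
        by (simp add: abs_mult w_def mult_right_mono[OF growth[of n, simplified]])
      also have "\<dots> = C * real (Suc n) powr (d - s)"
        unfolding w_def mult.assoc powr_add[symmetric] by simp
      finally show "norm ((\<Sum>j<n. z j) * w n) \<le> C * real (Suc n) powr (d - s)" .
    qed
    show "(\<lambda>n. C * real (Suc n) powr (d - s)) \<longlonglongrightarrow> 0" using d by real_asymp
  qed
  have "(\<lambda>n. \<Sum>i<n. z i * w i) \<longlonglongrightarrow> (\<Sum>i. (\<Sum>j\<le>i. z j) * (w i - w (Suc i))) + 0"
    unfolding sum_mult_by_parts[of z w] by (intro tendsto_add lim0 summable_LIMSEQ sm1)
  thus ?thesis unfolding summable_iff_convergent convergent_def w_def by blast
qed

context prob_space
begin

lemma expectation_square_sum_orthogonal: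
  fixes Z :: "nat \<Rightarrow> 'a \<Rightarrow> real"
  assumes int: "\<And>i j. i \<in> A \<Longrightarrow> j \<in> A \<Longrightarrow> integrable M (\<lambda>\<omega>. Z i \<omega> * Z j \<omega>)"
    and orth: "\<And>i j. i \<in> A \<Longrightarrow> j \<in> A \<Longrightarrow> i \<noteq> j \<Longrightarrow> expectation (\<lambda>\<omega>. Z i \<omega> * Z j \<omega>) = 0"
  shows "integrable M (\<lambda>\<omega>. (\<Sum>i\<in>A. Z i \<omega>)\<^sup>2)"
    and "expectation (\<lambda>\<omega>. (\<Sum>i\<in>A. Z i \<omega>)\<^sup>2) = (\<Sum>i\<in>A. expectation (\<lambda>\<omega>. (Z i \<omega>)\<^sup>2))"
proof -
  have eq: "(\<Sum>i\<in>A. Z i \<omega>)\<^sup>2 = (\<Sum>i\<in>A. \<Sum>j\<in>A. Z i \<omega> * Z j \<omega>)" for \<omega>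
    by (simp add: power2_eq_square sum_product)
  show "integrable M (\<lambda>\<omega>. (\<Sum>i\<in>A. Z i \<omega>)\<^sup>2)"
    unfolding eq using int by auto
  have "expectation (\<lambda>\<omega>. (\<Sum>i\<in>A. Z i \<omega>)\<^sup>2) = (\<Sum>i\<in>A. \<Sum>j\<in>A. expectation (\<lambda>\<omega>. Z i \<omega> * Z j \<omega>))"
    unfolding eq using int by (simp add: Bochner_Integration.integral_sum)
  also have "\<dots> = (\<Sum>i\<in>A. \<Sum>j\<in>A. if j = i then expectation (\<lambda>\<omega>. Z i \<omega> * Z j \<omega>) else 0)"
    using orth by (intro sum.cong) auto
  also have "\<dots> = (\<Sum>i\<in>A. expectation (\<lambda>\<omega>. (Z i \<omega>)\<^sup>2))"
    by (cases "finite A") (auto simp: power2_eq_square)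
  finally show "expectation (\<lambda>\<omega>. (\<Sum>i\<in>A. Z i \<omega>)\<^sup>2) = (\<Sum>i\<in>A. expectation (\<lambda>\<omega>. (Z i \<omega>)\<^sup>2))" .
qed

text \<open>The expected dyadic energy of \<open>[0, 2\<^sup>k)\<close> is at most \<open>(k + 1) 2\<^sup>k\<close>. By Markov's inequality and the
  Borel-Cantelli lemma it is almost surely at most \<open>2\<^sup>k\<^sup>(\<^sup>1\<^sup>+\<^sup>d\<^sup>)\<close> for large \<open>k\<close>, and hence the partial sums of
  \<open>Z\<close> are \<open>O(n\<^sup>1\<^sup>/\<^sup>2\<^sup>+\<^sup>d)\<close>. Letting \<open>d\<close> run through the reciprocals of the positive integers yields one almost
  sure event that serves all \<open>s > 0\<close>.\<close>

lemma AE_dirichlet_summable: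
  fixes Z :: "nat \<Rightarrow> 'a \<Rightarrow> real"
  assumes [measurable]: "\<And>i. Z i \<in> borel_measurable M"
    and int: "\<And>i j. integrable M (\<lambda>\<omega>. Z i \<omega> * Z j \<omega>)"
    and orth: "\<And>i j. i \<noteq> j \<Longrightarrow> expectation (\<lambda>\<omega>. Z i \<omega> * Z j \<omega>) = 0"
    and norm: "\<And>i. expectation (\<lambda>\<omega>. (Z i \<omega>)\<^sup>2) \<le> 1"
  shows "AE \<omega> in M. \<forall>s>0. summable (\<lambda>n. Z n \<omega> * real (Suc n) powr (-(1 / 2 + s)))"
proof -
  let ?D = "\<lambda>k m \<omega>. dyadic_energy k m (\<lambda>i. Z i \<omega>)"
  have D: "integrable M (?D k m) \<and> expectation (?D k m) \<le> (real k + 1) * 2 ^ k" for k m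
  proof (induction k arbitrary: m)
    case 0
    show ?case using int[of m m] norm[of m] by (simp add: power2_eq_square)
  next
    case (Suc k)
    have sq: "integrable M (\<lambda>\<omega>. (\<Sum>i\<in>{m..<m + 2 ^ Suc k}. Z i \<omega>)\<^sup>2)"
      "expectation (\<lambda>\<omega>. (\<Sum>i\<in>{m..<m + 2 ^ Suc k}. Z i \<omega>)\<^sup>2) =
        (\<Sum>i\<in>{m..<m + 2 ^ Suc k}. expectation (\<lambda>\<omega>. (Z i \<omega>)\<^sup>2))"
      by (rule expectation_square_sum_orthogonal; use int orth in simp)+
    have "expectation (\<lambda>\<omega>. (\<Sum>i\<in>{m..<m + 2 ^ Suc k}. Z i \<omega>)\<^sup>2) \<le> (\<Sum>i\<in>{m..<m + 2 ^ Suc k}. 1)"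
      unfolding sq(2) by (intro sum_mono norm)
    hence "expectation (\<lambda>\<omega>. (\<Sum>i\<in>{m..<m + 2 ^ Suc k}. Z i \<omega>)\<^sup>2) \<le> 2 ^ Suc k" by simp
    moreover have "expectation (?D (Suc k) m) = expectation (?D k m) + expectation (?D k (m + 2 ^ k)) +
        expectation (\<lambda>\<omega>. (\<Sum>i\<in>{m..<m + 2 ^ Suc k}. Z i \<omega>)\<^sup>2)"
      using Suc sq(1) unfolding dyadic_energy.simps by simp
    ultimately have "expectation (?D (Suc k) m) \<le> (real k + 1) * 2 ^ k + (real k + 1) * 2 ^ k + 2 ^ Suc k"
      using Suc[of m] Suc[of "m + 2 ^ k"] by linarith
    also have "\<dots> = (real (Suc k) + 1) * 2 ^ Suc k" by (simp add: algebra_simps)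
    finally show ?case using Suc sq(1) by (auto intro!: Bochner_Integration.integrable_add)
  qed
  have [measurable]: "?D k m \<in> borel_measurable M" for k m using D by auto
  have growth: "AE \<omega> in M. \<exists>C. \<forall>n. \<bar>\<Sum>i<n. Z i \<omega>\<bar> \<le> C * real (Suc n) powr (1 / 2 + d)" if d: "d > 0" for d
  proof -
    define q where "q = 2 powr (-d)"
    have q: "0 < q" "q < 1" using d by (auto simp: q_def powr_less_one)
    have q': "2 powr (real k * (1 + d)) = 2 ^ k / q ^ k" for k
      by (simp add: q_def powr_minus power_inverse powr_powr[symmetric] powr_realpow[symmetric] powr_add distrib_left)
         (simp add: powr_powr mult.commute divide_inverse)
    have sm: "summable (\<lambda>k. (real k + 1) * q ^ k)"
      using geometric_deriv_sums[of q] q by (auto simp: sums_iff add.commute)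
    define A where "A k = {\<omega>\<in>space M. ?D k 0 \<omega> \<ge> 2 powr (real k * (1 + d))}" for k
    have PA: "prob (A k) \<le> (real k + 1) * q ^ k" for k
    proof -
      have "prob (A k) \<le> expectation (?D k 0) / 2 powr (real k * (1 + d))"
        unfolding A_def using D by (intro integral_Markov_inequality_measure[where A="space M", simplified])
          (auto simp: dyadic_energy_nonneg)
      also have "\<dots> \<le> (real k + 1) * 2 ^ k / 2 powr (real k * (1 + d))"
        using D by (intro divide_right_mono) auto
      also have "\<dots> = (real k + 1) * q ^ k" using q by (simp add: q')
      finally show ?thesis .
    qed
    have "AE \<omega> in M. eventually (\<lambda>k. \<omega> \<in> space M - A k) sequentially"
    proof (rule borel_cantelli_AE1)
      show "A k \<in> events" for k unfolding A_def by measurable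
      show "summable (\<lambda>k. prob (A k))"
        by (rule summable_comparison_test'[OF sm, of 0]) (use PA in auto)
    qed (auto simp: less_top[symmetric])
    thus ?thesis
    proof eventually_elim
      case (elim \<omega>)
      then obtain K where K: "\<And>k. k \<ge> K \<Longrightarrow> ?D k 0 \<omega> \<le> 2 powr (real k * (1 + d))"
        unfolding eventually_sequentially A_def by force
      have "(\<lambda>k. (real k + 1) * q ^ k) \<longlonglongrightarrow> 0" using sm by (rule summable_LIMSEQ_zero)
      hence "Bseq (\<lambda>k. (real k + 1) * q ^ k)" by (rule convergent_imp_Bseq[OF convergentI])
      then obtain B where B: "B > 0" "\<And>k. \<bar>(real k + 1) * q ^ k\<bar> \<le> B" unfolding Bseq_def by auto
      have "\<bar>\<Sum>i<n. Z i \<omega>\<bar> \<le> (sqrt B * (2 ^ Suc K) powr (1/2 + d)) * real (Suc n) powr (1 / 2 + d)" for n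
      proof -
        define j where "j = (LEAST j. n < 2 ^ j)"
        have ex: "\<exists>j. n < 2 ^ j" using less_exp by blast
        have j1: "n < 2 ^ j" unfolding j_def by (rule LeastI_ex[OF ex])
        have j2: "2 ^ j \<le> 2 * Suc n"
        proof (cases j)
          case (Suc i)
          hence "\<not> n < 2 ^ i" using not_less_Least[of i "\<lambda>j. n < 2 ^ j"] by (simp add: j_def)
          thus ?thesis using Suc by simp
        qed simp
        \<comment> \<open>The smallest dyadic scale above \<open>n\<close>, raised by \<open>K\<close> so that the almost sure bound is in force; this only changes the constant.\<close>
        define k where "k = K + j"
        have k1: "n \<le> 2 ^ k" using j1 unfolding k_def power_add
          by (metis le_trans less_imp_le_nat mult_le_mono1 mult_1 one_le_numeral one_le_power)
        have k2: "(2::real) ^ k \<le> 2 ^ Suc K * real (Suc n)"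
        proof -
          have "(2::nat) ^ k \<le> 2 ^ K * (2 * Suc n)" unfolding k_def power_add using j2 by (intro mult_left_mono) auto
          hence "real (2 ^ k) \<le> real (2 ^ K * (2 * Suc n))" by (rule of_nat_mono)
          thus ?thesis by (simp add: algebra_simps)
        qed
        have "(\<Sum>i<n. Z i \<omega>)\<^sup>2 \<le> (real k + 1) * ?D k 0 \<omega>"
          using initial_segment_le_dyadic_energy[OF k1, of "\<lambda>i. Z i \<omega>" 0] by (simp add: atLeast0LessThan)
        also have "\<dots> \<le> (real k + 1) * 2 powr (real k * (1 + d))"
          using K[of k] by (intro mult_left_mono) (auto simp: k_def)
        also have "\<dots> = ((real k + 1) * q ^ k) * (2 powr (real k * (1 + d)) / q ^ k)"
          using q by simp
        also have "\<dots> \<le> B * (2 powr (real k * (1 + d)) / q ^ k)"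
          using B(2)[of k] q by (intro mult_right_mono) auto
        also have "2 powr (real k * (1 + d)) / q ^ k = ((2::real) ^ k) powr (1 + 2 * d)"
          unfolding q_def by (simp add: powr_realpow[symmetric] powr_powr powr_diff[symmetric] algebra_simps)
        also have "\<dots> \<le> (2 ^ Suc K * real (Suc n)) powr (1 + 2 * d)"
          using k2 d by (intro powr_mono2) auto
        finally have "(\<Sum>i<n. Z i \<omega>)\<^sup>2 \<le> B * (2 ^ Suc K * real (Suc n)) powr (1 + 2 * d)"
          using B by (simp add: mult_left_mono)
        hence "\<bar>\<Sum>i<n. Z i \<omega>\<bar> \<le> sqrt (B * (2 ^ Suc K * real (Suc n)) powr (1 + 2 * d))"
          using real_le_rsqrt[of "\<bar>\<Sum>i<n. Z i \<omega>\<bar>"] by simp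
        also have "\<dots> = sqrt B * (2 ^ Suc K * real (Suc n)) powr (1/2 + d)"
          by (simp add: real_sqrt_mult powr_half_sqrt[symmetric] powr_powr field_simps)
        also have "(2 ^ Suc K * real (Suc n)) powr (1/2 + d) = (2 ^ Suc K) powr (1/2 + d) * real (Suc n) powr (1/2 + d)"
          by (intro powr_mult) 
        finally show ?thesis by (simp only: mult.assoc)
      qed
      thus ?case by blast
    qed
  qed
  have "AE \<omega> in M. \<forall>m. \<exists>C. \<forall>n. \<bar>\<Sum>i<n. Z i \<omega>\<bar> \<le> C * real (Suc n) powr (1 / 2 + inverse (real (Suc m)))"
    unfolding AE_all_countable by (intro allI growth) auto
  thus ?thesis
  proof eventually_elim
    case (elim \<omega>)
    show ?case
    proof (intro allI impI)
      fix s :: real assume "s > 0"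
      then obtain m where m: "inverse (real (Suc m)) < s" using reals_Archimedean by blast
      from elim obtain C where "\<And>n. \<bar>\<Sum>i<n. Z i \<omega>\<bar> \<le> C * real (Suc n) powr (1 / 2 + inverse (real (Suc m)))" by blast
      from dirichlet_summable_of_growth[OF this _ m]
      show "summable (\<lambda>n. Z n \<omega> * real (Suc n) powr (-(1 / 2 + s)))" by simp
    qed
  qed
qed

end

section \<open>The Euler product of a random multiplicative function\<close>

text \<open>The range \<open>\<bar>x\<bar> \<le> 3 / 4\<close> includes \<open>x = \<plusminus> 2\<^sup>-\<^sup>1\<^sup>/\<^sup>2\<close>, the largest value in modulus in the Euler product for \<open>s \<ge> 0\<close>. The
  difference vanishes at zero and has derivative \<open>x\<^sup>2 / (1 + x)\<close>.\<close>

lemma ln_one_plus_third_order_bound: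
  fixes x :: real assumes "\<bar>x\<bar> \<le> 3 / 4"
  shows "\<bar>ln (1 + x) - (x - x\<^sup>2 / 2)\<bar> \<le> 4 * \<bar>x\<bar> ^ 3"
proof -
  define g where "g y = ln (1 + y) - (y - y\<^sup>2 / 2)" for y :: real
  have "norm (g x - g 0) \<le> (4 * \<bar>x\<bar>\<^sup>2) * norm (x - 0)"
  proof (rule field_differentiable_bound[of "{-\<bar>x\<bar>..\<bar>x\<bar>}" g "\<lambda>z. z\<^sup>2 / (1 + z)"])
    fix z assume z: "z \<in> {-\<bar>x\<bar>..\<bar>x\<bar>}"
    hence z': "\<bar>z\<bar> \<le> \<bar>x\<bar>" by (simp add: abs_le_iff)
    have z1: "1 / 4 \<le> 1 + z" using z' assms by linarith
    have "1 / (1 + z) - (1 - z) = z\<^sup>2 / (1 + z)"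
      using z1 by (subst eq_divide_eq) (simp add: left_diff_distrib algebra_simps power2_eq_square)
    moreover have "(g has_real_derivative 1 / (1 + z) - (1 - z)) (at z)"
      unfolding g_def using z1 by (auto intro!: derivative_eq_intros)
    ultimately show "(g has_field_derivative z\<^sup>2 / (1 + z)) (at z within {-\<bar>x\<bar>..\<bar>x\<bar>})"
      by (simp only: has_field_derivative_at_within)
    have "z\<^sup>2 * 1 \<le> z\<^sup>2 * (4 * (1 + z))" using z1 by (intro mult_left_mono) auto
    also have "\<dots> \<le> \<bar>x\<bar>\<^sup>2 * (4 * (1 + z))"
      using z1 power_mono[OF z', of 2] by (intro mult_right_mono) auto
    finally have "z\<^sup>2 / (1 + z) \<le> 4 * \<bar>x\<bar>\<^sup>2"
      using z1 by (subst pos_divide_le_eq) (auto simp: algebra_simps)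
    moreover have "0 \<le> z\<^sup>2 / (1 + z)" using z1 by simp
    ultimately show "norm (z\<^sup>2 / (1 + z)) \<le> 4 * \<bar>x\<bar>\<^sup>2"
      unfolding real_norm_def by linarith
  qed (use abs_ge_self[of x] abs_ge_minus_self[of x] in \<open>simp_all add: convex_real_interval\<close>)
  moreover have "(4 * \<bar>x\<bar>\<^sup>2) * norm (x - 0) = 4 * \<bar>x\<bar> ^ 3"
    by (simp only: diff_0_right real_norm_def power2_eq_square power3_eq_cube mult.assoc)
  moreover have "g x - g 0 = ln (1 + x) - (x - x\<^sup>2 / 2)" by (simp add: g_def)
  ultimately show ?thesis by (simp only: real_norm_def)
qed

lemma le_on_rationals_imp_le:
  fixes g h :: "real \<Rightarrow> real"
  assumes "continuous_on {0<..} g" "continuous_on {0<..} h"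
    and "\<And>q. q \<in> \<rat> \<Longrightarrow> q > 0 \<Longrightarrow> g q \<le> h q" and s: "s > 0"
  shows "g s \<le> h s"
proof (rule ccontr)
  assume "\<not> g s \<le> h s"
  have "isCont (\<lambda>x. g x - h x) s"
    using assms(1,2) s by (intro continuous_intros) (simp_all add: continuous_on_eq_continuous_at)
  hence "((\<lambda>x. g x - h x) \<longlongrightarrow> g s - h s) (at s)" by (simp add: isCont_def)
  hence "\<forall>\<^sub>F x in at s. g x - h x > 0" using \<open>\<not> g s \<le> h s\<close> by (intro order_tendstoD) auto
  moreover have "\<forall>\<^sub>F x in at s. x > 0" using s by (intro order_tendstoD[OF tendsto_ident_at])
  ultimately have "\<forall>\<^sub>F x in at s. g x - h x > 0 \<and> x > 0" by (rule eventually_conj)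
  then obtain d where d: "d > 0" "\<And>x. x \<noteq> s \<Longrightarrow> dist x s < d \<Longrightarrow> g x - h x > 0 \<and> x > 0"
    unfolding eventually_at by blast
  obtain q where q: "q \<in> \<rat>" "s < q" "q < s + d" using Rats_dense_in_real[of s "s + d"] d(1) by auto
  have "g q - h q > 0" "q > 0" using d(2)[of q] q by (simp_all add: dist_real_def)
  with assms(3)[OF q(1)] show False by simp
qed

context rademacher_multiplicative
begin

abbreviation prime_index :: "nat set" where "prime_index \<equiv> {i. prime (Suc i)}"

text \<open>The signs at the primes appear twice: indexed by \<open>i\<close> with \<open>Suc i\<close> prime, which matches the indexing of
  the series, and indexed by the primes themselves, which matches finite products over primes.\<close>

sublocale signs: rademacher_signs M "\<lambda>i. f (Suc i)" prime_index
proof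
  show "indep_vars (\<lambda>_. borel) (\<lambda>i. f (Suc i)) prime_index"
    by (rule indep_vars_reindex_inj[OF indep, of Suc]) auto
qed (auto simp: prob_plus prob_minus)

sublocale psigns: rademacher_signs M f "{p. prime p}"
  by standard (auto simp: indep prob_plus prob_minus)

lemma f_eq: "\<omega> \<in> space M \<Longrightarrow> n \<ge> 1 \<Longrightarrow>
    f n \<omega> = (if squarefree n then \<Prod>p\<in>prime_factors n. f p \<omega> else 0)"
  using f_squarefree f_not_squarefree by auto

lemma measurable_f [measurable]: "f (Suc i) \<in> borel_measurable M"
proof -
  have "(\<lambda>\<omega>. if squarefree (Suc i) then \<Prod>p\<in>prime_factors (Suc i). f p \<omega> else 0) \<in> borel_measurable M"
    by (cases "squarefree (Suc i)") (auto intro!: borel_measurable_prod psigns.measurable_sign)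
  thus ?thesis by (subst measurable_cong[OF f_eq]) auto
qed

text \<open>For squarefree arguments the values of \<open>f\<close> are products of signs over the sets of prime factors, and these sets determine
  the arguments.\<close>

lemma f_orthonormal:
  assumes "m \<ge> 1" "n \<ge> 1"
  shows "integrable M (\<lambda>\<omega>. f m \<omega> * f n \<omega>)"
    and "expectation (\<lambda>\<omega>. f m \<omega> * f n \<omega>) = (if m = n \<and> squarefree n then 1 else 0)"
proof -
  have sub: "prime_factors m \<subseteq> {p. prime p}" "prime_factors n \<subseteq> {p. prime p}" by auto
  note E = psigns.expectation_prod_signs[OF finite_set_mset sub(1) finite_set_mset sub(2)]
  show "integrable M (\<lambda>\<omega>. f m \<omega> * f n \<omega>)"
    and "expectation (\<lambda>\<omega>. f m \<omega> * f n \<omega>) = (if m = n \<and> squarefree n then 1 else 0)"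
  proof (atomize(full), cases "squarefree m \<and> squarefree n")
    case True
    hence eq: "f m \<omega> * f n \<omega> = (\<Prod>p\<in>prime_factors m. f p \<omega>) * (\<Prod>p\<in>prime_factors n. f p \<omega>)"
      if "\<omega> \<in> space M" for \<omega> using f_squarefree[OF that] assms by simp
    have "prime_factors m = prime_factors n \<longleftrightarrow> m = n"
      using True prod_prime_factors_squarefree by metis
    with E(2) True have E2: "expectation (\<lambda>\<omega>. (\<Prod>p\<in>prime_factors m. f p \<omega>) * (\<Prod>p\<in>prime_factors n. f p \<omega>)) =
      (if m = n \<and> squarefree n then 1 else 0)" by (simp only: True simp_thms)
    have "integrable M (\<lambda>\<omega>. f m \<omega> * f n \<omega>) \<longleftrightarrow> integrable M (\<lambda>\<omega>. (\<Prod>p\<in>prime_factors m. f p \<omega>) * (\<Prod>p\<in>prime_factors n. f p \<omega>))"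
      by (rule Bochner_Integration.integrable_cong[OF refl]) (rule eq)
    moreover have "expectation (\<lambda>\<omega>. f m \<omega> * f n \<omega>) = expectation (\<lambda>\<omega>. (\<Prod>p\<in>prime_factors m. f p \<omega>) * (\<Prod>p\<in>prime_factors n. f p \<omega>))"
      by (rule Bochner_Integration.integral_cong[OF refl]) (rule eq)
    ultimately show "integrable M (\<lambda>\<omega>. f m \<omega> * f n \<omega>) \<and> expectation (\<lambda>\<omega>. f m \<omega> * f n \<omega>) = (if m = n \<and> squarefree n then 1 else 0)"
      using E(1) E2 by (simp only: simp_thms)
  next
    case False
    hence eq: "f m \<omega> * f n \<omega> = 0" if "\<omega> \<in> space M" for \<omega>
      using f_not_squarefree[OF that] assms by auto
    have "integrable M (\<lambda>\<omega>. f m \<omega> * f n \<omega>) \<longleftrightarrow> integrable M (\<lambda>\<omega>. 0 :: real)"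
      by (rule Bochner_Integration.integrable_cong[OF refl]) (rule eq)
    moreover have "expectation (\<lambda>\<omega>. f m \<omega> * f n \<omega>) = expectation (\<lambda>\<omega>. 0)"
      by (rule Bochner_Integration.integral_cong[OF refl]) (rule eq)
    ultimately show "integrable M (\<lambda>\<omega>. f m \<omega> * f n \<omega>) \<and> expectation (\<lambda>\<omega>. f m \<omega> * f n \<omega>) = (if m = n \<and> squarefree n then 1 else 0)"
      using False by auto
  qed
qed

lemma f_orthonormal_Suc:
  "integrable M (\<lambda>\<omega>. f (Suc i) \<omega> * f (Suc j) \<omega>)"
  "i \<noteq> j \<Longrightarrow> expectation (\<lambda>\<omega>. f (Suc i) \<omega> * f (Suc j) \<omega>) = 0"
  "expectation (\<lambda>\<omega>. (f (Suc i) \<omega>)\<^sup>2) \<le> 1"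
  using f_orthonormal(1)[of "Suc i" "Suc j"] f_orthonormal(2)[of "Suc i" "Suc j"]
    f_orthonormal(2)[of "Suc i" "Suc i"] by (simp_all add: power2_eq_square)

lemma AE_F_summable:
  "AE \<omega> in M. \<forall>s>0. summable (\<lambda>n. f (Suc n) \<omega> * real (Suc n) powr (-(1 / 2 + s)))"
  by (rule AE_dirichlet_summable[OF measurable_f f_orthonormal_Suc])

definition prime_series :: "'a \<Rightarrow> real \<Rightarrow> real" where
  "prime_series \<omega> s = (\<Sum>n. (if prime (Suc n) then f (Suc n) \<omega> else 0) * real (Suc n) powr (-(1 / 2 + s)))"

lemma AE_prime_series_summable:
  "AE \<omega> in M. \<forall>s>0. summable (\<lambda>n. (if prime (Suc n) then f (Suc n) \<omega> else 0) * real (Suc n) powr (-(1 / 2 + s)))"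
proof (rule AE_dirichlet_summable)
  let ?Z = "\<lambda>n \<omega>. if prime (Suc n) then f (Suc n) \<omega> else 0"
  show "integrable M (\<lambda>\<omega>. ?Z i \<omega> * ?Z j \<omega>)" for i j
    by (cases "prime (Suc i)"; cases "prime (Suc j)") (simp_all only: f_orthonormal_Suc if_True if_False mult_zero_left mult_zero_right, simp_all)
  show "expectation (\<lambda>\<omega>. ?Z i \<omega> * ?Z j \<omega>) = 0" if "i \<noteq> j" for i j
    using that by (cases "prime (Suc i)"; cases "prime (Suc j)") (simp_all only: f_orthonormal_Suc if_True if_False mult_zero_left mult_zero_right, simp_all)
  show "expectation (\<lambda>\<omega>. (?Z i \<omega>)\<^sup>2) \<le> 1" for i
    by (cases "prime (Suc i)") (simp_all only: f_orthonormal_Suc if_True if_False, simp_all)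
qed auto

lemma squarefree_below_subset:
  "{n\<in>{1..N}. squarefree n} \<subseteq> smooth_squarefree {p. prime p \<and> p \<le> N}"
proof
  fix n assume n: "n \<in> {n\<in>{1..N}. squarefree n}"
  have "p \<le> N" if "p \<in> prime_factors n" for p
    using that n dvd_imp_le[of p n] by (auto simp: in_prime_factors_iff)
  thus "n \<in> smooth_squarefree {p. prime p \<and> p \<le> N}" using n by (auto simp: smooth_squarefree_def)
qed

text \<open>The finite Euler product is the sum of \<open>f(n) n\<^sup>-\<^sup>1\<^sup>/\<^sup>2\<^sup>-\<^sup>s\<close> over all \<open>n\<close> with prime factors at most \<open>N\<close>. It
  contains the partial sum up to \<open>N\<close>, and the remaining terms all have \<open>n > N\<close>; by orthogonality
  their mean square is at most a tail of the series for \<open>\<zeta> (1 + 2 s)\<close>.\<close>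

lemma euler_product_L2:
  assumes s: "s > 0"
  defines "D \<equiv> \<lambda>N \<omega>. \<Prod>p\<in>{p. prime p \<and> p \<le> N}. 1 + f p \<omega> * real p powr (-(1/2+s))"
  defines "S \<equiv> \<lambda>N \<omega>. \<Sum>i<N. f (Suc i) \<omega> * real (Suc i) powr (-(1/2+s))"
  shows "integrable M (\<lambda>\<omega>. (D N \<omega> - S N \<omega>)\<^sup>2)"
    and "expectation (\<lambda>\<omega>. (D N \<omega> - S N \<omega>)\<^sup>2) \<le> zeta_real (1 + 2 * s) - (\<Sum>i<N. real (Suc i) powr (-(1 + 2 * s)))"
proof -
  let ?P = "{p. prime p \<and> p \<le> N}"
  define A where "A = smooth_squarefree ?P - {1..N}"
  let ?Z = "\<lambda>n \<omega>. f n \<omega> * real n powr (-(1/2+s))"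
  have P: "finite ?P" "\<And>p. p \<in> ?P \<Longrightarrow> prime p" by (auto simp: finite_primes_le)
  have fin: "finite A" using finite_smooth_squarefree[OF P] by (simp add: A_def)
  have A: "n \<ge> 1" "n > N" "squarefree n" if "n \<in> A" for n
  proof -
    show sq: "squarefree n" using that by (auto simp: A_def smooth_squarefree_def)
    hence "n \<noteq> 0" by (metis not_squarefree_0)
    thus "n \<ge> 1" by simp
    with that show "n > N" by (auto simp: A_def)
  qed
  have eq: "D N \<omega> - S N \<omega> = (\<Sum>n\<in>A. ?Z n \<omega>)" if "\<omega> \<in> space M" for \<omega>
  proof -
    have "D N \<omega> = (\<Sum>n\<in>smooth_squarefree ?P. \<Prod>p\<in>prime_factors n. f p \<omega> * real p powr (-(1/2+s)))"
      unfolding D_def by (rule prod_one_plus_primes[OF P])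
    also have "\<dots> = (\<Sum>n\<in>smooth_squarefree ?P. ?Z n \<omega>)"
    proof (rule sum.cong[OF refl])
      fix n assume "n \<in> smooth_squarefree ?P"
      hence n: "squarefree n" by (auto simp: smooth_squarefree_def)
      hence "n \<noteq> 0" by (metis not_squarefree_0)
      with n f_eq[OF that, of n] show "(\<Prod>p\<in>prime_factors n. f p \<omega> * real p powr (-(1/2+s))) = ?Z n \<omega>"
        by (simp add: prod.distrib prod_powr_prime_factors)
    qed
    also have "\<dots> = (\<Sum>n\<in>{n\<in>{1..N}. squarefree n}. ?Z n \<omega>) + (\<Sum>n\<in>A. ?Z n \<omega>)"
    proof -
      have "smooth_squarefree ?P - {n\<in>{1..N}. squarefree n} = A"
        by (auto simp: A_def smooth_squarefree_def)
      thus ?thesis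
        using sum.subset_diff[OF squarefree_below_subset finite_smooth_squarefree[OF P], where g = "\<lambda>n. ?Z n \<omega>"]
        by (simp add: add.commute)
    qed
    also have "(\<Sum>n\<in>{n\<in>{1..N}. squarefree n}. ?Z n \<omega>) = (\<Sum>n\<in>{1..N}. ?Z n \<omega>)"
      using f_not_squarefree[OF that] by (intro sum.mono_neutral_left) auto
    also have "\<dots> = S N \<omega>" unfolding S_def
      by (rule sum.reindex_bij_witness[of _ Suc "\<lambda>p. p - 1"]) auto
    finally show ?thesis by simp
  qed
  have orth: "integrable M (\<lambda>\<omega>. ?Z m \<omega> * ?Z n \<omega>)"
    "expectation (\<lambda>\<omega>. ?Z m \<omega> * ?Z n \<omega>) = (if m = n then real n powr (-(1 + 2 * s)) else 0)"
    if "m \<in> A" "n \<in> A" for m n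
  proof -
    have *: "?Z m \<omega> * ?Z n \<omega> = (real m powr (-(1/2+s)) * real n powr (-(1/2+s))) * (f m \<omega> * f n \<omega>)" for \<omega>
      by (simp add: mult_ac)
    show "integrable M (\<lambda>\<omega>. ?Z m \<omega> * ?Z n \<omega>)"
      unfolding * using f_orthonormal(1)[of m n] A that by auto
    show "expectation (\<lambda>\<omega>. ?Z m \<omega> * ?Z n \<omega>) = (if m = n then real n powr (-(1 + 2 * s)) else 0)"
      unfolding * using f_orthonormal[of m n] A that by (auto simp: powr_add[symmetric])
  qed
  have E: "integrable M (\<lambda>\<omega>. (\<Sum>n\<in>A. ?Z n \<omega>)\<^sup>2)"
    "expectation (\<lambda>\<omega>. (\<Sum>n\<in>A. ?Z n \<omega>)\<^sup>2) = (\<Sum>n\<in>A. expectation (\<lambda>\<omega>. (?Z n \<omega>)\<^sup>2))"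
    by (rule expectation_square_sum_orthogonal[of A ?Z]; simp only: orth if_False)+
  have eq2: "(D N \<omega> - S N \<omega>)\<^sup>2 = (\<Sum>n\<in>A. ?Z n \<omega>)\<^sup>2" if "\<omega> \<in> space M" for \<omega>
    by (simp only: eq[OF that])
  show "integrable M (\<lambda>\<omega>. (D N \<omega> - S N \<omega>)\<^sup>2)"
  proof -
    have "integrable M (\<lambda>\<omega>. (D N \<omega> - S N \<omega>)\<^sup>2) \<longleftrightarrow> integrable M (\<lambda>\<omega>. (\<Sum>n\<in>A. ?Z n \<omega>)\<^sup>2)"
      by (rule Bochner_Integration.integrable_cong[OF refl]) (rule eq2)
    with E(1) show ?thesis by simp
  qed
  have "expectation (\<lambda>\<omega>. (D N \<omega> - S N \<omega>)\<^sup>2) = expectation (\<lambda>\<omega>. (\<Sum>n\<in>A. ?Z n \<omega>)\<^sup>2)"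
    by (rule Bochner_Integration.integral_cong[OF refl]) (rule eq2)
  also have "\<dots> = (\<Sum>n\<in>A. expectation (\<lambda>\<omega>. (?Z n \<omega>)\<^sup>2))" by (rule E(2))
  also have "\<dots> = (\<Sum>n\<in>A. real n powr (-(1 + 2 * s)))"
    by (intro sum.cong refl) (simp add: power2_eq_square orth del: minus_add_distrib)
  also have "\<dots> \<le> zeta_real (1 + 2 * s) - (\<Sum>n\<in>{1..N}. real n powr (-(1 + 2 * s)))"
  proof -
    have "(\<Sum>n\<in>A. real n powr (-(1 + 2 * s))) + (\<Sum>n\<in>{1..N}. real n powr (-(1 + 2 * s)))
        = (\<Sum>n\<in>A \<union> {1..N}. real n powr (-(1 + 2 * s)))"
      using fin by (intro sum.union_disjoint[symmetric]) (auto simp: A_def)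
    also have "\<dots> \<le> zeta_real (1 + 2 * s)"
      using s fin A(1)[of 0] by (intro sum_le_zeta_real) auto
    finally show ?thesis by simp
  qed
  also have "(\<Sum>n\<in>{1..N}. real n powr (-(1 + 2 * s))) = (\<Sum>i<N. real (Suc i) powr (-(1 + 2 * s)))"
    by (rule sum.reindex_bij_witness[of _ Suc "\<lambda>p. p - 1"]) auto
  finally show "expectation (\<lambda>\<omega>. (D N \<omega> - S N \<omega>)\<^sup>2) \<le> zeta_real (1 + 2 * s) - (\<Sum>i<N. real (Suc i) powr (-(1 + 2 * s)))" .
qed

text \<open>Mean square convergence only gives the Euler product along a subsequence, for a fixed \<open>s\<close>. That is
  enough, since the estimate of the logarithm of the finite products holds for every \<open>N\<close>. Stating the bounds for \<open>F\<close>
  itself rather than for its logarithm keeps them stable under limits.\<close>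

lemma AE_ln_F_at:
  assumes s: "s > 0"
  defines "C \<equiv> 4 * zeta_real (3 / 2)"
  shows "AE \<omega> in M. exp (prime_series \<omega> s - prime_zeta (1 + 2 * s) / 2 - C) \<le> dirichlet_F f \<omega> s
     \<and> dirichlet_F f \<omega> s \<le> exp (prime_series \<omega> s - prime_zeta (1 + 2 * s) / 2 + C)"
proof -
  let ?w = "\<lambda>n. real n powr (-(1/2+s))"
  define D where "D N \<omega> = (\<Prod>p\<in>{p. prime p \<and> p \<le> N}. 1 + f p \<omega> * ?w p)" for N \<omega>
  define S where "S N \<omega> = (\<Sum>i<N. f (Suc i) \<omega> * ?w (Suc i))" for N \<omega>
  define X where "X N \<omega> = (\<Sum>i<N. (if prime (Suc i) then f (Suc i) \<omega> else 0) * ?w (Suc i))" for N \<omega>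
  define Q where "Q N = (\<Sum>i<N. if prime (Suc i) then real (Suc i) powr (-(1 + 2 * s)) else 0)" for N
  note L2 = euler_product_L2[OF s, folded D_def S_def]
  have "(\<lambda>N. expectation (\<lambda>\<omega>. norm ((D N \<omega> - S N \<omega>)\<^sup>2))) \<longlonglongrightarrow> 0"
  proof (rule tendsto_sandwich[OF always_eventually always_eventually tendsto_const])
    have "(\<lambda>N. \<Sum>i<N. real (Suc i) powr (-(1 + 2 * s))) \<longlonglongrightarrow> zeta_real (1 + 2 * s)"
      unfolding zeta_real_def using s by (intro summable_LIMSEQ zeta_real_summable) auto
    from tendsto_diff[OF tendsto_const[of "zeta_real (1 + 2 * s)"] this]
    show "(\<lambda>N. zeta_real (1 + 2 * s) - (\<Sum>i<N. real (Suc i) powr (-(1 + 2 * s)))) \<longlonglongrightarrow> 0" by simp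
  qed (use L2(2) in auto)
  from tendsto_L1_AE_subseq[OF L2(1) this]
  obtain r where r: "strict_mono r" "AE \<omega> in M. (\<lambda>n. (D (r n) \<omega> - S (r n) \<omega>)\<^sup>2) \<longlonglongrightarrow> 0" by blast
  have signs: "AE \<omega> in M. \<forall>p\<in>{p. prime p}. f p \<omega> = 1 \<or> f p \<omega> = -1"
    using psigns.AE_sign by (subst AE_ball_countable) auto
  show ?thesis
    using r(2) signs AE_F_summable AE_prime_series_summable
  proof eventually_elim
    case (elim \<omega>)
    have sign: "f p \<omega> = 1 \<or> f p \<omega> = -1" if "prime p" for p using elim(2) that by auto
    have "(\<lambda>n. S n \<omega>) \<longlonglongrightarrow> dirichlet_F f \<omega> s"
    proof -
      have "f (Suc n) \<omega> * ?w (Suc n) = f (Suc n) \<omega> / real (Suc n) powr (1/2 + s)" for n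
        by (simp only: powr_minus divide_inverse)
      thus ?thesis unfolding S_def dirichlet_F_def
        using summable_LIMSEQ[OF elim(3)[rule_format, OF s]] by simp
    qed
    from LIMSEQ_subseq_LIMSEQ[OF this r(1)]
    have S: "(\<lambda>n. S (r n) \<omega>) \<longlonglongrightarrow> dirichlet_F f \<omega> s" by (simp add: comp_def)
    have "(\<lambda>n. sqrt ((D (r n) \<omega> - S (r n) \<omega>)\<^sup>2)) \<longlonglongrightarrow> sqrt 0"
      by (intro tendsto_real_sqrt elim)
    hence "(\<lambda>n. D (r n) \<omega> - S (r n) \<omega>) \<longlonglongrightarrow> 0" by (simp add: tendsto_rabs_zero_iff)
    from tendsto_add[OF this S] have D: "(\<lambda>n. D (r n) \<omega>) \<longlonglongrightarrow> dirichlet_F f \<omega> s" by simp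
    have "(\<lambda>n. X n \<omega>) \<longlonglongrightarrow> prime_series \<omega> s"
      unfolding X_def prime_series_def by (intro summable_LIMSEQ) (use elim(4) s in auto)
    from LIMSEQ_subseq_LIMSEQ[OF this r(1)]
    have X: "(\<lambda>n. X (r n) \<omega>) \<longlonglongrightarrow> prime_series \<omega> s" by (simp add: comp_def)
    have "Q \<longlonglongrightarrow> prime_zeta (1 + 2 * s)"
      unfolding Q_def[abs_def] prime_zeta_def using s by (intro summable_LIMSEQ prime_zeta_summable) auto
    from LIMSEQ_subseq_LIMSEQ[OF this r(1)]
    have Q: "(\<lambda>n. Q (r n)) \<longlonglongrightarrow> prime_zeta (1 + 2 * s)" by (simp add: comp_def)
    have bound: "exp (X N \<omega> - Q N / 2 - C) \<le> D N \<omega> \<and> D N \<omega> \<le> exp (X N \<omega> - Q N / 2 + C)" for N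
    proof -
      let ?P = "{p. prime p \<and> p \<le> N}"
      let ?x = "\<lambda>p. f p \<omega> * ?w p"
      have x: "\<bar>?x p\<bar> \<le> 3/4" "\<bar>?x p\<bar> ^ 3 \<le> real p powr (-(3/2))" "(?x p)\<^sup>2 = real p powr (-(1 + 2 * s))"
        if "p \<in> ?P" for p
      proof -
        have p: "prime p" "p \<ge> 2" using that prime_ge_2_nat by auto
        have a: "\<bar>?x p\<bar> = ?w p" using sign[OF p(1)] by (auto simp: abs_mult)
        have le: "?w p \<le> real p powr (-(1/2))" using p s by (intro powr_mono) auto
        also have "\<dots> \<le> 2 powr (-(1/2))" using p by (intro powr_mono2') auto
        also have "\<dots> = 1 / sqrt 2" by (simp add: powr_minus_divide powr_half_sqrt)
        also have "\<dots> \<le> 3 / 4"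
        proof -
          have "4 / 3 \<le> sqrt 2" by (rule real_le_rsqrt) (simp add: power2_eq_square)
          thus ?thesis by (simp add: field_simps)
        qed
        finally show "\<bar>?x p\<bar> \<le> 3/4" using a by simp
        have "\<bar>?x p\<bar> ^ 3 \<le> (real p powr (-(1/2))) ^ 3" unfolding a by (intro power_mono le) auto
        also have "\<dots> = real p powr (-(3/2))"
          using p by (simp add: powr_realpow[symmetric] powr_powr)
        finally show "\<bar>?x p\<bar> ^ 3 \<le> real p powr (-(3/2))" .
        show "(?x p)\<^sup>2 = real p powr (-(1 + 2 * s))"
          using sign[OF p(1)] by (auto simp: power2_eq_square powr_add[symmetric])
      qed
      have pos: "1 + ?x p > 0" if "p \<in> ?P" for p using x(1)[OF that] by (auto simp: abs_le_iff)
      have "ln (D N \<omega>) = (\<Sum>p\<in>?P. ln (1 + ?x p))"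
        unfolding D_def using pos finite_primes_le by (subst ln_prod) (auto simp: less_imp_neq[THEN not_sym])
      moreover have "X N \<omega> = (\<Sum>p\<in>?P. ?x p)"
        unfolding X_def sum_primes_Suc[symmetric] by (intro sum.cong) auto
      moreover have "Q N = (\<Sum>p\<in>?P. (?x p)\<^sup>2)"
      proof -
        have "Q N = (\<Sum>p\<in>?P. real p powr (-(1 + 2 * s)))"
          unfolding Q_def by (rule sum_primes_Suc)
        thus ?thesis using x(3) by simp
      qed
      ultimately have "\<bar>ln (D N \<omega>) - (X N \<omega> - Q N / 2)\<bar> = \<bar>\<Sum>p\<in>?P. ln (1 + ?x p) - (?x p - (?x p)\<^sup>2 / 2)\<bar>"
        by (simp only: sum_subtractf sum_divide_distrib)
      also have "\<dots> \<le> (\<Sum>p\<in>?P. \<bar>ln (1 + ?x p) - (?x p - (?x p)\<^sup>2 / 2)\<bar>)" by (rule sum_abs)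
      also have "\<dots> \<le> (\<Sum>p\<in>?P. 4 * real p powr (-(3/2)))"
        by (intro sum_mono order.trans[OF ln_one_plus_third_order_bound] mult_left_mono x) auto
      also have "\<dots> \<le> C" unfolding C_def sum_distrib_left[symmetric]
        by (intro mult_left_mono sum_le_zeta_real finite_primes_le) auto
      finally have *: "\<bar>ln (D N \<omega>) - (X N \<omega> - Q N / 2)\<bar> \<le> C" .
      have "D N \<omega> > 0" unfolding D_def by (intro prod_pos ballI pos)
      hence "D N \<omega> = exp (ln (D N \<omega>))" by simp
      also have "\<dots> \<le> exp (X N \<omega> - Q N / 2 + C)" using * by (simp add: abs_le_iff)
      finally have 1: "D N \<omega> \<le> exp (X N \<omega> - Q N / 2 + C)" .
      have "exp (X N \<omega> - Q N / 2 - C) \<le> exp (ln (D N \<omega>))" using * unfolding exp_le_cancel_iff by linarith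
      with 1 \<open>D N \<omega> > 0\<close> show ?thesis by simp
    qed
    have "exp (prime_series \<omega> s - prime_zeta (1 + 2 * s) / 2 - C) \<le> dirichlet_F f \<omega> s"
      by (rule LIMSEQ_le[OF _ D, of "\<lambda>n. exp (X (r n) \<omega> - Q (r n) / 2 - C)"])
         (use bound in \<open>auto intro!: tendsto_intros X Q\<close>)
    moreover have "dirichlet_F f \<omega> s \<le> exp (prime_series \<omega> s - prime_zeta (1 + 2 * s) / 2 + C)"
      by (rule LIMSEQ_le[OF D, of "\<lambda>n. exp (X (r n) \<omega> - Q (r n) / 2 + C)"])
         (use bound in \<open>auto intro!: tendsto_intros X Q\<close>)
    ultimately show ?case ..
  qed
qed

lemma continuous_prime_series:
  assumes "\<forall>s>0. summable (\<lambda>n. (if prime (Suc n) then f (Suc n) \<omega> else 0) * real (Suc n) powr (-(1 / 2 + s)))"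
  shows "continuous_on {0<..} (prime_series \<omega>)"
proof -
  have eq: "x * real (Suc n) powr (-(1/2)) * real (Suc n) powr (-s) = x * real (Suc n) powr (-(1/2+s))" for x s n
    by (simp add: powr_add[symmetric] mult.assoc)
  from dirichlet_continuous[of "\<lambda>n. (if prime (Suc n) then f (Suc n) \<omega> else 0) * real (Suc n) powr (-(1/2))"]
  show ?thesis unfolding eq prime_series_def[abs_def] using assms by blast
qed

lemma continuous_dirichlet_F:
  assumes "\<forall>s>0. summable (\<lambda>n. f (Suc n) \<omega> * real (Suc n) powr (-(1 / 2 + s)))"
  shows "continuous_on {0<..} (dirichlet_F f \<omega>)"
proof -
  have eq: "x * real (Suc n) powr (-(1/2)) * real (Suc n) powr (-s) = x * real (Suc n) powr (-(1/2+s))" for x s n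
    by (simp add: powr_add[symmetric] mult.assoc)
  have eq2: "dirichlet_F f \<omega> = (\<lambda>s. \<Sum>n. f (Suc n) \<omega> * real (Suc n) powr (-(1/2+s)))"
    unfolding dirichlet_F_def[abs_def] by (simp only: powr_minus divide_inverse)
  from dirichlet_continuous[of "\<lambda>n. f (Suc n) \<omega> * real (Suc n) powr (-(1/2))"]
  show ?thesis unfolding eq eq2 using assms by blast
qed

text \<open>Both sides of the bounds in \<open>AE_ln_F_at\<close> are continuous in \<open>s\<close>, so the exceptional set can be chosen
  independently of \<open>s\<close>.\<close>

lemma AE_ln_F:
  obtains C where "AE \<omega> in M. \<forall>s>0. 
     \<bar>ln (dirichlet_F f \<omega> s) - (prime_series \<omega> s - prime_zeta (1 + 2 * s) / 2)\<bar> \<le> C"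
proof -
  define C where "C = 4 * zeta_real (3 / 2)"
  let ?lo = "\<lambda>\<omega> s. exp (prime_series \<omega> s - prime_zeta (1 + 2 * s) / 2 - C)"
  let ?hi = "\<lambda>\<omega> s. exp (prime_series \<omega> s - prime_zeta (1 + 2 * s) / 2 + C)"
  have "continuous_on {0<..} (\<lambda>s. prime_zeta (1 + s))"
  proof -
    have eq: "(if prime (Suc n) then real (Suc n) powr (-1) else 0) * real (Suc n) powr (-s) =
      (if prime (Suc n) then real (Suc n) powr (-(1 + s)) else 0)" for n s
      by (cases "prime (Suc n)")
         (simp_all only: if_True if_False mult_zero_left powr_add[symmetric] minus_add_distrib)
    from dirichlet_continuous[of "\<lambda>n. if prime (Suc n) then real (Suc n) powr (-1) else 0"]
    show ?thesis unfolding eq prime_zeta_def using prime_zeta_summable[of "1 + s" for s] by simp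
  qed
  hence cz: "continuous_on {0<..} (\<lambda>s. prime_zeta (1 + 2 * s))"
    by (rule continuous_on_compose2) (auto intro!: continuous_intros)
  have "AE \<omega> in M. \<forall>q\<in>{q\<in>\<rat>. q > 0}. ?lo \<omega> q \<le> dirichlet_F f \<omega> q \<and> dirichlet_F f \<omega> q \<le> ?hi \<omega> q"
    unfolding C_def using AE_ln_F_at
    by (subst AE_ball_countable) (auto intro!: countable_subset[OF _ countable_rat])
  with AE_F_summable AE_prime_series_summable
  have "AE \<omega> in M. \<forall>s>0. \<bar>ln (dirichlet_F f \<omega> s) - (prime_series \<omega> s - prime_zeta (1 + 2 * s) / 2)\<bar> \<le> C"
  proof eventually_elim
    case (elim \<omega>)
    note cont = continuous_dirichlet_F[OF elim(1)] continuous_prime_series[OF elim(2)] cz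
    show ?case
    proof (intro allI impI)
      fix s :: real assume s: "s > 0"
      have lo: "?lo \<omega> s \<le> dirichlet_F f \<omega> s"
        by (rule le_on_rationals_imp_le[OF _ _ _ s]) (use elim(3) in \<open>auto intro!: continuous_intros cont\<close>)
      have hi: "dirichlet_F f \<omega> s \<le> ?hi \<omega> s"
        by (rule le_on_rationals_imp_le[OF _ _ _ s]) (use elim(3) in \<open>auto intro!: continuous_intros cont\<close>)
      have pos: "dirichlet_F f \<omega> s > 0" using lo by (rule less_le_trans[OF exp_gt_zero])
      from lo have "ln (?lo \<omega> s) \<le> ln (dirichlet_F f \<omega> s)" by (intro ln_mono) auto
      moreover from hi pos have "ln (dirichlet_F f \<omega> s) \<le> ln (?hi \<omega> s)" by (intro ln_mono) auto
      ultimately show "\<bar>ln (dirichlet_F f \<omega> s) - (prime_series \<omega> s - prime_zeta (1 + 2 * s) / 2)\<bar> \<le> C"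
        unfolding ln_exp by linarith
    qed
  qed
  thus ?thesis by (rule that)
qed

text \<open>The series at \<open>s\<close> is the series at \<open>s0\<close> with the additional weights \<open>(i + 1)\<^sup>-\<^sup>(\<^sup>s\<^sup>-\<^sup>s\<^sup>0\<^sup>)\<close>, which decrease
  from 1. The factor \<open>c\<close> will be \<open>1\<close> or \<open>-1\<close> to treat both directions together.\<close>

lemma prime_series_le_of_partial_sums:
  assumes s: "0 < s0" "s0 \<le> s" and l: "l \<ge> 0"
    and sm: "\<forall>s>0. summable (\<lambda>n. (if prime (Suc n) then f (Suc n) \<omega> else 0) * real (Suc n) powr (-(1 / 2 + s)))"
    and le: "\<And>n. signs.partial_sum (\<lambda>i. c * real (Suc i) powr (-(1 / 2 + s0))) n \<omega> \<le> l"
  shows "c * prime_series \<omega> s \<le> l"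
proof -
  define b where "b i = (if i \<in> prime_index then c * real (Suc i) powr (-(1 / 2 + s0)) * f (Suc i) \<omega> else 0)" for i
  have eq: "b i * real (Suc i) powr (-(s - s0)) = c * ((if prime (Suc i) then f (Suc i) \<omega> else 0) * real (Suc i) powr (-(1 / 2 + s)))" for i
  proof -
    have "real (Suc i) powr (-(1 / 2 + s0)) * real (Suc i) powr (-(s - s0)) = real (Suc i) powr (-(1 / 2 + s))"
      unfolding powr_add[symmetric] by (rule arg_cong[where f = "(powr) (real (Suc i))"]) simp
    thus ?thesis
      by (cases "prime (Suc i)")
         (simp_all only: b_def mem_Collect_eq if_True if_False mult_ac mult_zero_left mult_zero_right)
  qed
  have "(\<Sum>i<n. b i * real (Suc i) powr (-(s - s0))) \<le> l * real (Suc 0) powr (-(s - s0))" for n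
    using le s by (intro weighted_sum_le l Suc_powr_minus_decseq powr_ge_zero)
      (simp_all only: signs.partial_sum_def b_def diff_ge_0_iff_ge)
  hence le': "(\<Sum>i<n. c * ((if prime (Suc i) then f (Suc i) \<omega> else 0) * real (Suc i) powr (-(1 / 2 + s)))) \<le> l" for n
    unfolding eq by simp
  have "(\<lambda>i. c * ((if prime (Suc i) then f (Suc i) \<omega> else 0) * real (Suc i) powr (-(1 / 2 + s)))) sums (c * prime_series \<omega> s)"
    unfolding prime_series_def using sm s by (intro sums_mult summable_sums) auto
  hence "(\<lambda>n. \<Sum>i<n. c * ((if prime (Suc i) then f (Suc i) \<omega> else 0) * real (Suc i) powr (-(1 / 2 + s)))) \<longlonglongrightarrow> c * prime_series \<omega> s"
    by (simp add: sums_def)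
  thus ?thesis by (rule LIMSEQ_le_const2) (use le' in auto)
qed

end


section \<open>The law of the iterated logarithm for the prime series\<close>

definition lil_norm :: "real \<Rightarrow> real" where
  "lil_norm s = sqrt (2 * ln (1 / s) * ln (ln (ln (1 / s))))"

text \<open>The squared thresholds at the point with index \<open>Suc k\<close>, divided by 2, against \<open>\<rho>\<^sup>4\<close> times the squared
  normalisation at the point with index \<open>k\<close>, divided by 2. The quotient of the two without the factor
  \<open>\<rho>\<^sup>4\<close> tends to \<open>\<rho>\<^sup>2\<close>.\<close>

lemma upper_asymp:
  fixes \<rho> C :: real
  assumes "\<rho> > 1"
  shows "eventually (\<lambda>k. \<rho> * (\<rho> ^ Suc k + C) * ln (real (Suc k)) \<le> \<rho> ^ 4 * \<rho> ^ k * ln (real k * ln \<rho>)) sequentially"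
proof -
  define L where "L = ln \<rho>"
  have L: "L > 0" using assms by (simp add: L_def)
  have "(\<lambda>k. ln (real (Suc k)) / ln (real k * L)) \<longlonglongrightarrow> 1" using L by real_asymp
  moreover have "(\<lambda>k. 1 + C / \<rho> * (1 / \<rho>) ^ k) \<longlonglongrightarrow> 1 + C / \<rho> * 0"
    using assms by (intro tendsto_intros LIMSEQ_power_zero) auto
  ultimately have "(\<lambda>k. (1 + C / \<rho> * (1 / \<rho>) ^ k) * (ln (real (Suc k)) / ln (real k * L))) \<longlonglongrightarrow> (1 + C / \<rho> * 0) * 1"
    by (intro tendsto_mult)
  moreover have "\<rho> ^ 2 > (1 + C / \<rho> * 0) * 1" using assms by (simp add: one_less_power)
  ultimately have "\<forall>\<^sub>F k in sequentially. (1 + C / \<rho> * (1 / \<rho>) ^ k) * (ln (real (Suc k)) / ln (real k * L)) < \<rho> ^ 2"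
    by (rule order_tendstoD)
  moreover have "\<forall>\<^sub>F k in sequentially. ln (real k * L) > 0" using L by real_asymp
  ultimately show ?thesis
  proof eventually_elim
    case (elim k)
    have "(1 + C / \<rho> * (1 / \<rho>) ^ k) * ln (real (Suc k)) \<le> \<rho> ^ 2 * ln (real k * L)"
      using elim by (simp add: divide_simps mult_ac)
    hence "(\<rho> ^ 2 * \<rho> ^ k) * ((1 + C / \<rho> * (1 / \<rho>) ^ k) * ln (real (Suc k))) \<le> (\<rho> ^ 2 * \<rho> ^ k) * (\<rho> ^ 2 * ln (real k * L))"
      using assms by (intro mult_left_mono) auto
    moreover have "(\<rho> ^ 2 * \<rho> ^ k) * (1 + C / \<rho> * (1 / \<rho>) ^ k) = \<rho> * (\<rho> ^ Suc k + C)"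
      using assms by (simp add: field_simps power2_eq_square)
    moreover have "(\<rho> ^ 2 * \<rho> ^ k) * (\<rho> ^ 2 * ln (real k * L)) = \<rho> ^ 4 * \<rho> ^ k * ln (real k * L)"
      by (simp add: power2_eq_square power4_eq_xxxx)
    ultimately show ?case unfolding L_def by (metis mult.assoc)
  qed
qed

lemma ex_power_interval:
  fixes \<rho> y :: real
  assumes "\<rho> > 1" "\<rho> ^ K \<le> y"
  obtains k where "K \<le> k" "\<rho> ^ k \<le> y" "y < \<rho> ^ Suc k"
proof -
  obtain n where "y < \<rho> ^ n" using real_arch_pow[OF assms(1)] by blast
  hence ex: "\<exists>n. y < \<rho> ^ n" by blast
  define n where "n = (LEAST n. y < \<rho> ^ n)"
  have n: "y < \<rho> ^ n" unfolding n_def by (rule LeastI_ex[OF ex])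
  have "K < n"
  proof (rule ccontr)
    assume "\<not> K < n"
    hence "\<rho> ^ n \<le> \<rho> ^ K" using assms by (intro power_increasing) auto
    thus False using n assms(2) by linarith
  qed
  then obtain k where k: "n = Suc k" by (cases n) auto
  have "\<not> y < \<rho> ^ k" unfolding n_def[symmetric] using not_less_Least[of k "\<lambda>n. y < \<rho> ^ n"] k
    by (simp add: n_def)
  thus ?thesis using that[of k] n k \<open>K < n\<close> by simp
qed

context rademacher_multiplicative
begin

lemma prime_variance_le:
  assumes "\<bar>c\<bar> = 1" "s > 0"
  shows "(\<Sum>i\<in>{i\<in>prime_index. i < n}. (c * real (Suc i) powr (-(1 / 2 + s)))\<^sup>2) \<le> prime_zeta (1 + 2 * s)"
proof -
  have "c\<^sup>2 = 1" using assms(1) by (metis power2_abs one_power2)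
  hence "(c * real (Suc i) powr (-(1 / 2 + s)))\<^sup>2 = real (Suc i) powr (-(1 + 2 * s))" for i
    by (simp only: power_mult_distrib square_powr_half mult_1)
  thus ?thesis using sum_prime_index_le_prime_zeta[OF assms(2), of n] by (simp only: mem_Collect_eq)
qed

text \<open>The thresholds \<open>l k\<close> make the exponent in the maximal inequality equal to \<open>\<rho> ln k\<close>, so the
  exceptional probabilities are at most \<open>k\<^sup>-\<^sup>\<rho>\<close> and summable. The bound at \<open>\<sigma> (k + 1)\<close> is used for all \<open>s\<close> between
  \<open>\<sigma> (k + 1)\<close> and \<open>\<sigma> k\<close>, where the normalisation changes only by a factor close to \<open>\<surd>\<rho>\<close>.\<close>

lemma AE_eventually_le:
  assumes c: "\<bar>c\<bar> = 1" and \<rho>: "\<rho> > 1"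
  shows "AE \<omega> in M. \<forall>\<^sub>F s in at_right 0. c * prime_series \<omega> s \<le> \<rho>\<^sup>2 * lil_norm s"
proof -
  obtain C where C: "C > 0" "\<And>s. 0 < s \<Longrightarrow> s \<le> 1 \<Longrightarrow> \<bar>prime_zeta (1 + 2 * s) - ln (1 / s)\<bar> \<le> C"
    by (rule prime_zeta_asymp) blast
  define \<sigma> where "\<sigma> k = exp (- (\<rho> ^ k))" for k
  define V where "V k = \<rho> ^ k + C" for k
  define l where "l k = sqrt (2 * (\<rho> * V k * ln (real k)))" for k
  define a where "a k i = c * real (Suc i) powr (-(1 / 2 + \<sigma> k))" for k i
  define B where "B k = {\<omega>\<in>space M. \<exists>n. signs.partial_sum (a k) n \<omega> > l k}" for k
  have \<sigma>: "0 < \<sigma> k" "\<sigma> k \<le> 1" "ln (1 / \<sigma> k) = \<rho> ^ k" for k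
    using \<rho> by (auto simp: \<sigma>_def ln_div)
  have V: "V k > 0" "(\<Sum>i\<in>{i\<in>prime_index. i < n}. (a k i)\<^sup>2) \<le> V k" for k n
  proof -
    show "V k > 0" using C(1) \<rho> by (simp add: V_def add_pos_pos)
    have "(\<Sum>i\<in>{i\<in>prime_index. i < n}. (a k i)\<^sup>2) \<le> prime_zeta (1 + 2 * \<sigma> k)"
      unfolding a_def by (rule prime_variance_le[OF c \<sigma>(1)])
    also have "\<dots> \<le> V k" using C(2)[OF \<sigma>(1,2), of k] \<sigma>(3)[of k] unfolding V_def by linarith
    finally show "(\<Sum>i\<in>{i\<in>prime_index. i < n}. (a k i)\<^sup>2) \<le> V k" .
  qed
  have PB: "prob (B k) \<le> real k powr (-\<rho>)" if "k \<ge> 2" for k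
  proof -
    have lnk: "ln (real k) > 0" using that by simp
    have pos: "\<rho> * V k * ln (real k) > 0" using V(1)[of k] lnk \<rho> by simp
    hence "l k > 0" by (simp add: l_def)
    hence "prob (B k) \<le> exp (- ((l k)\<^sup>2 / (2 * V k)))"
      unfolding B_def by (rule signs.maximal_inequality) (rule V)+
    also have "(l k)\<^sup>2 / (2 * V k) = \<rho> * ln (real k)"
      using pos V(1)[of k] by (simp add: l_def)
    also have "exp (- (\<rho> * ln (real k))) = real k powr (-\<rho>)" using that by (simp add: powr_def)
    finally show ?thesis .
  qed
  have "AE \<omega> in M. \<forall>\<^sub>F k in sequentially. \<omega> \<in> space M - B k"
  proof (rule borel_cantelli_AE1)
    show "B k \<in> events" for k unfolding B_def by measurable
    show "summable (\<lambda>k. prob (B k))"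
      by (rule summable_comparison_test'[of "\<lambda>k. real k powr (-\<rho>)" 2])
         (use PB \<rho> in \<open>auto simp: summable_real_powr_iff\<close>)
  qed (auto simp: less_top[symmetric])
  with AE_prime_series_summable show ?thesis
  proof eventually_elim
    case (elim \<omega>)
    have "\<forall>\<^sub>F k in sequentially. \<omega> \<in> space M - B (Suc k)"
      using elim(2) by (rule eventually_sequentially_Suc[THEN iffD2])
    moreover have "\<forall>\<^sub>F k in sequentially. ln (real k * ln \<rho>) > 0"
      using \<rho> by real_asymp
    ultimately have "\<forall>\<^sub>F k in sequentially. \<omega> \<in> space M - B (Suc k) \<and> ln (real k * ln \<rho>) > 0 \<and>
        \<rho> * (\<rho> ^ Suc k + C) * ln (real (Suc k)) \<le> \<rho> ^ 4 * \<rho> ^ k * ln (real k * ln \<rho>)"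
      using upper_asymp[OF \<rho>, of C] by eventually_elim auto
    then obtain K where K: "\<And>k. k \<ge> K \<Longrightarrow> \<omega> \<in> space M - B (Suc k)"
      "\<And>k. k \<ge> K \<Longrightarrow> ln (real k * ln \<rho>) > 0"
      "\<And>k. k \<ge> K \<Longrightarrow> \<rho> * (\<rho> ^ Suc k + C) * ln (real (Suc k)) \<le> \<rho> ^ 4 * \<rho> ^ k * ln (real k * ln \<rho>)"
      unfolding eventually_sequentially by blast
    have "c * prime_series \<omega> s \<le> \<rho>\<^sup>2 * lil_norm s" if s: "0 < s" "s < \<sigma> K" for s
    proof -
      have "\<rho> ^ K \<le> ln (1 / s)"
        using s \<sigma>(1,3)[of K] by (metis divide_left_mono frac_le less_eq_real_def ln_mono mult_pos_pos zero_less_divide_1_iff zero_le_one order_refl)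
      then obtain k where k: "K \<le> k" "\<rho> ^ k \<le> ln (1 / s)" "ln (1 / s) < \<rho> ^ Suc k"
        using ex_power_interval[OF \<rho>] by blast
      have s2: "\<sigma> (Suc k) \<le> s"
      proof -
        have "- (\<rho> ^ Suc k) \<le> ln s" using k(3) s by (simp add: ln_div)
        thus ?thesis unfolding \<sigma>_def using s by (metis exp_le_cancel_iff exp_ln)
      qed
      have "signs.partial_sum (a (Suc k)) n \<omega> \<le> l (Suc k)" for n
        using K(1)[OF k(1)] unfolding B_def by (auto simp: not_less)
      moreover have "l (Suc k) \<ge> 0" using V(1)[of "Suc k"] \<rho> by (simp add: l_def)
      ultimately have "c * prime_series \<omega> s \<le> l (Suc k)"
        unfolding a_def by (intro prime_series_le_of_partial_sums[OF \<sigma>(1) s2 _ elim(1)])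
      also have "l (Suc k) \<le> sqrt (2 * (\<rho> ^ 4 * \<rho> ^ k * ln (real k * ln \<rho>)))"
        unfolding l_def V_def by (intro real_sqrt_le_mono mult_left_mono K(3) k) auto
      also have "\<dots> \<le> sqrt ((\<rho>\<^sup>2)\<^sup>2 * (2 * ln (1 / s) * ln (ln (ln (1 / s)))))"
      proof (rule real_sqrt_le_mono)
        have pk: "\<rho> ^ k > 0" using \<rho> by simp
        have "real k * ln \<rho> = ln (\<rho> ^ k)" using \<rho> by (simp add: ln_realpow)
        also have "\<dots> \<le> ln (ln (1 / s))" using k(2) pk by (rule ln_mono)
        finally have 1: "real k * ln \<rho> \<le> ln (ln (1 / s))" .
        have 2: "real k * ln \<rho> > 0"
        proof -
          have "k \<noteq> 0" using K(2)[OF k(1)] by (cases k) auto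
          thus ?thesis using \<rho> by simp
        qed
        have 3: "ln (real k * ln \<rho>) \<le> ln (ln (ln (1 / s)))" using 1 2 by (rule ln_mono)
        have "\<rho> ^ k * ln (real k * ln \<rho>) \<le> ln (1 / s) * ln (ln (ln (1 / s)))"
          using K(2)[OF k(1)] 3 k(2) pk by (intro mult_mono) linarith+
        hence "(2 * \<rho> ^ 4) * (\<rho> ^ k * ln (real k * ln \<rho>)) \<le> (2 * \<rho> ^ 4) * (ln (1 / s) * ln (ln (ln (1 / s))))"
          using \<rho> by (intro mult_left_mono) auto
        thus "2 * (\<rho> ^ 4 * \<rho> ^ k * ln (real k * ln \<rho>)) \<le> (\<rho>\<^sup>2)\<^sup>2 * (2 * ln (1 / s) * ln (ln (ln (1 / s))))"
          by (simp only: power_mult[symmetric] mult_ac) (simp add: mult_ac)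
      qed
      also have "\<dots> = \<rho>\<^sup>2 * lil_norm s" using \<rho> by (simp only: lil_norm_def real_sqrt_mult real_sqrt_abs) simp
      finally show ?thesis .
    qed
    thus ?case unfolding eventually_at_right_field using \<sigma>(1)[of K] by blast
  qed
qed

end

text \<open>The conditions on a large index \<open>j\<close> that occur in the lower bound: the first two bound the variance outside the
  block, the third makes the fourth-order term in \<open>lower_tail\<close> negligible, the fourth makes the
  probability of a large block sum at least of order \<open>1 / j\<close>, the fifth compares the final
  bound with the normalisation, and the last keeps \<open>x j - 2\<close> nonnegative.\<close>

lemma lower_asymp:
  fixes \<epsilon> C L R Z :: real
  assumes \<epsilon>: "0 < \<epsilon>" "\<epsilon> < 1" and R: "R \<ge> 2" and L: "L > 0"
  shows "eventually (\<lambda>j. 10 * C + 1 + ln 2 \<le> 2 * R ^ j) sequentially"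
    and "eventually (\<lambda>j. C \<le> R ^ j) sequentially"
    and "eventually (\<lambda>j. (2 * ln (real j))\<^sup>2 * Z \<le> (R ^ Suc j)\<^sup>2) sequentially"
    and "eventually (\<lambda>j. 2 * sqrt (2 * (1 - \<epsilon>) * ln (real j)) \<le> \<epsilon> * ln (real j)) sequentially"
    and "eventually (\<lambda>j. (1 - 3 * \<epsilon>) * sqrt (2 * ln (real (Suc j) * L)) \<le> (1 - 2 * \<epsilon>) * sqrt (2 * ln (real j)) - 2) sequentially"
    and "eventually (\<lambda>j. 2 \<le> sqrt (2 * (1 - \<epsilon>) * ln (real j))) sequentially"
proof -
  have pow: "2 ^ j \<le> R ^ j" for j using R by (intro power_mono) auto
  have "eventually (\<lambda>j. 10 * C + 1 + ln 2 \<le> 2 * 2 ^ j) sequentially" by real_asymp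
  thus "eventually (\<lambda>j. 10 * C + 1 + ln 2 \<le> 2 * R ^ j) sequentially"
    by eventually_elim (use pow in \<open>smt (verit)\<close>)
  have "eventually (\<lambda>j. C \<le> 2 ^ j) sequentially" by real_asymp
  thus "eventually (\<lambda>j. C \<le> R ^ j) sequentially"
    by eventually_elim (use pow in \<open>smt (verit)\<close>)
  have "((\<lambda>j. (2 * ln (real j))\<^sup>2 / (2 ^ j)\<^sup>2) \<longlongrightarrow> 0) sequentially" by real_asymp
  from tendsto_mult_left_zero[OF this, of Z]
  have "eventually (\<lambda>j. (2 * ln (real j))\<^sup>2 / (2 ^ j)\<^sup>2 * Z < 1) sequentially"
    by (intro order_tendstoD) auto
  thus "eventually (\<lambda>j. (2 * ln (real j))\<^sup>2 * Z \<le> (R ^ Suc j)\<^sup>2) sequentially"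
  proof eventually_elim
    case (elim j)
    hence "(2 * ln (real j))\<^sup>2 * Z \<le> (2 ^ j)\<^sup>2" by (simp add: field_simps)
    also have "\<dots> \<le> (R ^ Suc j)\<^sup>2"
    proof (rule power_mono)
      have "(2::real) ^ j \<le> 2 ^ Suc j" by simp
      also have "\<dots> \<le> R ^ Suc j" by (rule pow)
      finally show "2 ^ j \<le> R ^ Suc j" .
    qed simp
    finally show ?case .
  qed
  define q where "q = 1 - \<epsilon>"
  have q: "q > 0" using \<epsilon> by (simp add: q_def)
  show "eventually (\<lambda>j. 2 * sqrt (2 * (1 - \<epsilon>) * ln (real j)) \<le> \<epsilon> * ln (real j)) sequentially"
    unfolding q_def[symmetric] using q \<epsilon> by real_asymp
  show "eventually (\<lambda>j. 2 \<le> sqrt (2 * (1 - \<epsilon>) * ln (real j))) sequentially"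
    unfolding q_def[symmetric] using q by real_asymp
  have "((\<lambda>j. sqrt (2 * ln (real (Suc j) * L)) / sqrt (2 * ln (real j))) \<longlongrightarrow> 1) sequentially"
    using L by real_asymp
  from tendsto_mult_left[OF this, of "1 - 3 * \<epsilon>"]
  have 1: "((\<lambda>j. (1 - 3 * \<epsilon>) * (sqrt (2 * ln (real (Suc j) * L)) / sqrt (2 * ln (real j)))) \<longlongrightarrow> 1 - 3 * \<epsilon>) sequentially" by simp
  have 2: "((\<lambda>j. (1 - 2 * \<epsilon>) - 2 / sqrt (2 * ln (real j))) \<longlongrightarrow> (1 - 2 * \<epsilon>) - 0) sequentially"
    by (intro tendsto_diff tendsto_const) real_asymp
  have "eventually (\<lambda>j. 0 < ((1 - 2 * \<epsilon>) - 2 / sqrt (2 * ln (real j))) - (1 - 3 * \<epsilon>) * (sqrt (2 * ln (real (Suc j) * L)) / sqrt (2 * ln (real j)))) sequentially"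
    using \<epsilon> by (intro order_tendstoD(1)[OF tendsto_diff[OF 2 1]]) simp
  moreover have "eventually (\<lambda>j. sqrt (2 * ln (real j)) > 0) sequentially" by real_asymp
  ultimately show "eventually (\<lambda>j. (1 - 3 * \<epsilon>) * sqrt (2 * ln (real (Suc j) * L)) \<le> (1 - 2 * \<epsilon>) * sqrt (2 * ln (real j)) - 2) sequentially"
  proof eventually_elim
    case (elim j)
    define D where "D = sqrt (2 * ln (real j))"
    define N where "N = sqrt (2 * ln (real (Suc j) * L))"
    have D: "D > 0" using elim by (simp add: D_def)
    have "0 < (1 - 2 * \<epsilon>) - 2 / D - (1 - 3 * \<epsilon>) * (N / D)" using elim(1) unfolding D_def N_def .
    hence "0 < ((1 - 2 * \<epsilon>) - 2 / D - (1 - 3 * \<epsilon>) * (N / D)) * D" using D by simp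
    also have "\<dots> = (1 - 2 * \<epsilon>) * D - 2 - (1 - 3 * \<epsilon>) * N" using D by (simp add: field_simps)
    finally show ?case unfolding D_def N_def by simp
  qed
qed

context rademacher_multiplicative
begin

text \<open>The block of index \<open>j\<close> consists of the primes in \<open>(b j, b (j + 1)]\<close> with \<open>ln (ln (b j)) = 2 R\<^sup>j\<close>, and
  \<open>ln (1 / \<sigma> j) = R\<^sup>j\<^sup>+\<^sup>1\<close>. Primes beyond the block contribute almost nothing to the variance of the series at
  \<open>\<sigma> j\<close>, because there \<open>p\<^sup>-\<^sup>\<sigma>\<^sup>j\<close> is at most \<open>exp (- exp (R\<^sup>j\<^sup>+\<^sup>1))\<close>. Primes below the block contribute at
  most a constant multiple of \<open>R\<^sup>j\<close>, a fraction of order \<open>1 / R\<close> of the total variance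
  \<open>R\<^sup>j\<^sup>+\<^sup>1 + O(1)\<close>. The large values of the block sums are \<open>x j\<close> standard deviations with \<open>(x j)\<^sup>2 / 2 = (1 - \<epsilon>) ln j\<close>,
  so their probabilities are not summable.\<close>

lemma AE_frequently_ge:
  assumes c: "\<bar>c\<bar> = 1" and \<epsilon>: "0 < \<epsilon>" "\<epsilon> < 1"
  shows "AE \<omega> in M. \<exists>\<^sub>F s in at_right 0. c * prime_series \<omega> s \<ge> (1 - 3 * \<epsilon>) * lil_norm s"
proof -
  obtain C where C: "C > 0" "\<And>s. 0 < s \<Longrightarrow> s \<le> 1 \<Longrightarrow> \<bar>prime_zeta (1 + 2 * s) - ln (1 / s)\<bar> \<le> C"
    by (rule prime_zeta_asymp) blast
  \<comment> \<open>With this choice the bound \<open>\<mu> j\<close> on the part outside the block equals \<open>\<epsilon> \<surd>(2 ln j)\<close> times \<open>\<surd>(R\<^sup>j\<^sup>+\<^sup>1)\<close>.\<close>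
  define R where "R = 40 / \<epsilon>\<^sup>2"
  have "\<epsilon>\<^sup>2 \<le> 1" "\<epsilon>\<^sup>2 > 0" using \<epsilon> by (auto simp: power_le_one)
  hence R: "R \<ge> 40" by (simp add: R_def divide_simps)
  have R\<epsilon>: "21 \<le> \<epsilon> * R"
  proof -
    have "21 * \<epsilon> \<le> 40" using \<epsilon> by simp
    thus ?thesis using \<epsilon> by (simp add: R_def power2_eq_square field_simps)
  qed
  have Rpos: "R ^ j > 0" for j using R by simp
  define \<sigma> where "\<sigma> j = exp (- (R ^ Suc j))" for j
  \<comment> \<open>An auxiliary exponent with \<open>(b j)\<^sup>2\<^sup>u = exp 2\<close>: it compares the sum of \<open>1 / p\<close> over \<open>p \<le> b j\<close> with the prime zeta function at \<open>1 + 2 u\<close>.\<close>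
  define u where "u j = exp (- (2 * R ^ j))" for j
  define b where "b j = exp (exp (2 * R ^ j))" for j
  define Bl where "Bl j = {i\<in>prime_index. b j < real (Suc i) \<and> real (Suc i) \<le> b (Suc j)}" for j
  define a where "a j i = c * real (Suc i) powr (-(1 / 2 + \<sigma> j))" for j i
  \<comment> \<open>The coefficients outside the block carry the opposite sign, so that an upper bound for their partial sums is a lower bound for the rest of the series.\<close>
  define r where "r j i = (if i \<in> Bl j then 0 else - a j i)" for j i
  define V where "V j = (\<Sum>i\<in>Bl j. (a j i)\<^sup>2)" for j
  define W where "W j \<omega> = (\<Sum>i\<in>Bl j. a j i * f (Suc i) \<omega>)" for j \<omega>
  define U where "U j = 9 * (2 * R ^ j + C) + exp (- exp (R ^ Suc j)) * (R ^ Suc j + ln 2 + C)" for j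
  define x where "x j = sqrt (2 * (1 - \<epsilon>) * ln (real j))" for j
  define \<mu> where "\<mu> j = sqrt (80 * R ^ j * ln (real j))" for j
  have \<sigma>: "0 < \<sigma> j" "\<sigma> j \<le> 1" "ln (1 / \<sigma> j) = R ^ Suc j" for j
    using R by (auto simp: \<sigma>_def ln_div)
  have u: "0 < u j" "u j \<le> 1" "ln (1 / u j) = 2 * R ^ j" for j
    using R by (auto simp: u_def ln_div)
  have c2: "c\<^sup>2 = 1" using c by (metis power2_abs one_power2)
  have a2: "(a j i)\<^sup>2 = real (Suc i) powr (-(1 + 2 * \<sigma> j))" for j i
    by (simp only: a_def power_mult_distrib c2 mult_1 square_powr_half)
  have finB: "finite (Bl j)" for j
  proof (rule finite_subset)
    show "Bl j \<subseteq> {..nat \<lceil>b (Suc j)\<rceil>}"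
    proof
      fix i assume "i \<in> Bl j"
      hence "real i \<le> b (Suc j)" by (simp add: Bl_def)
      thus "i \<in> {..nat \<lceil>b (Suc j)\<rceil>}" by (simp add: le_nat_iff) linarith
    qed
  qed simp
  have subB: "Bl j \<subseteq> prime_index" for j by (auto simp: Bl_def)
  have r2: "(r j i)\<^sup>2 \<le> 9 * real (Suc i) powr (-(1 + 2 * u j)) + exp (- exp (R ^ Suc j)) * real (Suc i) powr (-(1 + 2 * (\<sigma> j / 2)))"
    if i: "i \<in> prime_index" for j i
  proof -
    have n0: "real (Suc i) > 0" by simp
    consider "i \<in> Bl j" | "real (Suc i) \<le> b j" | "b (Suc j) < real (Suc i)" using i unfolding Bl_def by fastforce
    thus ?thesis
    proof cases
      case 1
      thus ?thesis by (simp add: r_def)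
    next
      case 2
      have "(r j i)\<^sup>2 \<le> real (Suc i) powr (-(1 + 2 * \<sigma> j))" by (simp only: r_def a2[symmetric]) simp
      also have "\<dots> \<le> real (Suc i) powr (2 * u j + -(1 + 2 * u j))"
        using \<sigma>(1)[of j] by (intro powr_mono) auto
      also have "\<dots> = real (Suc i) powr (2 * u j) * real (Suc i) powr (-(1 + 2 * u j))" by (rule powr_add)
      also have "real (Suc i) powr (2 * u j) \<le> b j powr (2 * u j)"
        using 2 u(1)[of j] by (intro powr_mono2) auto
      also have "b j powr (2 * u j) = exp 1 * exp 1"
        by (simp add: b_def u_def powr_def exp_minus exp_add[symmetric])
      also have "\<dots> \<le> 3 * (3::real)" using exp_le by (intro mult_mono) auto
      finally have "(r j i)\<^sup>2 \<le> 9 * real (Suc i) powr (-(1 + 2 * u j))"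
        by (simp add: mult_right_mono)
      thus ?thesis by (rule order.trans) simp
    next
      case 3
      have "(r j i)\<^sup>2 \<le> real (Suc i) powr (-(1 + 2 * \<sigma> j))" by (simp only: r_def a2[symmetric]) simp
      also have "\<dots> = real (Suc i) powr (-\<sigma> j + -(1 + 2 * (\<sigma> j / 2)))"
        by (rule arg_cong[where f = "(powr) (real (Suc i))"]) simp
      also have "\<dots> = real (Suc i) powr (-\<sigma> j) * real (Suc i) powr (-(1 + 2 * (\<sigma> j / 2)))" by (rule powr_add)
      also have "real (Suc i) powr (-\<sigma> j) \<le> b (Suc j) powr (-\<sigma> j)"
        using 3 \<sigma>(1)[of j] by (intro powr_mono2') (auto simp: b_def)
      also have "b (Suc j) powr (-\<sigma> j) = exp (- exp (R ^ Suc j))"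
        by (simp add: b_def \<sigma>_def powr_def exp_add[symmetric])
      finally have "(r j i)\<^sup>2 \<le> exp (- exp (R ^ Suc j)) * real (Suc i) powr (-(1 + 2 * (\<sigma> j / 2)))"
        by (simp add: mult_right_mono)
      thus ?thesis by (rule order.trans) simp
    qed
  qed
  have rU: "(\<Sum>i\<in>{i\<in>prime_index. i < n}. (r j i)\<^sup>2) \<le> U j" for n j
  proof -
    have "(\<Sum>i\<in>{i\<in>prime_index. i < n}. (r j i)\<^sup>2) \<le>
      (\<Sum>i\<in>{i\<in>prime_index. i < n}. 9 * real (Suc i) powr (-(1 + 2 * u j)) + exp (- exp (R ^ Suc j)) * real (Suc i) powr (-(1 + 2 * (\<sigma> j / 2))))"
      by (intro sum_mono r2) auto
    also have "\<dots> = 9 * (\<Sum>i\<in>{i. prime (Suc i) \<and> i < n}. real (Suc i) powr (-(1 + 2 * u j)))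
       + exp (- exp (R ^ Suc j)) * (\<Sum>i\<in>{i. prime (Suc i) \<and> i < n}. real (Suc i) powr (-(1 + 2 * (\<sigma> j / 2))))"
      by (simp only: sum.distrib sum_distrib_left mem_Collect_eq)
    also have "\<dots> \<le> 9 * prime_zeta (1 + 2 * u j) + exp (- exp (R ^ Suc j)) * prime_zeta (1 + 2 * (\<sigma> j / 2))"
      using u \<sigma> by (intro add_mono mult_left_mono sum_prime_index_le_prime_zeta) auto
    also have "\<dots> \<le> 9 * (2 * R ^ j + C) + exp (- exp (R ^ Suc j)) * (R ^ Suc j + ln 2 + C)"
    proof (intro add_mono mult_left_mono)
      show "prime_zeta (1 + 2 * u j) \<le> 2 * R ^ j + C" using C(2)[OF u(1,2), of j] u(3)[of j] by linarith
      have "ln (1 / (\<sigma> j / 2)) = R ^ Suc j + ln 2"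
      proof -
        have "1 / (\<sigma> j / 2) = 1 / \<sigma> j * 2" by simp
        thus ?thesis using \<sigma>(1)[of j] \<sigma>(3)[of j] by (simp only: ln_mult) (simp add: ln_mult)
      qed
      thus "prime_zeta (1 + 2 * (\<sigma> j / 2)) \<le> R ^ Suc j + ln 2 + C"
        using C(2)[of "\<sigma> j / 2"] \<sigma>(1,2)[of j] by linarith
    qed auto
    finally show ?thesis unfolding U_def .
  qed
  have VU: "R ^ Suc j - C \<le> V j + U j" for j
  proof -
    have "(\<Sum>i<n. if prime (Suc i) then real (Suc i) powr (-(1 + 2 * \<sigma> j)) else 0) \<le> V j + U j" for n
    proof -
      let ?A = "{i\<in>prime_index. i < n}"
      have "(\<Sum>i<n. if prime (Suc i) then real (Suc i) powr (-(1 + 2 * \<sigma> j)) else 0) = (\<Sum>i\<in>?A. (a j i)\<^sup>2)"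
        unfolding a2 by (rule sum.mono_neutral_cong_right) auto
      also have "\<dots> = (\<Sum>i\<in>?A. (if i \<in> Bl j then (a j i)\<^sup>2 else 0) + (r j i)\<^sup>2)"
        by (intro sum.cong refl) (simp add: r_def)
      also have "\<dots> = (\<Sum>i\<in>?A. if i \<in> Bl j then (a j i)\<^sup>2 else 0) + (\<Sum>i\<in>?A. (r j i)\<^sup>2)" by (rule sum.distrib)
      also have "(\<Sum>i\<in>?A. if i \<in> Bl j then (a j i)\<^sup>2 else 0) = (\<Sum>i\<in>?A \<inter> Bl j. (a j i)\<^sup>2)"
        by (rule sum.inter_restrict[symmetric]) simp
      also have "\<dots> \<le> V j" unfolding V_def by (intro sum_mono2 finB) auto
      also note rU
      finally show ?thesis by simp
    qed
    hence "prime_zeta (1 + 2 * \<sigma> j) \<le> V j + U j"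
      unfolding prime_zeta_def using \<sigma>(1)[of j] by (intro suminf_le_const prime_zeta_summable) auto
    thus ?thesis using C(2)[OF \<sigma>(1,2), of j] \<sigma>(3)[of j] by linarith
  qed
  have Z: "(\<Sum>i\<in>Bl j. (a j i) ^ 4) \<le> zeta_real 2" for j
  proof -
    have "(\<Sum>i\<in>Bl j. (a j i) ^ 4) \<le> (\<Sum>i\<in>Bl j. real (Suc i) powr (-2))"
    proof (rule sum_mono)
      fix i
      have "(a j i) ^ 4 = ((a j i)\<^sup>2) * (a j i)\<^sup>2" by (simp add: power4_eq_xxxx power2_eq_square)
      also have "\<dots> = real (Suc i) powr (-(1 + 2 * \<sigma> j) + -(1 + 2 * \<sigma> j))" unfolding a2 powr_add ..
      also have "\<dots> \<le> real (Suc i) powr (-2)" using \<sigma>(1)[of j] by (intro powr_mono) auto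
      finally show "(a j i) ^ 4 \<le> real (Suc i) powr (-2)" .
    qed
    also have "\<dots> \<le> zeta_real 2"
      unfolding zeta_real_def by (intro sum_le_suminf zeta_real_summable finB) auto
    finally show ?thesis .
  qed
  have "R \<ge> 2" "ln R > 0" using R by auto
  note ev = lower_asymp[OF \<epsilon> this]
  have "\<forall>\<^sub>F j in sequentially. 10 * C + 1 + ln 2 \<le> 2 * R ^ j \<and> C \<le> R ^ j \<and> (2 * ln (real j))\<^sup>2 * zeta_real 2 \<le> (R ^ Suc j)\<^sup>2
     \<and> 2 * x j \<le> \<epsilon> * ln (real j) \<and> 2 \<le> x j
     \<and> (1 - 3 * \<epsilon>) * sqrt (2 * ln (real (Suc j) * ln R)) \<le> (1 - 2 * \<epsilon>) * sqrt (2 * ln (real j)) - 2 \<and> 2 \<le> j"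
    unfolding x_def by (intro eventually_conj ev eventually_ge_at_top)
  then obtain J where J: "\<And>j. j \<ge> J \<Longrightarrow> 10 * C + 1 + ln 2 \<le> 2 * R ^ j" "\<And>j. j \<ge> J \<Longrightarrow> C \<le> R ^ j"
    "\<And>j. j \<ge> J \<Longrightarrow> (2 * ln (real j))\<^sup>2 * zeta_real 2 \<le> (R ^ Suc j)\<^sup>2"
    "\<And>j. j \<ge> J \<Longrightarrow> 2 * x j \<le> \<epsilon> * ln (real j)" "\<And>j. j \<ge> J \<Longrightarrow> 2 \<le> x j"
    "\<And>j. j \<ge> J \<Longrightarrow> (1 - 3 * \<epsilon>) * sqrt (2 * ln (real (Suc j) * ln R)) \<le> (1 - 2 * \<epsilon>) * sqrt (2 * ln (real j)) - 2"
    "\<And>j. j \<ge> J \<Longrightarrow> 2 \<le> j"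
    unfolding eventually_sequentially by blast
  have lnj: "ln (real j) > 0" if "j \<ge> J" for j using J(7)[OF that] by simp
  have U20: "U j \<le> 20 * R ^ j" if "j \<ge> J" for j
  proof -
    define y where "y = R ^ Suc j"
    have y: "y > 0" unfolding y_def by (rule Rpos)
    define T where "T = exp (- exp y) * (y + ln 2 + C)"
    have "T \<le> 1 + ln 2 + C"
      unfolding T_def
    proof -
      have "y \<le> exp y" using exp_ge_add_one_self[of y] by linarith
      hence "exp y \<le> exp (exp y)" by simp
      hence "1 + y \<le> exp (exp y)" using exp_ge_add_one_self[of y] by linarith
      hence "exp (- exp y) \<le> 1 / (1 + y)" using y by (simp add: exp_minus field_simps)
      hence "exp (- exp y) * (y + ln 2 + C) \<le> 1 / (1 + y) * (y + ln 2 + C)"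
        using y C(1) by (intro mult_right_mono) auto
      also have "\<dots> \<le> 1 + ln 2 + C"
      proof -
        have "0 \<le> (ln 2 + C) * y" using y C(1) by simp
        thus ?thesis using y by (simp add: field_simps)
      qed
      finally show "exp (- exp y) * (y + ln 2 + C) \<le> 1 + ln 2 + C" .
    qed
    thus ?thesis using J(1)[OF that] unfolding U_def y_def[symmetric] T_def[symmetric] by (simp add: algebra_simps)
  qed
  have Vlow: "(1 - \<epsilon>) * R ^ Suc j \<le> V j" if "j \<ge> J" for j
  proof -
    have "21 * R ^ j \<le> \<epsilon> * R * R ^ j" using R\<epsilon> Rpos[of j] by (intro mult_right_mono) auto
    thus ?thesis using VU[of j] U20[OF that] J(2)[OF that] by (simp add: algebra_simps)
  qed
  have Vpos: "V j > 0" if "j \<ge> J" for j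
    using Vlow[OF that] \<epsilon> Rpos[of "Suc j"] by (smt (verit) mult_pos_pos)
  have x2: "(x j)\<^sup>2 = 2 * (1 - \<epsilon>) * ln (real j)" if "j \<ge> J" for j
    using lnj[OF that] \<epsilon> unfolding x_def by simp
  have PW: "prob {\<omega>\<in>space M. W j \<omega> \<ge> (x j - 2) * sqrt (V j)} \<ge> inverse (real j) / 4" if j: "j \<ge> J" for j
  proof -
    define t where "t = x j / sqrt (V j)"
    have sV: "sqrt (V j) > 0" "sqrt (V j) * sqrt (V j) = V j" using Vpos[OF j] by auto
    have t: "t \<ge> 0" using J(5)[OF j] sV by (simp add: t_def)
    have tV: "t * V j - 2 * sqrt (V j) = (x j - 2) * sqrt (V j)"
    proof -
      have "t * V j = (x j / sqrt (V j)) * (sqrt (V j) * sqrt (V j))" by (simp only: t_def sV(2))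
      also have "\<dots> = x j * sqrt (V j)"
      proof -
        have "(p / q) * (q * q) = p * q" if "q > 0" for p q :: real using that by simp
        thus ?thesis using sV(1) .
      qed
      finally show ?thesis by (simp add: algebra_simps)
    qed
    have t2V: "t\<^sup>2 * V j = (x j)\<^sup>2" using Vpos[OF j] by (simp add: t_def power_divide)
    have tsV: "t * sqrt (V j) = x j" using sV by (simp add: t_def)
    have "t ^ 4 * (\<Sum>i\<in>Bl j. (a j i) ^ 4) \<le> 1"
    proof -
      have "t ^ 4 * (V j)\<^sup>2 = (t\<^sup>2 * V j)\<^sup>2" by (simp add: power_mult_distrib power_mult[symmetric])
      also have "\<dots> = (1 - \<epsilon>)\<^sup>2 * (2 * ln (real j))\<^sup>2"
        unfolding t2V x2[OF j] by (simp only: power_mult_distrib mult_ac)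
      finally have t4: "t ^ 4 * (V j)\<^sup>2 = (1 - \<epsilon>)\<^sup>2 * (2 * ln (real j))\<^sup>2" .
      have "(t ^ 4 * zeta_real 2) * (V j)\<^sup>2 = (1 - \<epsilon>)\<^sup>2 * ((2 * ln (real j))\<^sup>2 * zeta_real 2)"
        using t4 by (simp add: mult_ac)
      also have "\<dots> \<le> (1 - \<epsilon>)\<^sup>2 * (R ^ Suc j)\<^sup>2" by (intro mult_left_mono J(3)[OF j]) simp
      also have "\<dots> = ((1 - \<epsilon>) * R ^ Suc j)\<^sup>2" by (rule power_mult_distrib[symmetric])
      also have "\<dots> \<le> (V j)\<^sup>2" using Vlow[OF j] \<epsilon> Rpos[of "Suc j"] by (intro power_mono mult_nonneg_nonneg) auto
      finally have "(t ^ 4 * zeta_real 2) * (V j)\<^sup>2 \<le> 1 * (V j)\<^sup>2" by simp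
      hence "t ^ 4 * zeta_real 2 \<le> 1" using Vpos[OF j] by (simp only: mult_le_cancel_right) auto
      moreover have "t ^ 4 * (\<Sum>i\<in>Bl j. (a j i) ^ 4) \<le> t ^ 4 * zeta_real 2"
        using t by (intro mult_left_mono Z) auto
      ultimately show ?thesis by linarith
    qed
    from signs.lower_tail[OF finB subB V_def Vpos[OF j] t this]
    have "exp (- ((x j)\<^sup>2 / 2) - 2 * x j) / 4 \<le> prob {\<omega>\<in>space M. W j \<omega> \<ge> (x j - 2) * sqrt (V j)}"
      unfolding W_def[symmetric] tV t2V mult.assoc tsV .
    moreover have "- ln (real j) \<le> - ((x j)\<^sup>2 / 2) - 2 * x j"
    proof -
      have "2 * (1 - \<epsilon>) * ln (real j) / 2 = ln (real j) - \<epsilon> * ln (real j)" by (simp add: left_diff_distrib)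
      thus ?thesis unfolding x2[OF j] using J(4)[OF j] by linarith
    qed
    hence "exp (- ln (real j)) \<le> exp (- ((x j)\<^sup>2 / 2) - 2 * x j)" by simp
    moreover have "exp (- ln (real j)) = inverse (real j)" using J(7)[OF j] by (simp add: exp_minus)
    ultimately show ?thesis by linarith
  qed
  have div: "\<not> summable (\<lambda>j. prob {\<omega>\<in>space M. W j \<omega> \<ge> (x j - 2) * sqrt (V j)})"
  proof
    assume "summable (\<lambda>j. prob {\<omega>\<in>space M. W j \<omega> \<ge> (x j - 2) * sqrt (V j)})"
    hence "summable (\<lambda>j. inverse (real j) / 4)"
      by (rule summable_comparison_test'[where N = J]) (use PW in auto)
    hence "summable (\<lambda>j. inverse (real j))" by (simp add: summable_divide_iff)
    thus False using not_summable_harmonic[where 'a=real] summable_Suc_iff[of "\<lambda>j. inverse (real j)"] by simp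
  qed
  have bmono: "b j \<le> b k" if "j \<le> k" for j k
    using that R unfolding b_def by (simp add: power_increasing)
  have disj: "disjoint_family_on Bl UNIV"
  proof -
    have "Bl j \<inter> Bl k = {}" if "j < k" for j k
      using bmono[of "Suc j" k] that by (force simp: Bl_def)
    thus ?thesis unfolding disjoint_family_on_def by (metis Int_commute linorder_neqE_nat)
  qed
  have indW: "indep_vars (\<lambda>_. borel) W UNIV"
  proof -
    have "indep_vars (\<lambda>j. PiM (Bl j) (\<lambda>_. borel)) (\<lambda>j \<omega>. restrict (\<lambda>i. f (Suc i) \<omega>) (Bl j)) UNIV"
      by (rule indep_vars_restrict[where K = Bl and L = UNIV, OF signs.indep]) (use subB disj in auto)
    hence "indep_vars (\<lambda>_. borel) (\<lambda>j \<omega>. \<Sum>i\<in>Bl j. a j i * restrict (\<lambda>i. f (Suc i) \<omega>) (Bl j) i) UNIV"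
    proof (rule indep_vars_compose2[where Y = "\<lambda>j x. \<Sum>i\<in>Bl j. a j i * x i" and N = "\<lambda>_. borel"])
      show "(\<lambda>x. \<Sum>i\<in>Bl j. a j i * x i) \<in> borel_measurable (PiM (Bl j) (\<lambda>_. borel))" for j
        by (intro borel_measurable_sum borel_measurable_times measurable_const measurable_component_singleton) auto
    qed
    moreover have "(\<lambda>j \<omega>. \<Sum>i\<in>Bl j. a j i * restrict (\<lambda>i. f (Suc i) \<omega>) (Bl j) i) = W"
      by (intro ext) (simp add: W_def)
    ultimately show ?thesis by simp
  qed
  note AE_W = borel_cantelli_AE2[OF indW div]
  define B where "B j = {\<omega>\<in>space M. \<exists>n. signs.partial_sum (r j) n \<omega> > \<mu> j}" for j
  have \<mu>: "\<mu> j > 0" "(\<mu> j)\<^sup>2 = 80 * R ^ j * ln (real j)" if "j \<ge> J" for j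
    using lnj[OF that] Rpos[of j] by (auto simp: \<mu>_def)
  have PB: "prob (B j) \<le> real j powr (-2)" if j: "j \<ge> J" for j
  proof -
    have "prob (B j) \<le> exp (- ((\<mu> j)\<^sup>2 / (2 * (20 * R ^ j))))"
      unfolding B_def using Rpos[of j] rU U20[OF j]
      by (intro signs.maximal_inequality \<mu> j) (auto intro: order.trans)
    also have "(\<mu> j)\<^sup>2 / (2 * (20 * R ^ j)) = 2 * ln (real j)"
    proof -
      have "80 * p * l / (2 * (20 * p)) = 2 * l" if "p > 0" for p l :: real using that by simp
      thus ?thesis unfolding \<mu>(2)[OF j] using Rpos[of j] .
    qed
    also have "exp (- (2 * ln (real j))) = real j powr (-2)" using J(7)[OF j] by (simp add: powr_def)
    finally show ?thesis .
  qed
  have AE_B: "AE \<omega> in M. \<forall>\<^sub>F j in sequentially. \<omega> \<in> space M - B j"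
  proof (rule borel_cantelli_AE1)
    show "B k \<in> events" for k unfolding B_def by measurable
    show "summable (\<lambda>k. prob (B k))"
      by (rule summable_comparison_test'[of "\<lambda>k. real k powr (-2)" J])
         (use PB in \<open>auto simp: summable_real_powr_iff\<close>)
  qed (auto simp: less_top[symmetric])
  show ?thesis using AE_W AE_B AE_prime_series_summable
  proof eventually_elim
    case (elim \<omega>)
    have key: "c * prime_series \<omega> (\<sigma> j) \<ge> (1 - 3 * \<epsilon>) * lil_norm (\<sigma> j)"
      if j: "j \<ge> J" and Wj: "W j \<omega> \<ge> (x j - 2) * sqrt (V j)" and Bj: "\<omega> \<in> space M - B j" for j
    proof -
      have "(\<lambda>n. signs.partial_sum (a j) n \<omega>) \<longlonglongrightarrow> c * prime_series \<omega> (\<sigma> j)"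
      proof -
        have "(\<lambda>i. c * ((if prime (Suc i) then f (Suc i) \<omega> else 0) * real (Suc i) powr (-(1 / 2 + \<sigma> j)))) sums (c * prime_series \<omega> (\<sigma> j))"
          unfolding prime_series_def using elim(3) \<sigma>(1)[of j] by (intro sums_mult summable_sums) auto
        moreover have "c * ((if prime (Suc i) then f (Suc i) \<omega> else 0) * real (Suc i) powr (-(1 / 2 + \<sigma> j))) =
            (if i \<in> prime_index then a j i * f (Suc i) \<omega> else 0)" for i
          by (simp add: a_def mult_ac)
        ultimately show ?thesis unfolding signs.partial_sum_def sums_def by simp
      qed
      moreover have "\<forall>n\<ge>nat \<lceil>b (Suc j)\<rceil>. W j \<omega> - \<mu> j \<le> signs.partial_sum (a j) n \<omega>"
      proof (intro allI impI)
        fix n assume n: "n \<ge> nat \<lceil>b (Suc j)\<rceil>"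
        have sub: "Bl j \<subseteq> {i\<in>prime_index. i < n}"
        proof
          fix i assume i: "i \<in> Bl j"
          hence "real (Suc i) \<le> b (Suc j)" by (simp add: Bl_def)
          also have "\<dots> \<le> real n" using n by linarith
          finally show "i \<in> {i\<in>prime_index. i < n}" using i by (simp add: Bl_def)
        qed
        have "W j \<omega> = (\<Sum>i\<in>{i\<in>prime_index. i < n}. if i \<in> Bl j then a j i * f (Suc i) \<omega> else 0)"
          unfolding W_def using sub by (intro sum.mono_neutral_cong_left) auto
        also have "\<dots> = (\<Sum>i\<in>{i\<in>prime_index. i < n}. a j i * f (Suc i) \<omega> + r j i * f (Suc i) \<omega>)"
          by (intro sum.cong refl) (simp add: r_def)
        also have "\<dots> = signs.partial_sum (a j) n \<omega> + signs.partial_sum (r j) n \<omega>"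
          unfolding signs.partial_sum_alt by (rule sum.distrib)
        finally have "W j \<omega> = signs.partial_sum (a j) n \<omega> + signs.partial_sum (r j) n \<omega>" .
        moreover have "signs.partial_sum (r j) n \<omega> \<le> \<mu> j"
          using Bj unfolding B_def by (auto simp: not_less)
        ultimately show "W j \<omega> - \<mu> j \<le> signs.partial_sum (a j) n \<omega>" by linarith
      qed
      ultimately have "W j \<omega> - \<mu> j \<le> c * prime_series \<omega> (\<sigma> j)"
        by (intro LIMSEQ_le_const) blast+
      moreover have "(1 - 3 * \<epsilon>) * lil_norm (\<sigma> j) \<le> (x j - 2) * sqrt (V j) - \<mu> j"
      proof -
        define S where "S = sqrt (R ^ Suc j)"
        define D where "D = sqrt (2 * ln (real j))"
        define q where "q = sqrt (1 - \<epsilon>)"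
        have S: "S > 0" using Rpos[of "Suc j"] unfolding S_def by simp
        have q: "q \<ge> 0" "q \<le> 1" "q * q = 1 - \<epsilon>" using \<epsilon> by (auto simp: q_def)
        have xD: "x j = q * D" unfolding x_def q_def D_def by (simp only: real_sqrt_mult mult_ac)
        have "lil_norm (\<sigma> j) = S * sqrt (2 * ln (real (Suc j) * ln R))"
        proof -
          have "ln (R ^ Suc j) = real (Suc j) * ln R" by (rule ln_realpow)
          thus ?thesis unfolding lil_norm_def \<sigma>(3) S_def real_sqrt_mult[symmetric]
            by (simp only: mult_ac)
        qed
        hence "(1 - 3 * \<epsilon>) * lil_norm (\<sigma> j) = S * ((1 - 3 * \<epsilon>) * sqrt (2 * ln (real (Suc j) * ln R)))" by simp
        also have "\<dots> \<le> S * ((1 - 2 * \<epsilon>) * D - 2)"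
          unfolding D_def by (rule mult_left_mono[OF J(6)[OF j] less_imp_le[OF S]])
        also have "\<dots> \<le> S * ((x j - 2) * q - \<epsilon> * D)"
        proof (rule mult_left_mono)
          have "(x j - 2) * q - \<epsilon> * D = (q * q) * D - 2 * q - \<epsilon> * D" unfolding xD by (simp add: algebra_simps)
          also have "\<dots> = (1 - 2 * \<epsilon>) * D - 2 * q" unfolding q(3) by (simp add: algebra_simps)
          finally show "(1 - 2 * \<epsilon>) * D - 2 \<le> (x j - 2) * q - \<epsilon> * D" using q(2) by linarith
        qed (use S in simp)
        also have "\<dots> = (x j - 2) * (q * S) - \<epsilon> * D * S" by (simp add: algebra_simps)
        also have "\<epsilon> * D * S = \<mu> j"
        proof -
          have "80 * R ^ j = \<epsilon>\<^sup>2 * (2 * R ^ Suc j)" using \<epsilon> by (simp add: R_def)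
          hence "\<mu> j = sqrt (\<epsilon>\<^sup>2 * (2 * ln (real j)) * R ^ Suc j)" unfolding \<mu>_def by (simp only: mult_ac)
          also have "\<dots> = \<epsilon> * D * S" unfolding D_def S_def using \<epsilon> by (simp only: real_sqrt_mult real_sqrt_abs)
          finally show ?thesis by simp
        qed
        also have "(x j - 2) * (q * S) \<le> (x j - 2) * sqrt (V j)"
        proof (rule mult_left_mono)
          have "q * S = sqrt ((1 - \<epsilon>) * R ^ Suc j)" unfolding q_def S_def by (rule real_sqrt_mult[symmetric])
          also have "\<dots> \<le> sqrt (V j)" by (rule real_sqrt_le_mono[OF Vlow[OF j]])
          finally show "q * S \<le> sqrt (V j)" .
        qed (use J(5)[OF j] in simp)
        finally show ?thesis by linarith
      qed
      ultimately show ?thesis using Wj by linarith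
    qed
    have "\<forall>\<^sub>F j in sequentially. \<omega> \<in> space M - B j \<and> j \<ge> J"
      using elim(2) eventually_ge_at_top[of J] by eventually_elim auto
    from frequently_eventually_frequently[OF elim(1) this]
    have freq: "\<exists>\<^sub>F j in sequentially. c * prime_series \<omega> (\<sigma> j) \<ge> (1 - 3 * \<epsilon>) * lil_norm (\<sigma> j)"
      by (rule frequently_elim1) (use key in auto)
    have "filterlim \<sigma> (at_right 0) sequentially"
    proof -
      have "R > 1" using R by simp
      hence "(\<lambda>j. exp (- (R ^ Suc j))) \<longlonglongrightarrow> 0" by real_asymp
      thus ?thesis unfolding \<sigma>_def[abs_def] by (simp add: filterlim_at)
    qed
    thus ?case using freq unfolding frequently_def filterlim_iff by blast
  qed
qed

end

section \<open>Limit points\<close>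

text \<open>Every value strictly between \<open>-1\<close> and \<open>1\<close> is attained by \<open>h\<close> arbitrarily close to zero, by the intermediate
  value theorem. The points \<open>-1\<close> and \<open>1\<close> are included by approximating \<open>l\<close> by \<open>(1 - e) l\<close>.\<close>

lemma limit_points_eq_Icc:
  fixes g h :: "real \<Rightarrow> real" and d :: real
  assumes d: "d > 0"
    and cont: "continuous_on {0<..<d} h"
    and diff: "((\<lambda>s. g s - h s) \<longlongrightarrow> 0) (at_right 0)"
    and upper: "\<And>e. e > 0 \<Longrightarrow> \<forall>\<^sub>F s in at_right 0. \<bar>h s\<bar> \<le> 1 + e"
    and near_one: "\<And>e. e > 0 \<Longrightarrow> \<exists>\<^sub>F s in at_right 0. h s \<ge> 1 - e"
    and near_minus_one: "\<And>e. e > 0 \<Longrightarrow> \<exists>\<^sub>F s in at_right 0. h s \<le> - 1 + e"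
  shows "limit_points (at 0 within {0<..<d}) g = {-1..1}"
proof -
  have at: "at 0 within {0<..<d} = at_right 0"
    by (rule at_within_nhd[where S = "{-1<..<d}"]) (use d in auto)
  show ?thesis unfolding at
  proof (intro equalityI subsetI)
    fix l assume "l \<in> limit_points (at_right 0) g"
    then obtain s :: "nat \<Rightarrow> real" where s: "filterlim s (at_right 0) sequentially" "(\<lambda>k. g (s k)) \<longlonglongrightarrow> l"
      by (auto simp: limit_points_def)
    have "(\<lambda>k. g (s k) - (g (s k) - h (s k))) \<longlonglongrightarrow> l - 0"
      by (intro tendsto_diff s(2) filterlim_compose[OF diff s(1)])
    hence hl: "(\<lambda>k. h (s k)) \<longlonglongrightarrow> l" by simp
    have "\<bar>l\<bar> \<le> 1"
    proof (rule field_le_epsilon)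
      fix e :: real assume "e > 0"
      from eventually_compose_filterlim[OF upper[OF this] s(1)]
      show "\<bar>l\<bar> \<le> 1 + e"
        by (intro tendsto_le[OF sequentially_bot tendsto_const tendsto_rabs[OF hl]])
    qed
    thus "l \<in> {-1..1}" by auto
  next
    fix l :: real assume l: "l \<in> {-1..1}"
    have ex: "\<exists>s. 0 < s \<and> s < min d (1 / real (Suc k)) \<and> \<bar>h s - l\<bar> < 1 / real (Suc k)" for k
    proof -
      define e where "e = 1 / (2 * real (Suc k))"
      have e: "0 < e" "e < 1" "e < 1 / real (Suc k)" by (auto simp: e_def field_simps)
      define l' where "l' = (1 - e) * l"
      have l': "\<bar>l'\<bar> \<le> 1 - e" "\<bar>l' - l\<bar> \<le> e"
      proof -
        have "\<bar>l\<bar> \<le> 1" using l by (simp add: abs_le_iff)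
        hence "(1 - e) * \<bar>l\<bar> \<le> (1 - e) * 1" "e * \<bar>l\<bar> \<le> e * 1" using e by (intro mult_left_mono; simp)+
        moreover have "\<bar>l'\<bar> = (1 - e) * \<bar>l\<bar>" using e by (simp add: l'_def abs_mult)
        moreover have "\<bar>l' - l\<bar> = e * \<bar>l\<bar>"
        proof -
          have "l' - l = - (e * l)" by (simp add: l'_def algebra_simps)
          thus ?thesis using e by (simp add: abs_mult)
        qed
        ultimately show "\<bar>l'\<bar> \<le> 1 - e" "\<bar>l' - l\<bar> \<le> e" by simp_all
      qed
      have small: "\<forall>\<^sub>F s in at_right 0. 0 < s \<and> s < min d (1 / real (Suc k))"
        unfolding eventually_at_right_field using d by (intro exI[of _ "min d (1 / real (Suc k))"]) auto
      obtain s1 where s1: "h s1 \<ge> l'" "0 < s1" "s1 < min d (1 / real (Suc k))"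
      proof -
        have "\<exists>\<^sub>F s in at_right 0. h s \<ge> 1 - e \<and> (0 < s \<and> s < min d (1 / real (Suc k)))"
          by (rule frequently_eventually_conj[OF near_one[OF e(1)] small, unfolded conj_commute[of "_ < _ \<and> _ < _"]])
        from frequently_ex[OF this] that l'(1) show ?thesis by (meson abs_ge_self order_trans)
      qed
      obtain s2 where s2: "h s2 \<le> l'" "0 < s2" "s2 < min d (1 / real (Suc k))"
      proof -
        have "\<exists>\<^sub>F s in at_right 0. h s \<le> - 1 + e \<and> (0 < s \<and> s < min d (1 / real (Suc k)))"
          by (rule frequently_eventually_conj[OF near_minus_one[OF e(1)] small, unfolded conj_commute[of "_ < _ \<and> _ < _"]])
        then obtain s where "h s \<le> - 1 + e" "0 < s" "s < min d (1 / real (Suc k))"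
          using frequently_ex by blast
        with that[of s] l'(1) show ?thesis by linarith
      qed
      have co: "continuous_on {min s1 s2..max s1 s2} h"
        by (rule continuous_on_subset[OF cont]) (use s1 s2 in auto)
      have conn: "connected (h ` {min s1 s2..max s1 s2})"
        by (rule connected_continuous_image[OF co]) simp
      have "l' \<in> h ` {min s1 s2..max s1 s2}"
        by (rule connectedD_interval[OF conn _ _ s2(1) s1(1)]) auto
      then obtain s where s: "min s1 s2 \<le> s" "s \<le> max s1 s2" "h s = l'" by auto
      have "\<bar>h s - l\<bar> < 1 / real (Suc k)" using l'(2) s(3) e(3) by simp
      moreover have "0 < s" using s(1) s1(2) s2(2) by linarith
      moreover have "s < min d (1 / real (Suc k))" using s(2) s1(3) s2(3) by linarith
      ultimately show ?thesis by blast
    qed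
    define s where "s k = (SOME s. 0 < s \<and> s < min d (1 / real (Suc k)) \<and> \<bar>h s - l\<bar> < 1 / real (Suc k))" for k
    have s: "0 < s k" "s k < min d (1 / real (Suc k))" "\<bar>h (s k) - l\<bar> < 1 / real (Suc k)" for k
      using someI_ex[OF ex[of k]] unfolding s_def by blast+
    have lim0: "(\<lambda>k. 1 / real (Suc k)) \<longlonglongrightarrow> 0" by real_asymp
    have "s \<longlonglongrightarrow> 0"
    proof (rule tendsto_sandwich[OF _ _ tendsto_const lim0])
      show "\<forall>\<^sub>F k in sequentially. 0 \<le> s k" using s(1) by (simp add: less_imp_le)
      show "\<forall>\<^sub>F k in sequentially. s k \<le> 1 / real (Suc k)" using s(2) by (intro always_eventually allI less_imp_le) simp
    qed
    hence fl: "filterlim s (at_right 0) sequentially"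
      unfolding filterlim_at using s(1) by (auto simp: less_imp_neq[THEN not_sym])
    have "(\<lambda>k. h (s k) - l) \<longlonglongrightarrow> 0"
      by (rule Lim_null_comparison[OF _ lim0]) (use s(3) in \<open>auto intro!: always_eventually less_imp_le\<close>)
    hence "(\<lambda>k. h (s k)) \<longlonglongrightarrow> l" by (simp add: LIM_zero_iff)
    from tendsto_add[OF this filterlim_compose[OF diff fl]]
    have "(\<lambda>k. g (s k)) \<longlonglongrightarrow> l" by simp
    thus "l \<in> limit_points (at_right 0) g" unfolding limit_points_def using fl by blast
  qed
qed

theorem corollary2:
  fixes M :: "'a measure" and f :: "nat \<Rightarrow> 'a \<Rightarrow> real"
  assumes "rademacher_multiplicative M f"
  shows "AE \<omega> in M.
    limit_points (at 0 within {0<..<exp (- exp 1)})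
      (\<lambda>s. sqrt (1 / (2 * ln (1 / s) * ln (ln (ln (1 / s)))))
            * (ln (dirichlet_F f \<omega> s) + ln (zeta_real (1 + 2 * s)) / 2)) = {-1..1}"
proof -
  interpret rademacher_multiplicative M f by fact
  define d where "d = exp (- exp (1::real))"
  have norm_pos: "0 < lil_norm s" "0 < ln (1 / s)" "0 < ln (ln (1 / s))" "0 < ln (ln (ln (1 / s)))"
    if "s \<in> {0<..<d}" for s
  proof -
    have s: "0 < s" "s < d" using that by auto
    have "ln s < - exp 1" using s ln_less_cancel_iff[of s d] unfolding d_def by simp
    hence 1: "exp 1 < ln (1 / s)" using s by (simp add: ln_div)
    show p1: "0 < ln (1 / s)" using 1 by (meson exp_gt_zero less_trans)
    have "ln (exp 1) < ln (ln (1 / s))" using 1 p1 by (simp only: ln_less_cancel_iff exp_gt_zero)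
    hence 2: "1 < ln (ln (1 / s))" by simp
    thus "0 < ln (ln (1 / s))" by simp
    show p3: "0 < ln (ln (ln (1 / s)))" using 2 by simp
    show "0 < lil_norm s" unfolding lil_norm_def using p1 p3 by simp
  qed
  have ev_d: "\<forall>\<^sub>F s in at_right 0. s \<in> {0<..<d}"
    unfolding eventually_at_right_field d_def by (intro exI[of _ "exp (- exp 1)"]) auto
  have norm_top: "filterlim lil_norm at_top (at_right 0)"
    unfolding lil_norm_def[abs_def] by real_asymp
  obtain C where C: "AE \<omega> in M. \<forall>s>0.
     \<bar>ln (dirichlet_F f \<omega> s) - (prime_series \<omega> s - prime_zeta (1 + 2 * s) / 2)\<bar> \<le> C" by (rule AE_ln_F)
  obtain C' where C': "\<And>s. 0 < s \<Longrightarrow> \<bar>ln (zeta_real (1 + 2 * s)) - prime_zeta (1 + 2 * s)\<bar> \<le> C'"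
    by (rule prime_zeta_asymp) blast
  have up: "AE \<omega> in M. \<forall>m. \<forall>\<^sub>F s in at_right 0. c * prime_series \<omega> s \<le> (1 + 1 / real (Suc m))\<^sup>2 * lil_norm s"
    if "\<bar>c\<bar> = 1" for c unfolding AE_all_countable using that by (intro allI AE_eventually_le) auto
  have low: "AE \<omega> in M. \<forall>m. \<exists>\<^sub>F s in at_right 0. c * prime_series \<omega> s \<ge> (1 - 3 * (1 / real (Suc (Suc m)))) * lil_norm s"
    if "\<bar>c\<bar> = 1" for c unfolding AE_all_countable using that by (intro allI AE_frequently_ge) auto
  have unit: "\<bar>1::real\<bar> = 1" "\<bar>-1::real\<bar> = 1" by auto
  show ?thesis
    using C up[OF unit(1)] up[OF unit(2)] low[OF unit(1)] low[OF unit(2)] AE_prime_series_summable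
    unfolding d_def[symmetric]
  proof eventually_elim
    case (elim \<omega>)
    define X where "X = prime_series \<omega>"
    show ?case
    proof (rule limit_points_eq_Icc[where h = "\<lambda>s. X s / lil_norm s"])
      show "d > 0" by (simp add: d_def)
      have cX: "continuous_on {0<..<d} X"
      proof (rule continuous_on_subset)
        show "continuous_on {0<..} X" unfolding X_def using elim(6) by (rule continuous_prime_series)
        show "{0<..<d} \<subseteq> {0<..}" by (rule subsetI) simp
      qed
      have c1: "continuous_on {0<..<d} (\<lambda>s. ln (1 / s))"
        by (intro continuous_on_ln continuous_on_divide continuous_on_const continuous_on_id) auto
      have c2: "continuous_on {0<..<d} (\<lambda>s. ln (ln (1 / s)))"
        by (rule continuous_on_ln[OF c1]) (use norm_pos(2) in \<open>simp add: less_imp_neq[THEN not_sym]\<close>)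
      have c3: "continuous_on {0<..<d} (\<lambda>s. ln (ln (ln (1 / s))))"
        by (rule continuous_on_ln[OF c2]) (use norm_pos(3) in \<open>simp add: less_imp_neq[THEN not_sym]\<close>)
      have "continuous_on {0<..<d} lil_norm"
        unfolding lil_norm_def[abs_def]
        by (intro continuous_on_real_sqrt continuous_on_mult continuous_on_const c1 c3)
      moreover have "\<forall>s\<in>{0<..<d}. lil_norm s \<noteq> 0" using norm_pos(1) by (metis less_irrefl)
      ultimately show "continuous_on {0<..<d} (\<lambda>s. X s / lil_norm s)"
        by (intro continuous_on_divide[OF cX])
      show "((\<lambda>s. sqrt (1 / (2 * ln (1 / s) * ln (ln (ln (1 / s))))) * (ln (dirichlet_F f \<omega> s) + ln (zeta_real (1 + 2 * s)) / 2)
           - X s / lil_norm s) \<longlongrightarrow> 0) (at_right 0)"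
      proof (rule Lim_null_comparison)
        show "((\<lambda>s. (C + C' / 2) / lil_norm s) \<longlongrightarrow> 0) (at_right 0)"
          by (rule tendsto_divide_0[OF tendsto_const]) (rule filterlim_at_top_imp_at_infinity[OF norm_top])
        show "\<forall>\<^sub>F s in at_right 0. norm (sqrt (1 / (2 * ln (1 / s) * ln (ln (ln (1 / s))))) * (ln (dirichlet_F f \<omega> s) + ln (zeta_real (1 + 2 * s)) / 2)
           - X s / lil_norm s) \<le> (C + C' / 2) / lil_norm s"
          using ev_d
        proof eventually_elim
          case (elim s)
          define y where "y = ln (dirichlet_F f \<omega> s) + ln (zeta_real (1 + 2 * s)) / 2"
          have s0: "s > 0" using elim by simp
          have "\<bar>y - X s\<bar> \<le> C + C' / 2"
            using \<open>\<forall>s>0. \<bar>ln (dirichlet_F f \<omega> s) - (prime_series \<omega> s - prime_zeta (1 + 2 * s) / 2)\<bar> \<le> C\<close>[rule_format, OF s0] C'[OF s0]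
            unfolding y_def X_def by linarith
          hence "\<bar>y - X s\<bar> / lil_norm s \<le> (C + C' / 2) / lil_norm s"
            using norm_pos(1)[OF elim] by (intro divide_right_mono) auto
          moreover have "sqrt (1 / (2 * ln (1 / s) * ln (ln (ln (1 / s))))) = 1 / lil_norm s"
            by (simp add: lil_norm_def real_sqrt_divide)
          moreover have "\<bar>1 / lil_norm s * y - X s / lil_norm s\<bar> = \<bar>y - X s\<bar> / lil_norm s"
          proof -
            have "1 / lil_norm s * y - X s / lil_norm s = (y - X s) / lil_norm s" by (simp add: diff_divide_distrib)
            thus ?thesis using norm_pos(1)[OF elim] by simp
          qed
          ultimately show ?case unfolding y_def[symmetric] by simp
        qed
      qed
      fix e :: real assume e: "e > 0"
      show "\<forall>\<^sub>F s in at_right 0. \<bar>X s / lil_norm s\<bar> \<le> 1 + e"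
      proof -
        have "(\<lambda>m. (1 + 1 / real (Suc m))\<^sup>2) \<longlonglongrightarrow> 1" by real_asymp
        hence "\<forall>\<^sub>F m in sequentially. (1 + 1 / real (Suc m))\<^sup>2 < 1 + e" using e by (intro order_tendstoD) auto
        then obtain m where m: "(1 + 1 / real (Suc m))\<^sup>2 < 1 + e" unfolding eventually_sequentially by blast
        show ?thesis
          using elim(2)[rule_format, of m] elim(3)[rule_format, of m] ev_d
        proof eventually_elim
          case (elim s)
          note p = norm_pos(1)[OF elim(3)]
          have "\<bar>X s\<bar> \<le> (1 + 1 / real (Suc m))\<^sup>2 * lil_norm s" using elim(1,2) by (simp add: X_def abs_le_iff)
          also have "\<dots> \<le> (1 + e) * lil_norm s" using m p by (intro mult_right_mono) auto
          finally show ?case using p by (simp add: pos_divide_le_eq)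
        qed
      qed
      obtain m where m: "3 * (1 / real (Suc (Suc m))) < e"
      proof -
        have "(\<lambda>m. 3 * (1 / real (Suc (Suc m)))) \<longlonglongrightarrow> 0" by real_asymp
        from order_tendstoD(2)[OF this e] show ?thesis using that unfolding eventually_sequentially by blast
      qed
      show "\<exists>\<^sub>F s in at_right 0. 1 - e \<le> X s / lil_norm s"
        using frequently_eventually_frequently[OF elim(4)[rule_format, of m] ev_d]
      proof (rule frequently_elim1)
        fix s assume s: "(1 - 3 * (1 / real (Suc (Suc m)))) * lil_norm s \<le> 1 * prime_series \<omega> s \<and> s \<in> {0<..<d}"
        note p = norm_pos(1)[of s]
        have "(1 - e) * lil_norm s \<le> (1 - 3 * (1 / real (Suc (Suc m)))) * lil_norm s"
          using m p s by (intro mult_right_mono) auto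
        hence "(1 - e) * lil_norm s \<le> X s" using s unfolding X_def by linarith
        thus "1 - e \<le> X s / lil_norm s" using s p by (simp add: pos_le_divide_eq)
      qed
      show "\<exists>\<^sub>F s in at_right 0. X s / lil_norm s \<le> - 1 + e"
        using frequently_eventually_frequently[OF elim(5)[rule_format, of m] ev_d]
      proof (rule frequently_elim1)
        fix s assume s: "(1 - 3 * (1 / real (Suc (Suc m)))) * lil_norm s \<le> -1 * prime_series \<omega> s \<and> s \<in> {0<..<d}"
        note p = norm_pos(1)[of s]
        have "(1 - e) * lil_norm s \<le> (1 - 3 * (1 / real (Suc (Suc m)))) * lil_norm s"
          using m p s by (intro mult_right_mono) auto
        hence "(1 - e) * lil_norm s \<le> - X s" using s unfolding X_def by linarith
        hence "X s \<le> (- 1 + e) * lil_norm s" by (simp add: algebra_simps)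
        thus "X s / lil_norm s \<le> - 1 + e" using s p by (simp add: pos_divide_le_eq)
      qed
    qed
  qed
qed

end
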